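(* The operator $\mathcal{H}:(cabv(T,X),\|\cdot\|)\to(cabv(T,X),\|\cdot\|)$, where $\|\cdot\|$ is the variational norm, is linear and continuous, and its operator norm with respect to the variational norm satisfies $$\|\mathcal{H}\|_{o,var}\leq\int_\Theta\|R_\theta\|_o\, dW(\theta).$$
   Context: $K$ is $\mathbb{R}$ or $\mathbb{C}$. $(\Theta,\Sigma,W)$ is a measure space, $(T,d)$ is a compact metric space with at least two elements, and $X$ is a non-null Hilbert space over $K$ with scalar product $(\cdot,\cdot)$, linear in the first and antilinear in the second variable. For a topological space $Z$, $\mathcal{B}_Z$ denotes its Borel $\sigma$-algebra. $\omega:T\times\Theta\to T$ is $(\mathcal{B}_T\otimes\Sigma,\mathcal{B}_T)$-measurable and $R:X\times\Theta\to X$ is $(\mathcal{B}_X\otimes\Sigma,\mathcal{B}_X)$-measurable. For $\theta\in\Theta$ put $\omega_\theta(t)=\omega(t,\theta)$ and $R_\theta(x)=R(x,\theta)$. For every $\theta\in\Theta$: $R_\theta$ is a continuous linear operator on $X$, with operator norm $\|R_\theta\|_o$; and $\omega_\theta:T\to T$ is Lipschitz with (smallest) Lipschitz constant $r_\theta=\sup_{s\ne t} d(\omega_\theta(s),\omega_\theta(t))/d(s,t)<\infty$. The function $\theta\mapsto\|R_\theta\|_o$ is assumed $\Sigma$-measurable ($\theta\mapsto r_\theta$ is then automatically $\Sigma$-measurable), and it is assumed that $\int_\Theta\|R_\theta\|_o(1+r_\theta)\,dW(\theta)<\infty$. $\mathcal{C}(T,X)$ is the Banach space of continuous functions $f:T\to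 X$ with norm $\|f\|_\infty=\sup_{t\in T}\|f(t)\|$, and $\mathcal{C}(T,X)'$ is its dual. The continuous linear operator $H_C:\mathcal{C}(T,X)\to\mathcal{C}(T,X)$ is given by the Bochner integral $H_C(f)(t)=\int_\Theta (R_\theta\circ f\circ\omega_\theta)(t)\,dW(\theta)$, and its adjoint $H_C':\mathcal{C}(T,X)'\to\mathcal{C}(T,X)'$ by $H_C'(y)=y\circ H_C$. $cabv(T,X)$ is the Banach space of $\sigma$-additive measures $\mu:\mathcal{B}_T\to X$ of finite total variation, with the variational norm $\|\mu\|=|\mu|(T)$. The (sesquilinear uniform) integral is defined as follows: for a simple function $f=\sum_{i=1}^m\varphi_{A_i}x_i$ (where $(A_i)$ is a partition of $T$ into Borel sets, $\varphi_{A_i}$ is the indicator function of $A_i$, $x_i\in X$) and $\mu\in cabv(T,X)$, $\int f\,d\mu=\sum_{i=1}^m(x_i,\mu(A_i))$; for $f$ a uniform limit of simple functions $f_m$ (in particular for every $f\in\mathcal{C}(T,X)$), $\int f\,d\mu=\lim_m\int f_m\,d\mu$. The map $\Phi:cabv(T,X)\to\mathcal{C}(T,X)'$, $\Phi(m)(f)=\int f\,dm$, is an antilinear isometric bijection. The operator $\mathcal{H}:cabv(T,X)\to cabv(T,X)$ is defined by $\mathcal{H}=\Phi^{-1}\circ H_C'\circ\Phi$. *)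

theory Defs
  imports "HOL-Analysis.Analysis"
begin

section \<open>The scalars and Hilbert spaces over them\<close>

text \<open>
  The first class axiom says that the field is \<open>\<real>\<close> or \<open>\<complex>\<close> (up to isomorphism); the other two
  force \<open>kcnj\<close> to be the identity on \<open>\<real>\<close> and the complex conjugation on \<open>\<complex>\<close>. Since \<open>of_real\<close>
  is not available in a class specification, \<open>a *\<^sub>R 1\<close> stands for \<open>of_real a\<close>.
\<close>

class real_or_complex = real_normed_field +
  fixes kcnj :: "'a \<Rightarrow> 'a"
  assumes real_or_complex:
      "(\<forall>x. \<exists>a. x = a *\<^sub>R 1) \<or> (\<exists>i. i * i = - 1 \<and> (\<forall>x. \<exists>a b. x = a *\<^sub>R 1 + b *\<^sub>R i))"
    and kcnj_add: "kcnj (x + y) = kcnj x + kcnj y"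
    and mult_kcnj: "x * kcnj x = ((norm x)\<^sup>2) *\<^sub>R 1"

instantiation real :: real_or_complex
begin
definition kcnj_real :: "real \<Rightarrow> real" where "kcnj_real x = x"
instance by standard (auto simp: kcnj_real_def power2_eq_square)
end

instantiation complex :: real_or_complex
begin
definition kcnj_complex :: "complex \<Rightarrow> complex" where "kcnj_complex x = cnj x"
instance
proof
  have "x = Re x *\<^sub>R 1 + Im x *\<^sub>R \<i>" for x
    by (simp add: complex_eq_iff)
  then show "(\<forall>x::complex. \<exists>a. x = a *\<^sub>R 1) \<or>
       (\<exists>i::complex. i * i = - 1 \<and> (\<forall>x. \<exists>a b. x = a *\<^sub>R 1 + b *\<^sub>R i))"
    using i_squared by blast
next
  show "x * kcnj x = ((norm x)\<^sup>2) *\<^sub>R 1" for x :: complex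
    using complex_norm_square[of x] by (simp add: kcnj_complex_def scaleR_conv_of_real)
qed (simp add: kcnj_complex_def)
end

text \<open>
  The underlying real Banach space of the Hilbert space is a type of class
  \<^class>\<open>banach\<close>; the scalar multiplication and the scalar product are parameters compatible with it.
\<close>

locale hilbert_space = vector_space smul
  for smul :: "'k::real_or_complex \<Rightarrow> 'x::banach \<Rightarrow> 'x" +
  fixes ip :: "'x \<Rightarrow> 'x \<Rightarrow> 'k"
  assumes smul_of_real: "smul (of_real r) x = r *\<^sub>R x"
    and ip_add_left: "ip (x + y) z = ip x z + ip y z"
    and ip_smul_left: "ip (smul c x) z = c * ip x z"
    and ip_commute: "ip y x = kcnj (ip x y)"
    and ip_self: "ip x x = of_real ((norm x)\<^sup>2)"


section \<open>The Bochner integral\<close>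

text \<open>
  The library's Bochner integral requires a second countable range space, which would restrict
  the Hilbert space to be separable. The following is its definition without that restriction.
\<close>

definition has_bochner ::
    "'a measure \<Rightarrow> ('a \<Rightarrow> 'b::real_normed_vector) \<Rightarrow> 'b \<Rightarrow> bool" where
  "has_bochner M f x \<longleftrightarrow>
     f \<in> borel_measurable M \<and>
     (\<exists>s. (\<forall>i. Bochner_Integration.simple_bochner_integrable M (s i)) \<and>
          (\<lambda>i. \<integral>\<^sup>+\<theta>. ennreal (norm (f \<theta> - s i \<theta>)) \<partial>M) \<longlonglongrightarrow> 0 \<and>
          (\<lambda>i. Bochner_Integration.simple_bochner_integral M (s i)) \<longlonglongrightarrow> x)"

lemma has_bochner_eq_has_bochner_integral:
  fixes f :: "'a \<Rightarrow> 'b::{real_normed_vector, second_countable_topology}"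
  shows "has_bochner M f x \<longleftrightarrow> has_bochner_integral M f x"
  unfolding has_bochner_def has_bochner_integral.simps by blast

definition bochner_integrable :: "'a measure \<Rightarrow> ('a \<Rightarrow> 'b::real_normed_vector) \<Rightarrow> bool" where
  "bochner_integrable M f \<longleftrightarrow> (\<exists>x. has_bochner M f x)"

definition bochner_integral :: "'a measure \<Rightarrow> ('a \<Rightarrow> 'b::real_normed_vector) \<Rightarrow> 'b" where
  "bochner_integral M f = (THE x. has_bochner M f x)"


section \<open>The space \<open>cabv(T,X)\<close>\<close>

definition variation ::
    "('t::topological_space set \<Rightarrow> 'x::real_normed_vector) \<Rightarrow> 't set \<Rightarrow> ennreal" where
  "variation \<mu> A =
     (SUP P \<in> {P. finite P \<and> partition_on A P \<and> P \<subseteq> sets borel}. \<Sum>B\<in>P. ennreal (norm (\<mu> B)))"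

text \<open>
  A vector measure is only defined on Borel sets; a function on all sets represents it uniquely
  when it is required to vanish off the Borel sets.
\<close>

definition cabv_set :: "('t::topological_space set \<Rightarrow> 'x::real_normed_vector) set" where
  "cabv_set = {\<mu>.
     (\<forall>A. range A \<subseteq> sets borel \<longrightarrow> disjoint_family A \<longrightarrow>
        (\<lambda>n::nat. \<mu> (A n)) sums \<mu> (\<Union>n. A n)) \<and>
     variation \<mu> UNIV < \<infinity> \<and>
     (\<forall>A. A \<notin> sets borel \<longrightarrow> \<mu> A = 0)}"

lemma variation_zero: "variation (\<lambda>_. 0) A = 0"
proof -
  have "variation (\<lambda>_. 0) A \<le> 0"
    unfolding variation_def by (rule SUP_least) simp
  then show ?thesis by simp
qed

lemma variation_add: "variation (\<lambda>A. \<mu> A + \<nu> A) S \<le> variation \<mu> S + variation \<nu> S"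
  unfolding variation_def
proof (rule SUP_least)
  fix P :: "'a set set" assume P: "P \<in> {P. finite P \<and> partition_on S P \<and> P \<subseteq> sets borel}"
  have "(\<Sum>B\<in>P. ennreal (norm (\<mu> B + \<nu> B)))
      \<le> (\<Sum>B\<in>P. ennreal (norm (\<mu> B)) + ennreal (norm (\<nu> B)))"
    by (intro sum_mono) (simp add: norm_triangle_ineq flip: ennreal_plus)
  also have "\<dots> = (\<Sum>B\<in>P. ennreal (norm (\<mu> B))) + (\<Sum>B\<in>P. ennreal (norm (\<nu> B)))"
    by (rule sum.distrib)
  also have "\<dots> \<le>
     (SUP P \<in> {P. finite P \<and> partition_on S P \<and> P \<subseteq> sets borel}. \<Sum>B\<in>P. ennreal (norm (\<mu> B))) +
     (SUP P \<in> {P. finite P \<and> partition_on S P \<and> P \<subseteq> sets borel}. \<Sum>B\<in>P. ennreal (norm (\<nu> B)))"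
    using P by (intro add_mono SUP_upper)
  finally show "(\<Sum>B\<in>P. ennreal (norm (\<mu> B + \<nu> B))) \<le> \<dots>" .
qed

lemma variation_scale:
  assumes "\<And>A. norm (\<nu> A) = c * norm (\<mu> A)" "c \<ge> 0"
  shows "variation \<nu> S = ennreal c * variation \<mu> S"
  unfolding variation_def
  by (simp only: assms(1) ennreal_mult[OF assms(2) norm_ge_zero] SUP_mult_left_ennreal
      sum_distrib_left)

lemma norm_le_variation:
  assumes "\<mu> {} = 0" "A \<in> sets borel"
  shows "ennreal (norm (\<mu> A)) \<le> variation \<mu> UNIV"
proof (cases "A = {}")
  case False
  have "ennreal (norm (\<mu> A)) \<le> (\<Sum>B\<in>{A, - A} - {{}}. ennreal (norm (\<mu> B)))"
    using False by (intro member_le_sum) auto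
  also have "\<dots> \<le> variation \<mu> UNIV"
    unfolding variation_def using assms(2)
    by (intro SUP_upper) (auto simp: partition_on_def disjoint_def)
  finally show ?thesis .
qed (simp add: assms(1))

lemma cabv_setD:
  assumes "\<mu> \<in> cabv_set"
  shows "range A \<subseteq> sets borel \<Longrightarrow> disjoint_family A \<Longrightarrow> (\<lambda>n::nat. \<mu> (A n)) sums \<mu> (\<Union>n. A n)"
    and "variation \<mu> UNIV < \<infinity>"
    and "B \<notin> sets borel \<Longrightarrow> \<mu> B = 0"
  using assms unfolding cabv_set_def by blast+

lemma cabv_setI:
  assumes "\<And>A. range A \<subseteq> sets borel \<Longrightarrow> disjoint_family A \<Longrightarrow> (\<lambda>n::nat. \<mu> (A n)) sums \<mu> (\<Union>n. A n)"
    and "variation \<mu> UNIV < \<infinity>"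
    and "\<And>B. B \<notin> sets borel \<Longrightarrow> \<mu> B = 0"
  shows "\<mu> \<in> cabv_set"
  using assms unfolding cabv_set_def by blast

lemma cabv_set_empty:
  assumes "\<mu> \<in> cabv_set"
  shows "\<mu> {} = 0"
proof -
  have "(\<lambda>n::nat. \<mu> {}) sums \<mu> (\<Union>n::nat. {})"
    by (rule cabv_setD(1)[OF assms]) (auto simp: disjoint_family_on_def)
  then show ?thesis
    using sums_summable summable_const_iff by blast
qed

lemma cabv_set_add:
  assumes "\<mu> \<in> cabv_set" "\<nu> \<in> cabv_set"
  shows "(\<lambda>A. \<mu> A + \<nu> A) \<in> cabv_set"
proof (rule cabv_setI)
  show "variation (\<lambda>A. \<mu> A + \<nu> A) UNIV < \<infinity>"
    using cabv_setD(2)[OF assms(1)] cabv_setD(2)[OF assms(2)]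
    by (intro le_less_trans[OF variation_add]) simp
qed (simp_all add: sums_add cabv_setD(1,3)[OF assms(1)] cabv_setD(1,3)[OF assms(2)])

lemma cabv_set_linear_image:
  assumes "\<mu> \<in> cabv_set" "bounded_linear h" "\<And>x. norm (h x) = c * norm x" "c \<ge> 0"
  shows "(\<lambda>A. h (\<mu> A)) \<in> cabv_set"
proof (rule cabv_setI)
  have "variation (\<lambda>A. h (\<mu> A)) UNIV = ennreal c * variation \<mu> UNIV"
    by (rule variation_scale[OF assms(3,4)])
  then show "variation (\<lambda>A. h (\<mu> A)) UNIV < \<infinity>"
    using cabv_setD(2)[OF assms(1)] by (simp add: ennreal_mult_less_top)
  have "h 0 = 0"
    by (rule linear_0[OF bounded_linear.linear[OF assms(2)]])
  then show "h (\<mu> B) = 0" if "B \<notin> sets borel" for B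
    by (simp add: cabv_setD(3)[OF assms(1) that])
qed (rule bounded_linear.sums[OF assms(2) cabv_setD(1)[OF assms(1)]])

lemma zero_in_cabv_set: "(\<lambda>_. 0) \<in> cabv_set"
  by (rule cabv_setI) (simp_all add: variation_zero)

typedef (overloaded) ('t, 'x) cabv =
  "cabv_set :: ('t::topological_space set \<Rightarrow> 'x::real_normed_vector) set"
  morphisms cabv_val Abs_cabv
  using zero_in_cabv_set by blast

lemma cabv_eqI: "(\<And>A. cabv_val \<mu> A = cabv_val \<nu> A) \<Longrightarrow> \<mu> = \<nu>"
  by (metis cabv_val_inject ext)

text \<open>The norm is the variational norm \<open>\<bar>\<mu>\<bar>(T)\<close>.\<close>

instantiation cabv :: (topological_space, real_normed_vector) real_normed_vector
begin

definition zero_cabv :: "('a, 'b) cabv" where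
  "0 = Abs_cabv (\<lambda>_. 0)"

definition plus_cabv :: "('a, 'b) cabv \<Rightarrow> ('a, 'b) cabv \<Rightarrow> ('a, 'b) cabv" where
  "\<mu> + \<nu> = Abs_cabv (\<lambda>A. cabv_val \<mu> A + cabv_val \<nu> A)"

definition scaleR_cabv :: "real \<Rightarrow> ('a, 'b) cabv \<Rightarrow> ('a, 'b) cabv" where
  "r *\<^sub>R \<mu> = Abs_cabv (\<lambda>A. r *\<^sub>R cabv_val \<mu> A)"

definition uminus_cabv :: "('a, 'b) cabv \<Rightarrow> ('a, 'b) cabv" where
  "- \<mu> = (- 1) *\<^sub>R (\<mu> :: ('a, 'b) cabv)"

definition minus_cabv :: "('a, 'b) cabv \<Rightarrow> ('a, 'b) cabv \<Rightarrow> ('a, 'b) cabv" where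
  "\<mu> - \<nu> = \<mu> + - (\<nu> :: ('a, 'b) cabv)"

definition norm_cabv :: "('a, 'b) cabv \<Rightarrow> real" where
  "norm \<mu> = enn2real (variation (cabv_val \<mu>) UNIV)"

definition dist_cabv :: "('a, 'b) cabv \<Rightarrow> ('a, 'b) cabv \<Rightarrow> real" where
  "dist \<mu> \<nu> = norm (\<mu> - \<nu> :: ('a, 'b) cabv)"

definition sgn_cabv :: "('a, 'b) cabv \<Rightarrow> ('a, 'b) cabv" where
  "sgn \<mu> = inverse (norm \<mu>) *\<^sub>R (\<mu> :: ('a, 'b) cabv)"

definition uniformity_cabv :: "(('a, 'b) cabv \<times> ('a, 'b) cabv) filter" where
  "uniformity_cabv = (INF e\<in>{0 <..}. principal {(x, y). dist x y < e})"

definition open_cabv :: "('a, 'b) cabv set \<Rightarrow> bool" where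
  "open_cabv S = (\<forall>x\<in>S. \<forall>\<^sub>F (x', y) in uniformity. x' = x \<longrightarrow> y \<in> S)"

lemma cabv_val_zero: "cabv_val (0 :: ('a, 'b) cabv) A = 0"
  by (simp add: zero_cabv_def Abs_cabv_inverse zero_in_cabv_set)

lemma cabv_val_plus: "cabv_val (\<mu> + \<nu> :: ('a, 'b) cabv) A = cabv_val \<mu> A + cabv_val \<nu> A"
  by (simp add: plus_cabv_def Abs_cabv_inverse cabv_set_add cabv_val)

lemma cabv_val_scaleR: "cabv_val (r *\<^sub>R \<mu> :: ('a, 'b) cabv) A = r *\<^sub>R cabv_val \<mu> A"
proof -
  have "(\<lambda>A. r *\<^sub>R cabv_val \<mu> A) \<in> cabv_set"
    by (rule cabv_set_linear_image[where c = "\<bar>r\<bar>"]) (auto simp: cabv_val bounded_linear_scaleR_right)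
  then show ?thesis
    by (simp add: scaleR_cabv_def Abs_cabv_inverse)
qed

lemma cabv_val_uminus: "cabv_val (- \<mu> :: ('a, 'b) cabv) A = - cabv_val \<mu> A"
  by (simp add: uminus_cabv_def cabv_val_scaleR)

lemma cabv_val_minus: "cabv_val (\<mu> - \<nu> :: ('a, 'b) cabv) A = cabv_val \<mu> A - cabv_val \<nu> A"
  by (simp add: minus_cabv_def cabv_val_plus cabv_val_uminus)

lemma variation_cabv_finite: "variation (cabv_val (\<mu> :: ('a, 'b) cabv)) UNIV < \<infinity>"
  by (rule cabv_setD(2)[OF cabv_val])

instance
proof
  fix \<mu> \<nu> \<rho> :: "('a, 'b) cabv" and r s :: real
  note vals = cabv_val_zero cabv_val_plus cabv_val_scaleR cabv_val_uminus cabv_val_minus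
  show "\<mu> + \<nu> + \<rho> = \<mu> + (\<nu> + \<rho>)" "\<mu> + \<nu> = \<nu> + \<mu>" "0 + \<mu> = \<mu>" "- \<mu> + \<mu> = 0" "\<mu> - \<nu> = \<mu> + - \<nu>"
    by (rule cabv_eqI, simp add: vals)+
  show "r *\<^sub>R (\<mu> + \<nu>) = r *\<^sub>R \<mu> + r *\<^sub>R \<nu>" "(r + s) *\<^sub>R \<mu> = r *\<^sub>R \<mu> + s *\<^sub>R \<mu>"
    "r *\<^sub>R s *\<^sub>R \<mu> = (r * s) *\<^sub>R \<mu>" "1 *\<^sub>R \<mu> = \<mu>"
    by (rule cabv_eqI, simp add: vals algebra_simps)+
  show "dist \<mu> \<nu> = norm (\<mu> - \<nu>)" "sgn \<mu> = inverse (norm \<mu>) *\<^sub>R \<mu>"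
    by (simp_all add: dist_cabv_def sgn_cabv_def)
  show "(uniformity :: (('a, 'b) cabv \<times> ('a, 'b) cabv) filter) =
      (INF e\<in>{0 <..}. principal {(x, y). dist x y < e})"
    by (simp add: uniformity_cabv_def)
  show "open U \<longleftrightarrow> (\<forall>x\<in>U. \<forall>\<^sub>F (x', y) in uniformity. x' = x \<longrightarrow> y \<in> U)"
    for U :: "('a, 'b) cabv set"
    by (simp add: open_cabv_def)
  show "norm \<mu> = 0 \<longleftrightarrow> \<mu> = 0"
  proof
    assume "norm \<mu> = 0"
    then have v: "variation (cabv_val \<mu>) UNIV = 0"
      using variation_cabv_finite[of \<mu>] by (auto simp: norm_cabv_def enn2real_eq_0_iff)
    show "\<mu> = 0"
    proof (rule cabv_eqI)
      fix A show "cabv_val \<mu> A = cabv_val 0 A"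
      proof (cases "A \<in> sets borel")
        case True
        then have "ennreal (norm (cabv_val \<mu> A)) \<le> 0"
          using norm_le_variation[of "cabv_val \<mu>" A] cabv_set_empty[OF cabv_val] v by metis
        then show ?thesis by (simp add: vals)
      next
        case False
        then have "cabv_val \<mu> A = 0"
          by (rule cabv_setD(3)[OF cabv_val])
        then show ?thesis by (simp add: vals)
      qed
    qed
  next
    assume "\<mu> = 0"
    then have "cabv_val \<mu> = (\<lambda>_. 0)" by (simp add: vals fun_eq_iff)
    then show "norm \<mu> = 0" by (simp add: norm_cabv_def variation_zero)
  qed
  have "cabv_val (\<mu> + \<nu>) = (\<lambda>A. cabv_val \<mu> A + cabv_val \<nu> A)"
    by (simp add: vals fun_eq_iff)
  then show "norm (\<mu> + \<nu>) \<le> norm \<mu> + norm \<nu>"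
    using variation_add[of "cabv_val \<mu>" "cabv_val \<nu>" UNIV]
      variation_cabv_finite[of \<mu>] variation_cabv_finite[of \<nu>]
    by (simp add: norm_cabv_def enn2real_mono flip: enn2real_plus)
  have "variation (cabv_val (r *\<^sub>R \<mu>)) UNIV = ennreal \<bar>r\<bar> * variation (cabv_val \<mu>) UNIV"
    by (rule variation_scale) (simp_all add: vals)
  then show "norm (r *\<^sub>R \<mu>) = \<bar>r\<bar> * norm \<mu>"
    by (simp add: norm_cabv_def enn2real_mult)
qed

end

definition smul_cabv ::
    "('k \<Rightarrow> 'x \<Rightarrow> 'x) \<Rightarrow> 'k \<Rightarrow> ('t::topological_space, 'x::real_normed_vector) cabv \<Rightarrow> ('t, 'x) cabv"
  where "smul_cabv smul c \<mu> = Abs_cabv (\<lambda>A. smul c (cabv_val \<mu> A))"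


section \<open>The sesquilinear uniform integral\<close>

definition sesq_integral_simple ::
    "('x \<Rightarrow> 'x \<Rightarrow> 'k) \<Rightarrow> ('t \<Rightarrow> 'x) \<Rightarrow> ('t::topological_space, 'x::real_normed_vector) cabv
      \<Rightarrow> 'k::real_or_complex" where
  "sesq_integral_simple ip f \<mu> = (\<Sum>x\<in>range f. ip x (cabv_val \<mu> (f -` {x})))"

definition has_sesq_integral ::
    "('x \<Rightarrow> 'x \<Rightarrow> 'k) \<Rightarrow> ('t \<Rightarrow> 'x) \<Rightarrow> ('t::topological_space, 'x::real_normed_vector) cabv
      \<Rightarrow> 'k::real_or_complex \<Rightarrow> bool" where
  "has_sesq_integral ip f \<mu> z \<longleftrightarrow>
     (\<exists>s. (\<forall>m. simple_function borel (s m)) \<and> uniform_limit UNIV s f sequentially \<and>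
          (\<lambda>m. sesq_integral_simple ip (s m) \<mu>) \<longlonglongrightarrow> z)"

definition sesq_integral ::
    "('x \<Rightarrow> 'x \<Rightarrow> 'k) \<Rightarrow> ('t \<Rightarrow> 'x) \<Rightarrow> ('t::topological_space, 'x::real_normed_vector) cabv
      \<Rightarrow> 'k::real_or_complex" where
  "sesq_integral ip f \<mu> = (THE z. has_sesq_integral ip f \<mu> z)"


section \<open>The operators\<close>

text \<open>
  As \<open>T\<close> is compact, \<^typ>\<open>'t \<Rightarrow>\<^sub>C 'x\<close> is \<open>\<C>(T,X)\<close> with the supremum norm.
\<close>

definition H_C ::
    "'th measure \<Rightarrow> ('x \<times> 'th \<Rightarrow> 'x) \<Rightarrow> ('t \<times> 'th \<Rightarrow> 't)
      \<Rightarrow> ('t::metric_space \<Rightarrow>\<^sub>C 'x::real_normed_vector) \<Rightarrow> ('t \<Rightarrow>\<^sub>C 'x)" where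
  "H_C W R \<omega> f = Bcontfun (\<lambda>t. bochner_integral W (\<lambda>\<theta>. R (apply_bcontfun f (\<omega> (t, \<theta>)), \<theta>)))"

definition H_C_adjoint ::
    "'th measure \<Rightarrow> ('x \<times> 'th \<Rightarrow> 'x) \<Rightarrow> ('t \<times> 'th \<Rightarrow> 't)
      \<Rightarrow> (('t::metric_space \<Rightarrow>\<^sub>C 'x::real_normed_vector) \<Rightarrow> 'k) \<Rightarrow> (('t \<Rightarrow>\<^sub>C 'x) \<Rightarrow> 'k)" where
  "H_C_adjoint W R \<omega> y = y \<circ> H_C W R \<omega>"

definition Phi ::
    "('x \<Rightarrow> 'x \<Rightarrow> 'k) \<Rightarrow> ('t::metric_space, 'x::real_normed_vector) cabv
      \<Rightarrow> (('t \<Rightarrow>\<^sub>C 'x) \<Rightarrow> 'k::real_or_complex)" where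
  "Phi ip m = (\<lambda>f. sesq_integral ip (apply_bcontfun f) m)"

text \<open>
  \<^term>\<open>Phi ip\<close> is injective, and its range is the dual of \<open>\<C>(T,X)\<close>; on that range,
  \<^term>\<open>inv (Phi ip)\<close> is its inverse.
\<close>

definition H_op ::
    "('x \<Rightarrow> 'x \<Rightarrow> 'k::real_or_complex) \<Rightarrow> 'th measure \<Rightarrow> ('x \<times> 'th \<Rightarrow> 'x) \<Rightarrow> ('t \<times> 'th \<Rightarrow> 't)
      \<Rightarrow> ('t::metric_space, 'x::real_normed_vector) cabv \<Rightarrow> ('t, 'x) cabv" where
  "H_op ip W R \<omega> = inv (Phi ip) \<circ> H_C_adjoint W R \<omega> \<circ> Phi ip"

definition lipschitz_constant :: "('t::metric_space \<Rightarrow> 't) \<Rightarrow> real" where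
  "lipschitz_constant g = (SUP (s, t)\<in>{(s, t). s \<noteq> t}. dist (g s) (g t) / dist s t)"

end

theory Submission
  imports Defs
begin

text \<open>
  Write \<open>\<Phi>\<close> for \<^term>\<open>Phi ip\<close>. The operator is determined by
  \<open>\<Phi> (\<H> \<mu>) = \<Phi> \<mu> \<circ> H\<^sub>C\<close>, so everything follows from two estimates and from the
  representation of functionals on \<open>\<C>(T,X)\<close> by vector measures. On the one hand
  \<open>\<parallel>H\<^sub>C f\<parallel> \<le> (\<integral> \<parallel>R\<^sub>\<theta>\<parallel> dW) \<parallel>f\<parallel>\<close> (lemma \<open>norm_H_le\<close>) and
  \<open>\<bar>\<Phi> \<mu> f\<bar> \<le> \<parallel>f\<parallel> \<parallel>\<mu>\<parallel>\<close> (lemma \<open>norm_sesq_integral_le\<close>), hence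
  the functional \<open>\<Phi> \<mu> \<circ> H\<^sub>C\<close> has norm at most
  \<open>(\<integral> \<parallel>R\<^sub>\<theta>\<parallel> dW) \<parallel>\<mu>\<parallel>\<close>. On the other hand every functional of norm at most \<open>B\<close> is
  \<open>\<Phi> \<nu>\<close> for exactly one \<open>\<nu>\<close>, and \<open>\<parallel>\<nu>\<parallel> \<le> B\<close>. Applied to \<open>\<Phi> \<mu> \<circ> H\<^sub>C\<close> this gives the
  bound; as \<open>\<Phi>\<close> is antilinear on both sides of the defining equation, uniqueness also gives
  the linearity of \<open>\<H>\<close>.

  Existence of \<open>\<nu>\<close> (theorem \<open>sesq_integral_rep_measure\<close>) is proved without a decomposition into
  scalar functionals. For a real functional \<open>L\<close> the set function
  \<open>U \<mapsto> sup {L f. \<parallel>f\<parallel> \<le> 1\<^sub>U}\<close> on open sets generates an outer measure for which Borel sets are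
  measurable, and slicing \<open>f\<close> by the values of its norm shows \<open>L f \<le> \<integral> \<parallel>f\<parallel> d\<rho>\<close> for the
  resulting measure \<open>\<rho>\<close>, whose total mass is at most \<open>B\<close> (theorem \<open>L_le_integral_norm\<close>). So the
  functional extends from continuous functions to \<open>1\<^sub>A x\<close> for Borel sets \<open>A\<close>, because
  continuous functions are dense in \<open>L\<^sup>1(\<rho>)\<close>. The extension is continuous and linear in \<open>x\<close>, so
  it is \<open>x \<mapsto> (x, \<nu>(A))\<close> by the Frechet-Riesz theorem, and \<open>\<parallel>\<nu>(A)\<parallel> \<le> \<rho>(A)\<close> makes \<open>\<nu>\<close> countably
  additive with \<open>\<bar>\<nu>\<bar>(T) \<le> \<rho>(T) \<le> B\<close>.

  Uniqueness (lemma \<open>cabv_eq_0_if_integrals_vanish\<close>) rests on the same density, now in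
  \<open>L\<^sup>1(\<bar>\<nu>\<bar>)\<close>, and on the fact that the variation \<open>\<bar>\<nu>\<bar>\<close> is itself a measure.

  The Hilbert space may be non-separable. Then sums of measurable functions need not be
  measurable, and the arguments about Bochner integrals compare measurable functions with
  simple functions only.
\<close>


section \<open>The scalar field\<close>

text \<open>
  The real part \<open>(z + kcnj z) / 2\<close> as a real number: expanding \<open>(1 + z) * kcnj (1 + z)\<close> gives
  \<open>\<bar>1 + z\<bar>\<^sup>2 = 1 + (z + kcnj z) + \<bar>z\<bar>\<^sup>2\<close>. This form needs no case distinction between the two fields.
\<close>

definition kre :: "'k::real_or_complex \<Rightarrow> real" where
  "kre z = ((norm (1 + z))\<^sup>2 - 1 - (norm z)\<^sup>2) / 2"

lemma mult_kcnj_of_real: "z * kcnj z = of_real ((norm z)\<^sup>2)" for z :: "'k::real_or_complex"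
  using mult_kcnj[of z] by (simp add: scaleR_conv_of_real)

lemma kcnj_0 [simp]: "kcnj 0 = (0::'k::real_or_complex)"
  using kcnj_add[of "0::'k" 0] by simp

lemma kcnj_unique: "z \<noteq> 0 \<Longrightarrow> z * w = of_real ((norm z)\<^sup>2) \<Longrightarrow> kcnj z = w"
  for z :: "'k::real_or_complex"
  by (metis mult_kcnj_of_real mult_left_cancel)

lemma kcnj_of_real [simp]: "kcnj (of_real r) = (of_real r :: 'k::real_or_complex)"
  by (cases "r = 0") (auto intro!: kcnj_unique simp: power2_eq_square simp flip: of_real_mult)

lemma kcnj_mult: "kcnj (z * w) = kcnj z * kcnj w" for z w :: "'k::real_or_complex"
proof (cases "z = 0 \<or> w = 0")
  case False
  have "z * w * (kcnj z * kcnj w) = (z * kcnj z) * (w * kcnj w)" by simp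
  also have "\<dots> = of_real ((norm (z * w))\<^sup>2)"
    by (simp only: mult_kcnj_of_real norm_mult power_mult_distrib of_real_mult)
  finally show ?thesis using False by (intro kcnj_unique) auto
qed auto

lemma norm_kcnj [simp]: "norm (kcnj z) = norm z" for z :: "'k::real_or_complex"
proof (cases "z = 0")
  case False
  have "norm z * norm (kcnj z) = norm z * norm z"
    unfolding norm_mult[symmetric] mult_kcnj_of_real by (simp add: power2_eq_square norm_mult)
  with False show ?thesis by simp
qed simp

lemma kcnj_kcnj [simp]: "kcnj (kcnj z) = z" for z :: "'k::real_or_complex"
proof (cases "z = 0")
  case False
  then have "kcnj z \<noteq> 0" by (metis norm_eq_zero norm_kcnj)
  then show ?thesis by (rule kcnj_unique) (use mult_kcnj_of_real[of z] in \<open>simp add: mult.commute\<close>)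
qed simp

lemma of_real_kre: "of_real (2 * kre z) = z + kcnj z" for z :: "'k::real_or_complex"
proof -
  have "of_real ((norm (1 + z))\<^sup>2) = (1 + z) * (1 + kcnj z)"
    by (metis kcnj_add kcnj_of_real mult_kcnj_of_real of_real_1)
  also have "\<dots> = 1 + (z + kcnj z) + of_real ((norm z)\<^sup>2)"
    unfolding mult_kcnj_of_real[symmetric] by (simp add: algebra_simps)
  finally show ?thesis by (simp add: kre_def)
qed

lemma kre_eqI: "z + kcnj z = of_real (2 * r) \<Longrightarrow> kre z = r" for z :: "'k::real_or_complex"
  by (metis of_real_kre of_real_eq_iff mult_cancel_left zero_neq_numeral)

lemma kre_add: "kre (z + w) = kre z + kre w" for z :: "'k::real_or_complex"
  by (rule kre_eqI) (simp add: kcnj_add of_real_kre algebra_simps flip: of_real_kre)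

lemma kre_of_real_mult: "kre (of_real r * z) = r * kre z" for z :: "'k::real_or_complex"
proof (rule kre_eqI)
  have "of_real r * z + kcnj (of_real r * z) = of_real r * (z + kcnj z)"
    by (simp add: kcnj_mult distrib_left)
  then show "of_real r * z + kcnj (of_real r * z) = of_real (2 * (r * kre z))"
    by (simp flip: of_real_kre)
qed

lemma kre_of_real [simp]: "kre (of_real r :: 'k::real_or_complex) = r"
  by (rule kre_eqI) simp

lemma kre_minus: "kre (- z) = - kre z" for z :: "'k::real_or_complex"
  using kre_of_real_mult[of "-1" z] by simp

lemma kre_diff: "kre (z - w) = kre z - kre w" for z :: "'k::real_or_complex"
  using kre_add[of z "- w"] by (simp add: kre_minus)

lemma kre_kcnj [simp]: "kre (kcnj z) = kre z" for z :: "'k::real_or_complex"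
  by (rule kre_eqI) (simp only: of_real_kre kcnj_kcnj add.commute)

lemma kre_le_norm: "kre z \<le> norm z" for z :: "'k::real_or_complex"
proof -
  have "norm (1 + z) \<le> 1 + norm z" using norm_triangle_ineq[of 1 z] by simp
  then have "(norm (1 + z))\<^sup>2 \<le> (1 + norm z)\<^sup>2" by (rule power_mono) simp
  then show ?thesis by (simp add: kre_def power2_sum)
qed

lemma abs_kre_le_norm: "\<bar>kre z\<bar> \<le> norm z" for z :: "'k::real_or_complex"
  using kre_le_norm[of z] kre_le_norm[of "- z"] by (simp add: kre_minus)

lemma kre_mult_kcnj: "kre (kcnj z * z) = (norm z)\<^sup>2" for z :: "'k::real_or_complex"
  by (simp only: mult.commute[of "kcnj z"] mult_kcnj_of_real kre_of_real)

text \<open>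
  With \<open>c = kcnj (z - w)\<close> the hypothesis says \<open>\<bar>z - w\<bar>\<^sup>2 = 0\<close>. This transfers identities that are
  linear in the scalar from real parts to scalars.
\<close>

lemma scalar_eq_via_kre: "(\<And>c. kre (c * z) = kre (c * w)) \<Longrightarrow> z = w" for z w :: "'k::real_or_complex"
  using kre_mult_kcnj[of "z - w"] by (simp add: right_diff_distrib kre_diff)

lemma obtain_phase:
  fixes z :: "'k::real_or_complex"
  obtains c where "norm c \<le> 1" "kre (c * z) = norm z"
proof (cases "z = 0")
  case True
  then show ?thesis using that[of 0] kre_of_real[of 0, where 'k='k] by simp
next
  case False
  let ?c = "of_real (1 / norm z) * kcnj z"
  have "norm ?c \<le> 1" using False by (simp add: norm_mult norm_divide)
  moreover have "kre (?c * z) = norm z"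
    unfolding mult.assoc kre_of_real_mult kre_mult_kcnj
    using False by (simp add: power2_eq_square)
  ultimately show ?thesis by (rule that)
qed

text \<open>
  The class of the scalars does not contain completeness. It comes from the real coordinates
  \<open>kre z\<close> and \<open>kre (- i * z)\<close>, which are Cauchy sequences of real numbers.
\<close>

lemma scalar_complete:
  fixes z :: "nat \<Rightarrow> 'k::real_or_complex"
  assumes "Cauchy z"
  shows "convergent z"
proof -
  have cauchy_part: "convergent (\<lambda>n. kre (c * z n))" for c
  proof (rule Cauchy_convergent, rule CauchyI)
    fix e :: real assume "e > 0"
    then have "e / (norm c + 1) > 0" by (simp add: add_nonneg_pos)
    with assms obtain M where M: "\<And>m n. m \<ge> M \<Longrightarrow> n \<ge> M \<Longrightarrow> norm (z m - z n) < e / (norm c + 1)"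
      unfolding Cauchy_iff by blast
    have "norm (kre (c * z m) - kre (c * z n)) < e" if "m \<ge> M" "n \<ge> M" for m n
    proof -
      have "norm (kre (c * z m) - kre (c * z n)) \<le> norm c * norm (z m - z n)"
        using abs_kre_le_norm[of "c * (z m - z n)"]
        by (simp add: right_diff_distrib kre_diff norm_mult flip: norm_mult)
      also have "\<dots> \<le> (norm c + 1) * norm (z m - z n)"
        by (intro mult_right_mono) auto
      also have "\<dots> < e"
        using M[OF that] by (subst (asm) pos_less_divide_eq) (simp_all add: add_nonneg_pos mult.commute)
      finally show ?thesis .
    qed
    then show "\<exists>M. \<forall>m\<ge>M. \<forall>n\<ge>M. norm (kre (c * z m) - kre (c * z n)) < e" by blast
  qed
  consider "\<forall>x::'k. \<exists>a. x = a *\<^sub>R 1"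
    | i where "i * i = (- 1 :: 'k)" "\<forall>x::'k. \<exists>a b. x = a *\<^sub>R 1 + b *\<^sub>R i"
    using real_or_complex by blast
  then show ?thesis
  proof cases
    case 1
    have "w = of_real (kre w)" for w :: 'k
      using 1[rule_format, of w] by (auto simp: scaleR_conv_of_real)
    then have "z = (\<lambda>n. of_real (kre (1 * z n)))" by (simp add: fun_eq_iff)
    moreover have "convergent (\<lambda>n. of_real (kre (1 * z n)) :: 'k)"
      using convergentI[OF tendsto_of_real[OF convergent_LIMSEQ_iff[THEN iffD1, OF cauchy_part[of 1]]]] .
    ultimately show ?thesis by simp
  next
    case 2
    have ni: "norm i = 1"
      using arg_cong[OF 2(1), of norm] by (simp add: norm_mult) (metis abs_norm_cancel real_sqrt_abs2 real_sqrt_one)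
    have ki: "kcnj i = - i"
      by (rule kcnj_unique) (use 2(1) ni in auto)
    have kre_i: "kre i = 0" by (rule kre_eqI) (simp add: ki)
    have dec: "w = of_real (kre w) + of_real (kre (- i * w)) * i" for w
    proof -
      obtain a b where w: "w = of_real a + of_real b * i"
        using 2(2) by (metis scaleR_conv_of_real mult.right_neutral)
      have ii: "i * (i * x) = - x" for x using 2(1) by (simp flip: mult.assoc)
      have "- i * w = of_real (- a) * i + of_real b"
        unfolding w by (simp add: algebra_simps ii)
      then have "kre (- i * w) = b"
        by (simp only: kre_add kre_of_real kre_of_real_mult kre_i)
      moreover have "kre w = a" unfolding w by (simp only: kre_add kre_of_real kre_of_real_mult kre_i)
      ultimately show ?thesis using w by simp
    qed
    have "convergent (\<lambda>n. of_real (kre (1 * z n)) + of_real (kre (- i * z n)) * i)"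
      using convergentI[OF tendsto_add[OF tendsto_of_real
            tendsto_mult[OF tendsto_of_real tendsto_const]],
          OF cauchy_part[of 1, unfolded convergent_LIMSEQ_iff]
            cauchy_part[of "- i", unfolded convergent_LIMSEQ_iff]] .
    then show ?thesis using dec by simp
  qed
qed


section \<open>Hilbert spaces\<close>

context hilbert_space
begin

lemma norm_smul [simp]: "norm (smul c x) = norm c * norm x"
proof -
  have "of_real ((norm (smul c x))\<^sup>2) = (c * kcnj c) * ip x x"
    by (metis ip_self ip_smul_left ip_commute kcnj_mult mult.assoc mult.commute)
  also have "\<dots> = of_real ((norm c * norm x)\<^sup>2)"
    by (simp only: mult_kcnj_of_real ip_self power_mult_distrib of_real_mult)
  finally have "(norm (smul c x))\<^sup>2 = (norm c * norm x)\<^sup>2" by (simp only: of_real_eq_iff)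
  then show ?thesis by (simp add: power2_eq_iff_nonneg)
qed

lemma smul_scaleR: "smul c (r *\<^sub>R x) = r *\<^sub>R smul c x"
  by (simp add: mult.commute flip: smul_of_real)

lemma bounded_linear_smul: "bounded_linear (smul c)"
  by (rule bounded_linear_intro[where K = "norm c"])
    (simp_all add: scale_right_distrib smul_scaleR mult.commute)

lemma ip_add_right: "ip x (y + z) = ip x y + ip x z"
  by (metis ip_commute ip_add_left kcnj_add)

lemma ip_smul_right: "ip x (smul c y) = kcnj c * ip x y"
  by (metis ip_commute ip_smul_left kcnj_mult)

lemma ip_scaleR_left: "ip (r *\<^sub>R x) y = of_real r * ip x y"
  using ip_smul_left[of "of_real r" x y] by (simp add: smul_of_real)

lemma ip_scaleR_right: "ip x (r *\<^sub>R y) = of_real r * ip x y"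
  using ip_smul_right[of x "of_real r" y] by (simp add: smul_of_real)

lemma norm_add_sq: "(norm (x + y))\<^sup>2 = (norm x)\<^sup>2 + 2 * kre (ip x y) + (norm y)\<^sup>2"
proof -
  have c: "ip y x = kcnj (ip x y)" by (rule ip_commute)
  have "of_real ((norm (x + y))\<^sup>2) = ip (x + y) (x + y)" by (simp only: ip_self)
  also have "\<dots> = of_real ((norm x)\<^sup>2) + (ip x y + kcnj (ip x y)) + of_real ((norm y)\<^sup>2)"
    by (simp only: ip_add_left ip_add_right ip_self[of x] ip_self[of y] c add.assoc
        add.left_commute)
  also have "\<dots> = of_real ((norm x)\<^sup>2 + 2 * kre (ip x y) + (norm y)\<^sup>2)"
    by (simp only: of_real_kre[symmetric] of_real_add)
  finally show ?thesis by (simp only: of_real_eq_iff)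
qed

lemma kre_ip_le: "kre (ip x y) \<le> norm x * norm y"
proof -
  have "(norm (x + y))\<^sup>2 \<le> (norm x + norm y)\<^sup>2"
    by (rule power_mono[OF norm_triangle_ineq]) simp
  then show ?thesis using norm_add_sq[of x y] by (simp add: power2_sum)
qed

lemma norm_ip_le: "norm (ip x y) \<le> norm x * norm y"
proof -
  obtain c where c: "norm c \<le> 1" "kre (c * ip x y) = norm (ip x y)" by (rule obtain_phase)
  have "norm (ip x y) \<le> norm (smul c x) * norm y"
    using kre_ip_le[of "smul c x" y] c(2) by (simp only: ip_smul_left)
  also have "\<dots> \<le> norm x * norm y"
    using c(1) by (intro mult_right_mono) (auto intro: mult_left_le_one_le)
  finally show ?thesis .
qed

lemma bounded_linear_ip_left: "bounded_linear (\<lambda>x. ip x y)"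
  by (rule bounded_linear_intro[where K = "norm y"])
    (simp_all add: ip_add_left ip_scaleR_left scaleR_conv_of_real norm_ip_le)

lemma bounded_linear_ip_right: "bounded_linear (\<lambda>y. ip x y)"
  by (rule bounded_linear_intro[where K = "norm x"])
    (simp_all add: ip_add_right ip_scaleR_right scaleR_conv_of_real norm_ip_le mult.commute[of _ "norm x"])

lemma norm_le_via_ip:
  assumes "\<And>x. norm (ip x z) \<le> C * norm x" "C \<ge> 0"
  shows "norm z \<le> C"
proof (cases "z = 0")
  case False
  have "(norm z)\<^sup>2 \<le> C * norm z"
    using assms(1)[of z] by (simp add: ip_self norm_power norm_mult power2_eq_square)
  with False show ?thesis by (simp add: power2_eq_square)
qed (use assms(2) in simp)


text \<open>
  The representing vector minimizes the functional \<open>J x = \<parallel>x\<parallel>\<^sup>2 - 2 Re (\<phi> x)\<close>. Its first variation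
  gives the identity of the real parts, and linearity over the scalars gives the rest.
\<close>

theorem frechet_riesz:
  assumes add: "\<And>x y. \<phi> (x + y) = \<phi> x + \<phi> y"
    and smul: "\<And>c x. \<phi> (smul c x) = c * \<phi> x"
    and bound: "\<And>x. norm (\<phi> x) \<le> B * norm x"
  obtains z where "\<And>x. \<phi> x = ip x z"
proof -
  define J where "J x = (norm x)\<^sup>2 - 2 * kre (\<phi> x)" for x
  have \<phi>_scaleR: "\<phi> (r *\<^sub>R x) = of_real r * \<phi> x" for r x
    using smul[of "of_real r" x] by (simp add: smul_of_real)
  have "bounded_linear \<phi>"
    by (rule bounded_linear_intro[where K = B])
      (simp_all add: add \<phi>_scaleR scaleR_conv_of_real bound mult.commute[of _ B])
  then have kre_bl: "bounded_linear (\<lambda>x. kre (\<phi> x))"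
    by (intro bounded_linear_intro[where K = B])
      (auto simp: add \<phi>_scaleR kre_add kre_of_real_mult mult.commute[of _ B]
        intro: order_trans[OF abs_kre_le_norm bound])
  then interpret \<phi>: bounded_linear "\<lambda>x. kre (\<phi> x)" .
  \<comment> \<open>Completing the square, since \<open>Re (\<phi> x) \<le> B \<parallel>x\<parallel>\<close>.\<close>
  have J_below: "J x \<ge> - B\<^sup>2" for x
  proof -
    have "kre (\<phi> x) \<le> B * norm x" by (rule order_trans[OF kre_le_norm bound])
    moreover have "0 \<le> (norm x - B)\<^sup>2" by simp
    ultimately show ?thesis by (simp add: J_def power2_diff algebra_simps)
  qed
  define j where "j = (INF x. J x)"
  have bdd: "bdd_below (range J)" using J_below by (auto intro!: bdd_belowI)
  have j_le: "j \<le> J x" for x unfolding j_def by (rule cINF_lower[OF bdd]) simp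
  have "\<exists>x. J x < j + 1 / Suc n" for n
  proof -
    have "(INF x. J x) < j + 1 / Suc n" by (simp add: j_def)
    then show ?thesis using cINF_less_iff[OF _ bdd] by auto
  qed
  then obtain u where u: "\<And>n. J (u n) < j + 1 / Suc n" by metis
  \<comment> \<open>By the parallelogram law, \<open>J\<close> is uniformly convex, which makes minimizing sequences Cauchy.\<close>
  have J_convex: "(norm (x - y))\<^sup>2 / 2 = J x + J y - 2 * J ((1/2) *\<^sub>R (x + y))" for x y
  proof -
    have "(norm (x - y))\<^sup>2 = (norm x)\<^sup>2 - 2 * kre (ip x y) + (norm y)\<^sup>2"
      using norm_add_sq[of x "- 1 *\<^sub>R y"] ip_scaleR_right[of x "-1" y] by (simp add: kre_minus)
    moreover have "(norm ((1/2) *\<^sub>R (x + y)))\<^sup>2 = (norm (x + y))\<^sup>2 / 4"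
      by (simp add: power_divide)
    ultimately show ?thesis
      unfolding J_def by (simp add: \<phi>.scaleR \<phi>.add norm_add_sq algebra_simps)
  qed
  have "Cauchy u"
  proof (rule CauchyI)
    fix e :: real assume e: "e > 0"
    obtain M where M: "1 / Suc M < e\<^sup>2 / 4"
      using nat_approx_posE[of "e\<^sup>2 / 4"] e by auto
    have "norm (u m - u n) < e" if "m \<ge> M" "n \<ge> M" for m n
    proof -
      have "1 / real (Suc m) \<le> 1 / Suc M" "1 / real (Suc n) \<le> 1 / Suc M"
        using that by (simp_all add: frac_le)
      then have "(norm (u m - u n))\<^sup>2 / 2 < e\<^sup>2 / 2"
        using J_convex[of "u m" "u n"] u[of m] u[of n] j_le[of "(1/2) *\<^sub>R (u m + u n)"] M by linarith
      then show ?thesis using e by (simp add: power_less_imp_less_base)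
    qed
    then show "\<exists>M. \<forall>m\<ge>M. \<forall>n\<ge>M. norm (u m - u n) < e" by blast
  qed
  then obtain z where z: "u \<longlonglongrightarrow> z" using Cauchy_convergent convergent_def by blast
  have "(\<lambda>n. J (u n)) \<longlonglongrightarrow> J z"
    unfolding J_def by (intro tendsto_intros \<phi>.tendsto z)
  moreover have "(\<lambda>n. j + 1 / Suc n) \<longlonglongrightarrow> j + 0"
    by (intro tendsto_intros LIMSEQ_Suc lim_1_over_n)
  ultimately have "J z \<le> j + 0"
    by (rule LIMSEQ_le) (use u less_imp_le in blast)
  then have z_min: "J z \<le> J x" for x using j_le[of x] by linarith
  have real_part: "kre (\<phi> h) = kre (ip h z)" for h
  proof -
    define d where "d = kre (ip z h) - kre (\<phi> h)"
    have quad: "0 \<le> 2 * t * d + t\<^sup>2 * (norm h)\<^sup>2" for t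
    proof -
      have "J (z + t *\<^sub>R h) = J z + 2 * t * d + t\<^sup>2 * (norm h)\<^sup>2"
        by (simp add: J_def norm_add_sq ip_scaleR_right kre_of_real_mult \<phi>.add \<phi>.scaleR d_def
            power_mult_distrib algebra_simps)
      then show ?thesis using z_min[of "z + t *\<^sub>R h"] by linarith
    qed
    have "d = 0"
    proof (rule ccontr)
      assume d: "d \<noteq> 0"
      let ?N = "(norm h)\<^sup>2 + 1"
      have N: "?N > 0" by (simp add: add_nonneg_pos)
      \<comment> \<open>The step \<open>t = - q\<close> makes the quadratic polynomial in \<open>quad\<close> negative; the summand \<open>1\<close> in the
          denominator covers \<open>h = 0\<close>.\<close>
      define q where "q = d / ?N"
      have dq: "d = q * ?N" and "q \<noteq> 0" using d N by (simp_all add: q_def)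
      have "2 * (- q) * d + (- q)\<^sup>2 * (norm h)\<^sup>2 = - (q\<^sup>2 * ((norm h)\<^sup>2 + 2))"
        unfolding dq by (simp add: power2_eq_square algebra_simps)
      moreover have "q\<^sup>2 * ((norm h)\<^sup>2 + 2) > 0"
        using \<open>q \<noteq> 0\<close> by (intro mult_pos_pos) (auto simp: add_nonneg_pos)
      ultimately show False using quad[of "- q"] by linarith
    qed
    then show ?thesis using kre_kcnj[of "ip z h"] by (simp add: d_def flip: ip_commute)
  qed
  have "\<phi> x = ip x z" for x
    by (rule scalar_eq_via_kre) (metis smul ip_smul_left real_part)
  then show ?thesis by (rule that)
qed

end


section \<open>The variation of a vector measure is a measure\<close>

lemma cabv_val_empty [simp]: "cabv_val m {} = 0"
  by (rule cabv_set_empty[OF cabv_val])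

lemma cabv_val_sums:
  "range A \<subseteq> sets borel \<Longrightarrow> disjoint_family A \<Longrightarrow> (\<lambda>n::nat. cabv_val m (A n)) sums cabv_val m (\<Union>n. A n)"
  by (rule cabv_setD(1)[OF cabv_val])

lemma cabv_val_Un:
  assumes "A \<in> sets borel" "B \<in> sets borel" "A \<inter> B = {}"
  shows "cabv_val m (A \<union> B) = cabv_val m A + cabv_val m B"
proof -
  have "(\<lambda>n. cabv_val m (binaryset A B n)) sums cabv_val m (\<Union>n. binaryset A B n)"
    using assms by (intro cabv_val_sums)
      (auto simp: range_binaryset_eq disjoint_family_on_def binaryset_def)
  moreover have "(\<lambda>n. cabv_val m (binaryset A B n)) sums (cabv_val m A + cabv_val m B)"
    by (rule binaryset_sums) simp
  ultimately show ?thesis unfolding UN_binaryset_eq by (rule sums_unique2)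
qed

lemma cabv_val_UN:
  assumes "finite I" "disjoint_family_on B I" "\<And>i. i \<in> I \<Longrightarrow> B i \<in> sets borel"
  shows "cabv_val m (\<Union>i\<in>I. B i) = (\<Sum>i\<in>I. cabv_val m (B i))"
  using assms
proof (induction I rule: finite_induct)
  case (insert i I)
  have "cabv_val m (B i \<union> (\<Union>j\<in>I. B j)) = cabv_val m (B i) + cabv_val m (\<Union>j\<in>I. B j)"
    using insert.prems insert.hyps
    by (intro cabv_val_Un) (auto simp: disjoint_family_on_def intro!: sets.finite_UN)
  moreover have "disjoint_family_on B I"
    using insert.prems(1) by (rule disjoint_family_on_mono[rotated]) auto
  ultimately show ?case using insert by simp
qed simp

lemma ennreal_norm_sums_le:
  fixes a :: "nat \<Rightarrow> 'a::real_normed_vector"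
  assumes "a sums s"
  shows "ennreal (norm s) \<le> (\<Sum>k. ennreal (norm (a k)))"
proof (rule LIMSEQ_le_const2)
  show "(\<lambda>n. ennreal (norm (\<Sum>k<n. a k))) \<longlonglongrightarrow> ennreal (norm s)"
    using assms unfolding sums_def by (intro tendsto_ennrealI tendsto_norm)
  have "ennreal (norm (\<Sum>k<n. a k)) \<le> (\<Sum>k. ennreal (norm (a k)))" for n
  proof -
    have "ennreal (norm (\<Sum>k<n. a k)) \<le> (\<Sum>k<n. ennreal (norm (a k)))"
      by (simp add: norm_sum sum_ennreal ennreal_leI)
    also have "\<dots> \<le> (\<Sum>k. ennreal (norm (a k)))"
      by (rule sum_le_suminf) auto
    finally show ?thesis .
  qed
  then show "\<exists>N. \<forall>n\<ge>N. ennreal (norm (\<Sum>k<n. a k)) \<le> (\<Sum>k. ennreal (norm (a k)))" by blast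
qed

text \<open>
  The pieces are indexed, possibly empty, and need not exhaust \<open>A\<close>: dropping empty ones and adding
  the remainder yields a partition.
\<close>

lemma sum_le_variation:
  assumes "\<mu> {} = 0" "finite I" "disjoint_family_on B I" "\<And>i. i \<in> I \<Longrightarrow> B i \<in> sets borel"
    and "(\<Union>i\<in>I. B i) \<subseteq> A" "A \<in> sets borel"
  shows "(\<Sum>i\<in>I. ennreal (norm (\<mu> (B i)))) \<le> variation \<mu> A"
proof -
  define I' where "I' = {i\<in>I. B i \<noteq> {}}"
  define P where "P = B ` I' \<union> ({A - (\<Union>i\<in>I. B i)} - {{}})"
  have inj: "inj_on B I'"
    using assms(3) by (auto simp: inj_on_def I'_def disjoint_family_on_def)
  have fin: "finite I'" "finite P" using assms(2) by (simp_all add: I'_def P_def)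
  have "(\<Sum>i\<in>I. ennreal (norm (\<mu> (B i)))) = (\<Sum>i\<in>I'. ennreal (norm (\<mu> (B i))))"
    unfolding I'_def using assms(1,2) by (intro sum.mono_neutral_right) auto
  also have "\<dots> = (\<Sum>C\<in>B ` I'. ennreal (norm (\<mu> C)))"
    by (simp add: sum.reindex[OF inj])
  also have "\<dots> \<le> (\<Sum>C\<in>P. ennreal (norm (\<mu> C)))"
    using fin by (intro sum_mono2) (auto simp: P_def)
  also have "\<dots> \<le> variation \<mu> A"
    unfolding variation_def
  proof (rule SUP_upper, safe)
    show "partition_on A P"
    proof (rule partition_onI)
      show "\<Union> P = A"
      proof -
        have "\<Union>(B ` I') = (\<Union>i\<in>I. B i)" unfolding I'_def by blast
        moreover have "\<Union>({A - (\<Union>i\<in>I. B i)} - {{}}) = A - (\<Union>i\<in>I. B i)" by blast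
        ultimately have "\<Union>P = (\<Union>i\<in>I. B i) \<union> (A - (\<Union>i\<in>I. B i))"
          unfolding P_def Union_Un_distrib by (simp only:)
        then show ?thesis using assms(5) by blast
      qed
      fix C D assume "C \<in> P" "D \<in> P" "C \<noteq> D"
      moreover have "C' \<inter> D' = {}" if "C' \<in> B ` I'" "D' \<in> B ` I'" "C' \<noteq> D'" for C' D'
        using that disjoint_family_onD[OF assms(3)] unfolding I'_def by blast
      ultimately show "disjnt C D"
        unfolding disjnt_def P_def I'_def by blast
    qed (auto simp: P_def I'_def)
    have "(\<Union>i\<in>I. B i) \<in> sets borel" using assms(2,4) by (intro sets.finite_UN) auto
    then show "C \<in> sets borel" if "C \<in> P" for C
      using that assms(4,6) by (auto simp: P_def I'_def)
  qed (use fin in auto)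
  finally show ?thesis .
qed

lemma variation_add_disjoint_le:
  assumes "\<mu> {} = 0" "A \<in> sets borel" "B \<in> sets borel" "A \<inter> B = {}"
  shows "variation \<mu> A + variation \<mu> B \<le> variation \<mu> (A \<union> B)"
proof -
  let ?P = "\<lambda>A. {P. finite P \<and> partition_on A P \<and> P \<subseteq> sets borel}"
  let ?S = "\<lambda>P. \<Sum>C\<in>P. ennreal (norm (\<mu> C))"
  have ne: "?P C \<noteq> {}" if "C \<in> sets borel" for C
  proof (cases "C = {}")
    case True
    then have "{} \<in> ?P C" by (simp add: partition_on_def disjoint_def)
    then show ?thesis by blast
  next
    case False
    then have "{C} \<in> ?P C" using that by (simp add: partition_on_def)
    then show ?thesis by blast
  qed
  have PQ: "?S P + ?S Q \<le> variation \<mu> (A \<union> B)" if P: "P \<in> ?P A" and Q: "Q \<in> ?P B" for P Q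
  proof -
    have disj: "C \<inter> D = {}" if "C \<in> P" "D \<in> Q" for C D
      using that P Q assms(4) by (auto simp: partition_on_def)
    have "P \<inter> Q = {}"
      using disj P by (fastforce simp: partition_on_def)
    then have "?S P + ?S Q = ?S (P \<union> Q)"
      using P Q by (intro sum.union_disjoint[symmetric]) auto
    also have "\<dots> \<le> variation \<mu> (A \<union> B)"
    proof (rule sum_le_variation)
      show "disjoint_family_on (\<lambda>C. C) (P \<union> Q)"
        unfolding disjoint_family_on_def
      proof (intro ballI impI)
        fix C D assume "C \<in> P \<union> Q" "D \<in> P \<union> Q" "C \<noteq> D"
        then show "C \<inter> D = {}"
          using P Q disj[of C D] disj[of D C] unfolding partition_on_def disjoint_def by blast
      qed
    qed (use P Q assms in \<open>auto simp: partition_on_def\<close>)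
    finally show ?thesis .
  qed
  have "?S P + variation \<mu> B \<le> variation \<mu> (A \<union> B)" if "P \<in> ?P A" for P
  proof -
    have "?S P + variation \<mu> B = (SUP Q\<in>?P B. ?S P + ?S Q)"
      unfolding variation_def using ne[OF assms(3)] by (subst ennreal_SUP_add_right) auto
    then show ?thesis using PQ[OF that] by (auto intro: SUP_least)
  qed
  moreover have "variation \<mu> A + variation \<mu> B = (SUP P\<in>?P A. ?S P + variation \<mu> B)"
    unfolding variation_def[of \<mu> A] using ne[OF assms(2)] by (subst ennreal_SUP_add_left) auto
  ultimately show ?thesis by (auto intro: SUP_least)
qed

text \<open>
  Superadditivity: partitions of disjoint sets combine to a partition of the union. Countable
  subadditivity: a partition of the union is refined by intersection with the sets \<open>D k\<close>.
\<close>

lemma variation_countably_additive: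
  "countably_additive (sets borel) (variation (cabv_val m))"
proof (rule countably_additiveI)
  fix D :: "nat \<Rightarrow> 'a set"
  assume D: "range D \<subseteq> sets borel" "disjoint_family D" "(\<Union>k. D k) \<in> sets borel"
  let ?V = "variation (cabv_val m)"
  show "(\<Sum>k. ?V (D k)) = ?V (\<Union>k. D k)"
  proof (rule antisym)
    have part: "(\<Sum>k<n. ?V (D k)) \<le> ?V (\<Union>k<n. D k)" for n
    proof (induction n)
      case (Suc n)
      have "(\<Sum>k<Suc n. ?V (D k)) \<le> ?V (\<Union>k<n. D k) + ?V (D n)"
        using Suc by (simp add: add_right_mono)
      also have "\<dots> \<le> ?V ((\<Union>k<n. D k) \<union> D n)"
      proof (rule variation_add_disjoint_le)
        have "D k \<inter> D n = {}" if "k < n" for k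
          using that by (intro disjoint_family_onD[OF D(2)]) auto
        then show "(\<Union>k<n. D k) \<inter> D n = {}" by blast
      qed (use D(1) in auto)
      also have "(\<Union>k<n. D k) \<union> D n = (\<Union>k<Suc n. D k)" by (auto simp: lessThan_Suc)
      finally show ?case .
    qed simp
    have "(\<Sum>k<n. ?V (D k)) \<le> ?V (\<Union>k. D k)" for n
    proof -
      have "?V (\<Union>k<n. D k) + 0 \<le> ?V (\<Union>k<n. D k) + ?V ((\<Union>k. D k) - (\<Union>k<n. D k))"
        by (intro add_left_mono) simp
      also have "\<dots> \<le> ?V ((\<Union>k<n. D k) \<union> ((\<Union>k. D k) - (\<Union>k<n. D k)))"
        using D(1) by (intro variation_add_disjoint_le) auto
      also have "(\<Union>k<n. D k) \<union> ((\<Union>k. D k) - (\<Union>k<n. D k)) = (\<Union>k. D k)" by auto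
      finally show ?thesis using part[of n] by simp
    qed
    then show "(\<Sum>k. ?V (D k)) \<le> ?V (\<Union>k. D k)"
      by (intro suminf_le_const) auto
    show "?V (\<Union>k. D k) \<le> (\<Sum>k. ?V (D k))"
      unfolding variation_def[of _ "\<Union>k. D k"]
    proof (rule SUP_least, safe)
      fix P :: "'a set set"
      assume P: "finite P" "partition_on (\<Union>k. D k) P" "P \<subseteq> sets borel"
      have "(\<Sum>B\<in>P. ennreal (norm (cabv_val m B)))
          \<le> (\<Sum>B\<in>P. \<Sum>k. ennreal (norm (cabv_val m (B \<inter> D k))))"
      proof (rule sum_mono)
        fix B assume B: "B \<in> P"
        then have "B = (\<Union>k. B \<inter> D k)" using P(2) by (auto simp: partition_on_def)
        moreover have "(\<lambda>k. cabv_val m (B \<inter> D k)) sums cabv_val m (\<Union>k. B \<inter> D k)"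
          using B P(3) D by (intro cabv_val_sums disjoint_family_subset[OF D(2)]) auto
        ultimately show "ennreal (norm (cabv_val m B)) \<le> (\<Sum>k. ennreal (norm (cabv_val m (B \<inter> D k))))"
          by (metis ennreal_norm_sums_le)
      qed
      also have "\<dots> = (\<Sum>k. \<Sum>B\<in>P. ennreal (norm (cabv_val m (B \<inter> D k))))"
        by (rule suminf_sum[symmetric]) simp
      also have "\<dots> \<le> (\<Sum>k. ?V (D k))"
      proof (rule suminf_le)
        fix k
        show "(\<Sum>B\<in>P. ennreal (norm (cabv_val m (B \<inter> D k)))) \<le> ?V (D k)"
        proof (rule sum_le_variation)
          show "disjoint_family_on (\<lambda>B. B \<inter> D k) P"
            using P(2) by (fastforce simp: partition_on_def disjoint_def disjoint_family_on_def)
        qed (use P D in auto)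
      qed auto
      finally show "(\<Sum>B\<in>P. ennreal (norm (cabv_val m B))) \<le> (\<Sum>k. ?V (D k))" .
    qed
  qed
qed

definition var_measure :: "('t::topological_space, 'x::real_normed_vector) cabv \<Rightarrow> 't measure" where
  "var_measure m = measure_of UNIV (sets borel) (variation (cabv_val m))"

lemma space_var_measure [simp]: "space (var_measure m) = UNIV"
  by (simp add: var_measure_def space_measure_of_conv)

lemma sets_var_measure [simp, measurable_cong]: "sets (var_measure m) = sets borel"
  unfolding var_measure_def
  using sets.sigma_sets_eq[of borel] by (simp add: sets_measure_of_conv)

lemma emeasure_var_measure:
  assumes "A \<in> sets borel"
  shows "emeasure (var_measure m) A = variation (cabv_val m) A"
  unfolding var_measure_def
proof (rule emeasure_measure_of_sigma)
  show "sigma_algebra UNIV (sets borel)" using sets.sigma_algebra_axioms[of borel] by simp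
  show "positive (sets borel) (variation (cabv_val m))"
    using variation_add_disjoint_le[of "cabv_val m" "{}" UNIV] variation_cabv_finite[of m]
    by (auto simp: positive_def top_unique)
qed (use assms variation_countably_additive in auto)

lemma emeasure_var_measure_UNIV: "emeasure (var_measure m) UNIV = ennreal (norm m)"
  using variation_cabv_finite[of m] by (simp add: emeasure_var_measure norm_cabv_def less_top)

lemma finite_measure_var_measure: "finite_measure (var_measure m)"
  by (rule finite_measureI) (simp add: emeasure_var_measure_UNIV)

lemma norm_cabv_val_le: "A \<in> sets borel \<Longrightarrow> ennreal (norm (cabv_val m A)) \<le> emeasure (var_measure m) A"
  using sum_le_variation[of "cabv_val m" "{()}" "\<lambda>_. A" A]
  by (simp add: emeasure_var_measure disjoint_family_on_def)


section \<open>The integral of simple functions\<close>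

lemma simple_function_borelD:
  assumes "simple_function (borel :: 't::topological_space measure) s"
  shows "finite (range s)" "s -` A \<in> sets borel"
  using simple_functionD[OF assms] by auto

lemma cabv_val_compose_fibre:
  assumes p: "simple_function borel p"
  shows "cabv_val m ((\<lambda>t. h (p t)) -` {x}) = (\<Sum>y\<in>{y \<in> range p. h y = x}. cabv_val m (p -` {y}))"
proof -
  have "(\<lambda>t. h (p t)) -` {x} = (\<Union>y\<in>{y \<in> range p. h y = x}. p -` {y})" by auto
  then show ?thesis
    using simple_function_borelD[OF p]
    by (simp only:, intro cabv_val_UN) (auto simp: disjoint_family_on_def)
qed

lemma nn_integral_norm_simple:
  assumes s: "simple_function borel s" and [measurable_cong]: "sets M = sets borel"
  shows "(\<integral>\<^sup>+t. ennreal (norm (s t)) \<partial>M) = (\<Sum>x\<in>range s. ennreal (norm x) * emeasure M (s -` {x}))"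
proof -
  note s' = simple_function_borelD[OF s]
  have "ennreal (norm (s t)) = (\<Sum>x\<in>range s. ennreal (norm x) * indicator (s -` {x}) t)" for t
  proof -
    have "(\<Sum>x\<in>range s. ennreal (norm x) * indicator (s -` {x}) t)
        = (\<Sum>x\<in>{s t}. ennreal (norm x) * indicator (s -` {x}) t)"
      using s'(1) by (intro sum.mono_neutral_right) (auto simp: indicator_def)
    then show ?thesis by simp
  qed
  then have "(\<integral>\<^sup>+t. ennreal (norm (s t)) \<partial>M)
      = (\<integral>\<^sup>+t. (\<Sum>x\<in>range s. ennreal (norm x) * indicator (s -` {x}) t) \<partial>M)" by simp
  also have "\<dots> = (\<Sum>x\<in>range s. \<integral>\<^sup>+t. ennreal (norm x) * indicator (s -` {x}) t \<partial>M)"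
    using s'(2) by (intro nn_integral_sum) (simp add: assms(2))
  also have "\<dots> = (\<Sum>x\<in>range s. ennreal (norm x) * emeasure M (s -` {x}))"
    using s'(2) by (intro sum.cong refl nn_integral_cmult_indicator) (simp add: assms(2))
  finally show ?thesis .
qed

context hilbert_space
begin

lemma ip_0_right [simp]: "ip x 0 = 0" and ip_0_left [simp]: "ip 0 y = 0"
  by (rule linear_0[OF bounded_linear.linear[OF bounded_linear_ip_right]],
      rule linear_0[OF bounded_linear.linear[OF bounded_linear_ip_left]])

lemma ip_sum_right: "ip x (\<Sum>i\<in>I. f i) = (\<Sum>i\<in>I. ip x (f i))"
  by (rule linear_sum[OF bounded_linear.linear[OF bounded_linear_ip_right]])

lemma ip_diff_right: "ip x (y - z) = ip x y - ip x z"
  by (rule linear_diff[OF bounded_linear.linear[OF bounded_linear_ip_right]])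

lemma eq_via_ip: "(\<And>x. ip x y = ip x z) \<Longrightarrow> y = z"
  using norm_le_via_ip[of "y - z" 0] by (simp add: ip_diff_right)

lemma ip_diff_left: "ip (x - y) z = ip x z - ip y z"
  by (rule linear_diff[OF bounded_linear.linear[OF bounded_linear_ip_left]])

text \<open>
  A simple integral can be computed over the fibres of any simple function through which the
  integrand factors. For the pair of two simple functions this is a common refinement, whence the
  additivity of the integral.
\<close>

lemma sesq_integral_simple_compose:
  assumes p: "simple_function borel p"
  shows "sesq_integral_simple ip (\<lambda>t. h (p t)) m = (\<Sum>y\<in>range p. ip (h y) (cabv_val m (p -` {y})))"
proof -
  have "sesq_integral_simple ip (\<lambda>t. h (p t)) m
      = (\<Sum>x\<in>range (\<lambda>t. h (p t)). \<Sum>y\<in>{y \<in> range p. h y = x}. ip (h y) (cabv_val m (p -` {y})))"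
    unfolding sesq_integral_simple_def cabv_val_compose_fibre[OF p] ip_sum_right
    by (intro sum.cong refl) auto
  also have "\<dots> = (\<Sum>y\<in>range p. ip (h y) (cabv_val m (p -` {y})))"
    using simple_function_borelD(1)[OF p] by (intro sum.group) (auto simp flip: image_image)
  finally show ?thesis .
qed

lemma sesq_integral_simple_pair:
  assumes "simple_function borel s" "simple_function borel s'"
  shows "sesq_integral_simple ip (\<lambda>t. h (s t) (s' t)) m
    = (\<Sum>y\<in>range (\<lambda>t. (s t, s' t)). ip (h (fst y) (snd y)) (cabv_val m ((\<lambda>t. (s t, s' t)) -` {y})))"
proof -
  have "simple_function borel (\<lambda>t. (s t, s' t))"
    using assms by (rule simple_function_compose2)
  from sesq_integral_simple_compose[OF this, of "\<lambda>y. h (fst y) (snd y)"] show ?thesis by simp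
qed

lemma sesq_integral_simple_add:
  assumes "simple_function borel s" "simple_function borel s'"
  shows "sesq_integral_simple ip (\<lambda>t. s t + s' t) m
    = sesq_integral_simple ip s m + sesq_integral_simple ip s' m"
  using sesq_integral_simple_pair[OF assms, of "\<lambda>x y. x + y"]
    sesq_integral_simple_pair[OF assms, of "\<lambda>x y. x"] sesq_integral_simple_pair[OF assms, of "\<lambda>x y. y"]
  by (simp add: ip_add_left sum.distrib)

lemma sesq_integral_simple_diff:
  assumes "simple_function borel s" "simple_function borel s'"
  shows "sesq_integral_simple ip (\<lambda>t. s t - s' t) m
    = sesq_integral_simple ip s m - sesq_integral_simple ip s' m"
  using sesq_integral_simple_pair[OF assms, of "\<lambda>x y. x - y"]
    sesq_integral_simple_pair[OF assms, of "\<lambda>x y. x"] sesq_integral_simple_pair[OF assms, of "\<lambda>x y. y"]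
  by (simp add: ip_diff_left sum_subtractf)

lemma sesq_integral_simple_smul:
  assumes "simple_function borel s"
  shows "sesq_integral_simple ip (\<lambda>t. smul c (s t)) m = c * sesq_integral_simple ip s m"
  using sesq_integral_simple_compose[OF assms, of "smul c"]
  by (simp add: sesq_integral_simple_def ip_smul_left sum_distrib_left)

lemma norm_sesq_integral_simple_le:
  assumes s: "simple_function borel s"
  shows "ennreal (norm (sesq_integral_simple ip s m)) \<le> (\<integral>\<^sup>+t. ennreal (norm (s t)) \<partial>var_measure m)"
proof -
  have "norm (sesq_integral_simple ip s m) \<le> (\<Sum>x\<in>range s. norm x * norm (cabv_val m (s -` {x})))"
    unfolding sesq_integral_simple_def by (rule sum_norm_le) (rule norm_ip_le)
  then have "ennreal (norm (sesq_integral_simple ip s m))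
      \<le> (\<Sum>x\<in>range s. ennreal (norm x) * ennreal (norm (cabv_val m (s -` {x}))))"
    by (simp add: ennreal_leI flip: ennreal_mult)
  also have "\<dots> \<le> (\<Sum>x\<in>range s. ennreal (norm x) * emeasure (var_measure m) (s -` {x}))"
    using simple_function_borelD(2)[OF s] by (intro sum_mono mult_left_mono norm_cabv_val_le) auto
  also have "\<dots> = (\<integral>\<^sup>+t. ennreal (norm (s t)) \<partial>var_measure m)"
    by (rule nn_integral_norm_simple[OF s, symmetric]) simp
  finally show ?thesis .
qed

end


section \<open>The integral of uniform limits of simple functions\<close>

lemma obtain_small_factor:
  fixes c e :: real
  assumes "e > 0" "c \<ge> 0"
  obtains d where "d > 0" "d * c < e"
proof
  show "e / (c + 1) > 0" "e / (c + 1) * c < e" using assms by (simp_all add: pos_divide_less_eq)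
qed

text \<open>
  The image lies in a compact set, which finitely many balls of radius \<open>e\<close> cover. The
  approximation depends only on the set of those balls that contain \<open>f t\<close>, so it is simple,
  and no countable base of the target is involved.
\<close>

lemma simple_function_approx:
  fixes f :: "'a \<Rightarrow> 'b::metric_space"
  assumes f: "f \<in> borel_measurable M" and K: "compact K" "\<And>t. t \<in> space M \<Longrightarrow> f t \<in> K" and e: "e > 0"
  obtains s where "simple_function M s" "\<And>t. t \<in> space M \<Longrightarrow> dist (s t) (f t) < e"
proof -
  obtain k where k: "finite k" "K \<subseteq> (\<Union>x\<in>k. ball x e)"
    using K(1) e unfolding compact_eq_totally_bounded by blast
  define N where "N t = {x \<in> k. f t \<in> ball x e}" for t
  have "simple_function M N"
    unfolding simple_function_def
  proof safe
    have "N ` space M \<subseteq> Pow k" by (auto simp: N_def)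
    then show "finite (N ` space M)" using k(1) finite_subset by blast
    fix t
    have N_eq: "N u = N t \<longleftrightarrow> (\<forall>x\<in>k. f u \<in> ball x e \<longleftrightarrow> f t \<in> ball x e)" for u
      unfolding N_def by blast
    have "{u \<in> space M. f u \<in> ball x e \<longleftrightarrow> f t \<in> ball x e} \<in> sets M" for x
    proof -
      have "{u \<in> space M. f u \<in> ball x e} = f -` ball x e \<inter> space M"
        "{u \<in> space M. f u \<notin> ball x e} = space M - (f -` ball x e \<inter> space M)"
        by blast+
      moreover have "f -` ball x e \<inter> space M \<in> sets M" by (rule measurable_sets[OF f]) simp
      ultimately show ?thesis by (cases "f t \<in> ball x e") (simp_all only: sets.compl_sets simp_thms)
    qed
    then have "{u \<in> space M. \<forall>x\<in>k. f u \<in> ball x e \<longleftrightarrow> f t \<in> ball x e} \<in> sets M"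
      using k(1) by (intro sets.sets_Collect_finite_All)
    also have "{u \<in> space M. \<forall>x\<in>k. f u \<in> ball x e \<longleftrightarrow> f t \<in> ball x e} = N -` {N t} \<inter> space M"
      unfolding N_eq[symmetric] by blast
    finally show "N -` {N t} \<inter> space M \<in> sets M" .
  qed
  then have "simple_function M (\<lambda>t. SOME x. x \<in> N t)"
    by (rule simple_function_compose1)
  moreover have "dist (SOME x. x \<in> N t) (f t) < e" if t: "t \<in> space M" for t
  proof -
    have "\<exists>x. x \<in> N t" using K(2)[OF t] k(2) unfolding N_def by blast
    then have "(SOME x. x \<in> N t) \<in> N t" by (rule someI_ex)
    then show ?thesis by (simp add: N_def)
  qed
  ultimately show ?thesis by (rule that)
qed

text \<open>
  In a space without countable base the difference of two measurable functions need not be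
  measurable. It is if one of them is simple: on each of its fibres the difference is a translate
  of the other one.
\<close>

lemma borel_measurable_norm_diff_simple:
  fixes f s :: "'a \<Rightarrow> 'b::real_normed_vector"
  assumes f: "f \<in> borel_measurable M" and s: "simple_function M s"
  shows "(\<lambda>t. norm (f t - s t)) \<in> borel_measurable M"
proof -
  have "(\<lambda>t. norm (f t - c)) \<in> borel_measurable M" for c
    by (rule measurable_compose[OF f]) (intro borel_measurable_continuous_onI continuous_intros)
  moreover have "s \<in> measurable M (count_space (s ` space M))"
    using measurable_simple_function[OF s] by (auto simp: measurable_def)
  moreover have "countable (s ` space M)"
    using simple_functionD(1)[OF s] by (rule countable_finite)
  ultimately show ?thesis
    using measurable_compose_countable'[where f = "\<lambda>c t. norm (f t - c)"] by metis
qed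

lemma simple_functions_uniform_limit:
  fixes f :: "'t::topological_space \<Rightarrow> 'x::metric_space"
  assumes T: "compact (UNIV :: 't set)" and f: "continuous_on UNIV f"
  obtains s where "\<forall>n. simple_function borel (s n)" "uniform_limit UNIV s f sequentially"
proof -
  have K: "compact (range f)" using compact_continuous_image[OF f T] .
  have "\<exists>s. simple_function borel s \<and> (\<forall>t. dist (s t) (f t) < 1 / Suc n)" for n
    using simple_function_approx[of f borel "range f" "1 / Suc n"] K borel_measurable_continuous_onI[OF f]
    by (metis of_nat_0_less_iff rangeI zero_less_Suc zero_less_divide_1_iff UNIV_I space_borel)
  then obtain s where s: "\<And>n. simple_function borel (s n)" "\<And>n t. dist (s n t) (f t) < 1 / Suc n" by metis
  have "uniform_limit UNIV s f sequentially"
  proof (rule uniform_limitI)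
    fix e :: real assume "e > 0"
    then have "eventually (\<lambda>n. inverse (real (Suc n)) < e) sequentially"
      using order_tendstoD(2)[OF LIMSEQ_inverse_real_of_nat] by blast
    then show "\<forall>\<^sub>F n in sequentially. \<forall>t\<in>UNIV. dist (s n t) (f t) < e"
      by (rule eventually_mono) (metis s(2) less_trans inverse_eq_divide)
  qed
  moreover have "\<forall>n. simple_function borel (s n)" using s(1) by simp
  ultimately show ?thesis by (intro that)
qed

context hilbert_space
begin

lemma norm_sesq_integral_simple_le_sup:
  assumes s: "simple_function borel s" and C: "\<And>t. norm (s t) \<le> C"
  shows "norm (sesq_integral_simple ip s m) \<le> C * norm m"
proof -
  have C0: "C \<ge> 0" by (rule order_trans[OF norm_ge_zero C])
  have "ennreal (norm (sesq_integral_simple ip s m)) \<le> (\<integral>\<^sup>+t. ennreal (norm (s t)) \<partial>var_measure m)"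
    by (rule norm_sesq_integral_simple_le[OF s])
  also have "\<dots> \<le> (\<integral>\<^sup>+t. ennreal C \<partial>var_measure m)"
    using C by (intro nn_integral_mono ennreal_leI)
  also have "\<dots> = ennreal (C * norm m)"
    using C0 by (simp add: emeasure_var_measure_UNIV ennreal_mult)
  finally show ?thesis using C0 by (simp add: ennreal_le_iff)
qed

text \<open>
  Two approximating sequences are treated at once: equal sequences give the Cauchy property,
  different ones the independence of the limit.
\<close>

lemma sesq_integral_simple_limits_agree:
  assumes s: "\<And>n. simple_function borel (s n)" "uniform_limit UNIV s f sequentially"
    and s': "\<And>n. simple_function borel (s' n)" "uniform_limit UNIV s' f sequentially"
    and e: "e > 0"
  shows "\<exists>N. \<forall>n\<ge>N. \<forall>k\<ge>N. norm (sesq_integral_simple ip (s n) m - sesq_integral_simple ip (s' k) m) < e"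
proof -
  obtain d where d: "d > 0" "d * (2 * norm m) < e"
    using obtain_small_factor[OF e, of "2 * norm m"] by auto
  obtain N where N: "\<And>n t. n \<ge> N \<Longrightarrow> dist (s n t) (f t) < d" "\<And>n t. n \<ge> N \<Longrightarrow> dist (s' n t) (f t) < d"
    using eventually_conj[OF uniform_limitD[OF s(2) d(1)] uniform_limitD[OF s'(2) d(1)]]
    unfolding eventually_sequentially by auto
  have "norm (sesq_integral_simple ip (s n) m - sesq_integral_simple ip (s' k) m) < e"
    if "n \<ge> N" "k \<ge> N" for n k
  proof -
    have "norm (s n t - s' k t) \<le> 2 * d" for t
      using N(1)[OF that(1), of t] N(2)[OF that(2), of t] dist_triangle2[of "s n t" "s' k t" "f t"]
      by (simp add: dist_norm)
    then have "norm (sesq_integral_simple ip (\<lambda>t. s n t - s' k t) m) \<le> 2 * d * norm m"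
      by (intro norm_sesq_integral_simple_le_sup simple_function_compose2[OF s(1) s'(1)])
    then show ?thesis using d(2) by (simp add: sesq_integral_simple_diff s s' mult.commute mult.left_commute)
  qed
  then show ?thesis by blast
qed

lemma sesq_integral_LIMSEQ:
  assumes s: "\<And>n. simple_function borel (s n)" "uniform_limit UNIV s f sequentially"
  shows "(\<lambda>n. sesq_integral_simple ip (s n) m) \<longlonglongrightarrow> sesq_integral ip f m"
proof -
  have "Cauchy (\<lambda>n. sesq_integral_simple ip (s n) m)"
    by (rule CauchyI) (use sesq_integral_simple_limits_agree[OF s s] in blast)
  then obtain z where z: "(\<lambda>n. sesq_integral_simple ip (s n) m) \<longlonglongrightarrow> z"
    using scalar_complete convergent_def by blast
  have "sesq_integral ip f m = z"
    unfolding sesq_integral_def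
  proof (rule the_equality)
    show "has_sesq_integral ip f m z" unfolding has_sesq_integral_def using s z by blast
    fix z' assume "has_sesq_integral ip f m z'"
    then obtain s' where s': "\<And>n. simple_function borel (s' n)" "uniform_limit UNIV s' f sequentially"
      "(\<lambda>n. sesq_integral_simple ip (s' n) m) \<longlonglongrightarrow> z'"
      unfolding has_sesq_integral_def by blast
    have "(\<lambda>n. sesq_integral_simple ip (s' n) m - sesq_integral_simple ip (s n) m) \<longlonglongrightarrow> 0"
      unfolding LIMSEQ_iff
      using sesq_integral_simple_limits_agree[OF s'(1,2) s] by (metis diff_zero)
    moreover have "(\<lambda>n. sesq_integral_simple ip (s' n) m - sesq_integral_simple ip (s n) m) \<longlonglongrightarrow> z' - z"
      by (intro tendsto_diff s'(3) z)
    ultimately show "z' = z" using LIMSEQ_unique by force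
  qed
  with z show ?thesis by simp
qed

lemma cabv_val_smul: "cabv_val (smul_cabv smul c m) A = smul c (cabv_val m A)"
proof -
  have "(\<lambda>A. smul c (cabv_val m A)) \<in> cabv_set"
    by (rule cabv_set_linear_image[OF cabv_val bounded_linear_smul, where c = "norm c"]) auto
  then show ?thesis by (simp add: smul_cabv_def Abs_cabv_inverse)
qed

lemma vector_space_smul_cabv:
  "vector_space (smul_cabv smul :: 'k \<Rightarrow> ('t::topological_space, 'x) cabv \<Rightarrow> ('t, 'x) cabv)"
  by unfold_locales
    (rule cabv_eqI, simp add: cabv_val_smul cabv_val_plus scale_right_distrib scale_left_distrib)+

lemma smul_cabv_of_real: "smul_cabv smul (of_real r) m = r *\<^sub>R m"
  by (rule cabv_eqI) (simp add: cabv_val_smul cabv_val_scaleR smul_of_real)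

context
  assumes T: "compact (UNIV :: 't::metric_space set)"
begin

lemma sesq_integral_add:
  fixes f g :: "'t \<Rightarrow> 'x"
  assumes f: "continuous_on UNIV f" and g: "continuous_on UNIV g"
  shows "sesq_integral ip (\<lambda>t. f t + g t) m = sesq_integral ip f m + sesq_integral ip g m"
proof -
  obtain s where "\<forall>n. simple_function borel (s n)" "uniform_limit UNIV s f sequentially"
    by (rule simple_functions_uniform_limit[OF T f])
  then have s: "simple_function borel (s n)" "uniform_limit UNIV s f sequentially" for n by simp_all
  obtain s' where "\<forall>n. simple_function borel (s' n)" "uniform_limit UNIV s' g sequentially"
    by (rule simple_functions_uniform_limit[OF T g])
  then have s': "simple_function borel (s' n)" "uniform_limit UNIV s' g sequentially" for n by simp_all
  have "(\<lambda>n. sesq_integral_simple ip (\<lambda>t. s n t + s' n t) m) \<longlonglongrightarrow> sesq_integral ip (\<lambda>t. f t + g t) m"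
    by (intro sesq_integral_LIMSEQ simple_function_compose2[OF s(1) s'(1)] uniform_limit_add s(2) s'(2))
  moreover have "(\<lambda>n. sesq_integral_simple ip (\<lambda>t. s n t + s' n t) m)
      \<longlonglongrightarrow> sesq_integral ip f m + sesq_integral ip g m"
    unfolding sesq_integral_simple_add[OF s(1) s'(1)]
    by (intro tendsto_add sesq_integral_LIMSEQ s s')
  ultimately show ?thesis by (rule LIMSEQ_unique)
qed

lemma sesq_integral_smul:
  fixes f :: "'t \<Rightarrow> 'x"
  assumes f: "continuous_on UNIV f"
  shows "sesq_integral ip (\<lambda>t. smul c (f t)) m = c * sesq_integral ip f m"
proof -
  obtain s where "\<forall>n. simple_function borel (s n)" "uniform_limit UNIV s f sequentially"
    by (rule simple_functions_uniform_limit[OF T f])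
  then have s: "simple_function borel (s n)" "uniform_limit UNIV s f sequentially" for n by simp_all
  have "(\<lambda>n. sesq_integral_simple ip (\<lambda>t. smul c (s n t)) m) \<longlonglongrightarrow> sesq_integral ip (\<lambda>t. smul c (f t)) m"
    by (intro sesq_integral_LIMSEQ simple_function_compose1[OF s(1)]
        bounded_linear.uniform_limit[OF bounded_linear_smul s(2)])
  moreover have "(\<lambda>n. sesq_integral_simple ip (\<lambda>t. smul c (s n t)) m) \<longlonglongrightarrow> c * sesq_integral ip f m"
    unfolding sesq_integral_simple_smul[OF s(1)]
    by (intro tendsto_mult tendsto_const sesq_integral_LIMSEQ s)
  ultimately show ?thesis by (rule LIMSEQ_unique)
qed

lemma sesq_integral_add_measure:
  fixes f :: "'t \<Rightarrow> 'x"
  assumes f: "continuous_on UNIV f"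
  shows "sesq_integral ip f (m + m') = sesq_integral ip f m + sesq_integral ip f m'"
proof -
  obtain s where "\<forall>n. simple_function borel (s n)" "uniform_limit UNIV s f sequentially"
    by (rule simple_functions_uniform_limit[OF T f])
  then have s: "simple_function borel (s n)" "uniform_limit UNIV s f sequentially" for n by simp_all
  have "sesq_integral_simple ip (s n) (m + m')
      = sesq_integral_simple ip (s n) m + sesq_integral_simple ip (s n) m'" for n
    by (simp add: sesq_integral_simple_def cabv_val_plus ip_add_right sum.distrib)
  then have "(\<lambda>n. sesq_integral_simple ip (s n) (m + m')) \<longlonglongrightarrow> sesq_integral ip f m + sesq_integral ip f m'"
    by (simp only:) (intro tendsto_add sesq_integral_LIMSEQ s)
  with sesq_integral_LIMSEQ[OF s] show ?thesis by (rule LIMSEQ_unique)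
qed

lemma sesq_integral_smul_measure:
  fixes f :: "'t \<Rightarrow> 'x"
  assumes f: "continuous_on UNIV f"
  shows "sesq_integral ip f (smul_cabv smul c m) = kcnj c * sesq_integral ip f m"
proof -
  obtain s where "\<forall>n. simple_function borel (s n)" "uniform_limit UNIV s f sequentially"
    by (rule simple_functions_uniform_limit[OF T f])
  then have s: "simple_function borel (s n)" "uniform_limit UNIV s f sequentially" for n by simp_all
  have "sesq_integral_simple ip (s n) (smul_cabv smul c m) = kcnj c * sesq_integral_simple ip (s n) m" for n
    by (simp add: sesq_integral_simple_def cabv_val_smul ip_smul_right sum_distrib_left)
  then have "(\<lambda>n. sesq_integral_simple ip (s n) (smul_cabv smul c m)) \<longlonglongrightarrow> kcnj c * sesq_integral ip f m"
    by (simp only:) (intro tendsto_mult tendsto_const sesq_integral_LIMSEQ s)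
  with sesq_integral_LIMSEQ[OF s] show ?thesis by (rule LIMSEQ_unique)
qed

text \<open>
  The \<open>L\<^sup>1\<close> estimate with respect to the variation, in the form needed to compare a continuous
  function with an indicator function.
\<close>

lemma norm_sesq_integral_diff_le:
  fixes f :: "'t \<Rightarrow> 'x"
  assumes f: "continuous_on UNIV f" and r: "simple_function borel r"
  shows "ennreal (norm (sesq_integral ip f m - sesq_integral_simple ip r m))
    \<le> (\<integral>\<^sup>+t. ennreal (norm (f t - r t)) \<partial>var_measure m)" (is "_ \<le> ?I")
proof (rule ennreal_le_epsilon)
  fix e :: real assume e: "e > 0"
  obtain s where "\<forall>n. simple_function borel (s n)" "uniform_limit UNIV s f sequentially"
    by (rule simple_functions_uniform_limit[OF T f])
  then have s: "simple_function borel (s n)" "uniform_limit UNIV s f sequentially" for n by simp_all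
  obtain d where d: "d > 0" "d * norm m < e" using obtain_small_factor[OF e norm_ge_zero] by blast
  have meas: "(\<lambda>t. norm (f t - r t)) \<in> borel_measurable borel"
    by (rule borel_measurable_norm_diff_simple[OF borel_measurable_continuous_onI[OF f] r])
  have lim: "(\<lambda>n. ennreal (norm (sesq_integral_simple ip (s n) m - sesq_integral_simple ip r m)))
      \<longlonglongrightarrow> ennreal (norm (sesq_integral ip f m - sesq_integral_simple ip r m))"
    by (intro tendsto_ennrealI tendsto_norm tendsto_diff tendsto_const sesq_integral_LIMSEQ s)
  have "\<forall>\<^sub>F n in sequentially. ennreal (norm (sesq_integral_simple ip (s n) m - sesq_integral_simple ip r m)) \<le> ?I + ennreal e"
    using uniform_limitD[OF s(2) d(1)]
  proof (rule eventually_mono)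
    fix n assume n: "\<forall>t\<in>UNIV. dist (s n t) (f t) < d"
    have "ennreal (norm (sesq_integral_simple ip (\<lambda>t. s n t - r t) m))
        \<le> (\<integral>\<^sup>+t. ennreal (norm (s n t - r t)) \<partial>var_measure m)"
      by (intro norm_sesq_integral_simple_le simple_function_compose2[OF s(1) r])
    also have "\<dots> \<le> (\<integral>\<^sup>+t. ennreal (norm (f t - r t)) + ennreal d \<partial>var_measure m)"
    proof (rule nn_integral_mono)
      fix t
      have "norm (s n t - r t) \<le> norm (f t - r t) + d"
        using n[rule_format, of t] norm_triangle_ineq[of "f t - r t" "s n t - f t"]
        by (simp add: dist_norm)
      then show "ennreal (norm (s n t - r t)) \<le> ennreal (norm (f t - r t)) + ennreal d"
        using d(1) by (simp add: ennreal_leI flip: ennreal_plus)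
    qed
    also have "\<dots> = ?I + ennreal (d * norm m)"
      using meas d(1) by (subst nn_integral_add) (simp_all add: emeasure_var_measure_UNIV ennreal_mult)
    also have "\<dots> \<le> ?I + ennreal e"
      using d(2) by (intro add_left_mono ennreal_leI) simp
    finally show "ennreal (norm (sesq_integral_simple ip (s n) m - sesq_integral_simple ip r m)) \<le> ?I + ennreal e"
      by (simp add: sesq_integral_simple_diff[OF s(1) r])
  qed
  then show "ennreal (norm (sesq_integral ip f m - sesq_integral_simple ip r m)) \<le> ?I + ennreal e"
    by (rule tendsto_upperbound[OF lim]) simp
qed

lemma norm_sesq_integral_le:
  fixes f :: "'t \<Rightarrow> 'x"
  assumes f: "continuous_on UNIV f" and C: "\<And>t. norm (f t) \<le> C"
  shows "norm (sesq_integral ip f m) \<le> C * norm m"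
proof -
  have C0: "C \<ge> 0" by (rule order_trans[OF norm_ge_zero C])
  have "sesq_integral_simple ip (\<lambda>_. 0) m = 0" by (simp add: sesq_integral_simple_def)
  then have "ennreal (norm (sesq_integral ip f m)) \<le> (\<integral>\<^sup>+t. ennreal (norm (f t)) \<partial>var_measure m)"
    using norm_sesq_integral_diff_le[OF f, of "\<lambda>_. 0" m] by simp
  also have "\<dots> \<le> (\<integral>\<^sup>+t. ennreal C \<partial>var_measure m)"
    using C by (intro nn_integral_mono ennreal_leI)
  also have "\<dots> = ennreal (C * norm m)"
    using C0 by (simp add: emeasure_var_measure_UNIV ennreal_mult)
  finally show ?thesis using C0 by (simp add: ennreal_le_iff)
qed

end

end


section \<open>Approximation of indicator functions by continuous functions\<close>

text \<open>
  The functions \<open>max 0 (1 - n d(t, F))\<close> decrease to the indicator of \<open>F\<close>.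
\<close>

lemma continuous_approx_indicator_closed:
  fixes M :: "'t::metric_space measure"
  assumes sets_M [measurable_cong]: "sets M = sets borel" and "finite_measure M" and F: "closed F" and e: "e > 0"
  shows "\<exists>g. continuous_on UNIV g \<and> (\<integral>\<^sup>+t. ennreal \<bar>g t - indicator F t\<bar> \<partial>M) < ennreal e"
proof (cases "F = {}")
  case True
  then show ?thesis using e by (intro exI[of _ "\<lambda>_. 0"]) simp
next
  case False
  interpret finite_measure M by fact
  define g where "g n t = max 0 (1 - real n * infdist t F)" for n t
  have cont: "continuous_on UNIV (g n)" for n
    unfolding g_def by (intro continuous_intros)
  then have [measurable]: "g n \<in> borel_measurable borel" for n
    by (rule borel_measurable_continuous_onI)
  have [measurable]: "F \<in> sets borel" using F by simp
  have "(\<lambda>n. \<integral>\<^sup>+t. ennreal \<bar>g n t - indicator F t\<bar> \<partial>M) \<longlonglongrightarrow> (\<integral>\<^sup>+t. 0 \<partial>M)"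
  proof (rule nn_integral_dominated_convergence[where w = "\<lambda>_. 1"])
    show "AE t in M. ennreal \<bar>g n t - indicator F t\<bar> \<le> 1" for n
      by (intro AE_I2) (auto simp: g_def indicator_def infdist_nonneg ennreal_le_1)
    show "AE t in M. (\<lambda>n. ennreal \<bar>g n t - indicator F t\<bar>) \<longlonglongrightarrow> 0"
    proof (intro AE_I2 tendsto_eventually)
      fix t
      show "\<forall>\<^sub>F n in sequentially. ennreal \<bar>g n t - indicator F t\<bar> = 0"
      proof (cases "t \<in> F")
        case True
        then show ?thesis by (simp add: g_def)
      next
        case False
        then have d: "infdist t F > 0"
          using F \<open>F \<noteq> {}\<close> in_closed_iff_infdist_zero infdist_nonneg by (metis less_eq_real_def)
        obtain N :: nat where N: "1 < real N * infdist t F" using reals_Archimedean3[OF d] by blast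
        have "g n t = 0" if "n \<ge> N" for n
          using N mult_right_mono[of "real N" "real n" "infdist t F"] that d unfolding g_def by linarith
        then show ?thesis using False
          unfolding eventually_sequentially by (intro exI[of _ N]) simp
      qed
    qed
  qed (auto simp: less_top[symmetric])
  then have "\<forall>\<^sub>F n in sequentially. (\<integral>\<^sup>+t. ennreal \<bar>g n t - indicator F t\<bar> \<partial>M) < ennreal e"
    using e by (intro order_tendstoD(2)[where y = 0]) simp_all
  then obtain n where "(\<integral>\<^sup>+t. ennreal \<bar>g n t - indicator F t\<bar> \<partial>M) < ennreal e"
    unfolding eventually_sequentially by blast
  with cont show ?thesis by blast
qed

text \<open>
  Dynkin's argument starting from closed sets. The approximating functions are not required to
  have values in the unit interval, so that for a disjoint union one can add up approximations
  of finitely many of its members.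
\<close>

lemma continuous_approx_indicator:
  fixes M :: "'t::metric_space measure"
  assumes sets_M [measurable_cong]: "sets M = sets borel" and "finite_measure M"
    and "A \<in> sets borel" and "e > 0"
  shows "\<exists>g. continuous_on UNIV g \<and> (\<integral>\<^sup>+t. ennreal \<bar>g t - indicator A t\<bar> \<partial>M) < ennreal e"
proof -
  interpret finite_measure M by fact
  have space_M: "space M = UNIV" using sets_eq_imp_space_eq[OF sets_M] by simp
  have sigma: "sets borel = sigma_sets UNIV (Collect closed :: 't set set)"
    unfolding borel_eq_closed by (simp add: sets_measure_of)
  have "Int_stable (Collect closed :: 't set set)" by (auto simp: Int_stable_def)
  moreover have "Collect closed \<subseteq> Pow (UNIV :: 't set)" by simp
  moreover have "A \<in> sigma_sets UNIV (Collect closed)" using assms(3) by (simp only: sigma)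
  ultimately have "A \<in> sets borel \<and> (\<forall>e>0. \<exists>g. continuous_on UNIV g \<and>
      (\<integral>\<^sup>+t. ennreal \<bar>g t - indicator A t\<bar> \<partial>M) < ennreal e)"
  proof (induction rule: sigma_sets_induct_disjoint)
    case (basic F)
    then show ?case using continuous_approx_indicator_closed[OF sets_M assms(2)] by auto
  next
    case empty
    show ?case by (intro conjI allI impI exI[of _ "\<lambda>_. 0"]) simp_all
  next
    case (compl A)
    have "\<exists>h. continuous_on UNIV h \<and> (\<integral>\<^sup>+t. ennreal \<bar>h t - indicator (UNIV - A) t\<bar> \<partial>M) < ennreal e"
      if e: "e > 0" for e
    proof -
      obtain g where g: "continuous_on UNIV g" "(\<integral>\<^sup>+t. ennreal \<bar>g t - indicator A t\<bar> \<partial>M) < ennreal e"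
        using compl(2) e by blast
      have "\<bar>(1 - g t) - indicator (UNIV - A) t\<bar> = \<bar>g t - indicator A t\<bar>" for t
        by (auto simp: indicator_def)
      then show ?thesis using g by (intro exI[of _ "\<lambda>t. 1 - g t"]) (auto intro: continuous_intros)
    qed
    then show ?case using conjunct1[OF compl(2)] by (simp add: borel_open)
  next
    case (union A)
    have A [measurable]: "A i \<in> sets borel" for i using conjunct1[OF union(3)] .
    have "\<exists>h. continuous_on UNIV h \<and> (\<integral>\<^sup>+t. ennreal \<bar>h t - indicator (\<Union>i. A i) t\<bar> \<partial>M) < ennreal e"
      if e: "e > 0" for e
    proof -
      define B where "B n = (\<Union>i. A i) - (\<Union>i<n. A i)" for n :: nat
      have B [measurable]: "B n \<in> sets borel" for n unfolding B_def by measurable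
      have "(\<lambda>n. emeasure M (B n)) \<longlonglongrightarrow> emeasure M (\<Inter>n. B n)"
        by (rule Lim_emeasure_decseq)
          (auto simp: sets_M decseq_def B_def intro: less_le_trans)
      moreover have "(\<Inter>n. B n) = {}" by (auto simp: B_def)
      ultimately have "(\<lambda>n. emeasure M (B n)) \<longlonglongrightarrow> 0" by simp
      then have "\<forall>\<^sub>F n in sequentially. emeasure M (B n) < ennreal (e / 2)"
        using e by (intro order_tendstoD(2)[where y = 0]) simp_all
      then obtain N where N: "emeasure M (B N) < ennreal (e / 2)"
        unfolding eventually_sequentially by blast
      obtain d where d: "d > 0" "d * real N < e / 2" using obtain_small_factor[of "e / 2" "real N"] e by auto
      have "\<forall>i. \<exists>g. continuous_on UNIV g \<and> (\<integral>\<^sup>+t. ennreal \<bar>g t - indicator (A i) t\<bar> \<partial>M) < ennreal d"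
        using union(3) d(1) by blast
      from choice[OF this] obtain g where "\<forall>i. continuous_on UNIV (g i) \<and>
          (\<integral>\<^sup>+t. ennreal \<bar>g i t - indicator (A i) t\<bar> \<partial>M) < ennreal d" by (rule exE)
      then have g: "continuous_on UNIV (g i)"
          "(\<integral>\<^sup>+t. ennreal \<bar>g i t - indicator (A i) t\<bar> \<partial>M) < ennreal d" for i by simp_all
      have [measurable]: "g i \<in> borel_measurable borel" for i
        using g(1) by (rule borel_measurable_continuous_onI)
      have pointwise: "ennreal \<bar>(\<Sum>i<N. g i t) - indicator (\<Union>i. A i) t\<bar>
          \<le> (\<Sum>i<N. ennreal \<bar>g i t - indicator (A i) t\<bar>) + indicator (B N) t" for t
      proof -
        have "indicator (\<Union>i<N. A i) t = (\<Sum>i<N. indicator (A i) t :: real)"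
          using union(1) by (intro indicator_UN_disjoint) (auto simp: disjoint_family_on_def)
        moreover have "indicator (\<Union>i. A i) t = indicator (\<Union>i<N. A i) t + (indicator (B N) t :: real)"
          by (auto simp: B_def indicator_def)
        ultimately have "\<bar>(\<Sum>i<N. g i t) - indicator (\<Union>i. A i) t\<bar>
            = \<bar>(\<Sum>i<N. g i t - indicator (A i) t) - indicator (B N) t\<bar>"
          by (simp only: sum_subtractf diff_diff_eq)
        also have "\<dots> \<le> \<bar>\<Sum>i<N. g i t - indicator (A i) t\<bar> + \<bar>indicator (B N) t\<bar>"
          by (rule abs_triangle_ineq4)
        also have "\<dots> \<le> (\<Sum>i<N. \<bar>g i t - indicator (A i) t\<bar>) + indicator (B N) t"
          by (intro add_mono sum_abs) simp
        finally have "ennreal \<bar>(\<Sum>i<N. g i t) - indicator (\<Union>i. A i) t\<bar>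
            \<le> ennreal ((\<Sum>i<N. \<bar>g i t - indicator (A i) t\<bar>) + indicator (B N) t)" by (rule ennreal_leI)
        then show ?thesis
          by (simp add: sum_nonneg flip: ennreal_indicator)
      qed
      have "(\<integral>\<^sup>+t. ennreal \<bar>(\<Sum>i<N. g i t) - indicator (\<Union>i. A i) t\<bar> \<partial>M)
          \<le> (\<integral>\<^sup>+t. (\<Sum>i<N. ennreal \<bar>g i t - indicator (A i) t\<bar>) + indicator (B N) t \<partial>M)"
        by (rule nn_integral_mono) (rule pointwise)
      also have "\<dots> = (\<Sum>i<N. \<integral>\<^sup>+t. ennreal \<bar>g i t - indicator (A i) t\<bar> \<partial>M) + emeasure M (B N)"
        by (subst nn_integral_add) (auto simp: nn_integral_sum sets_M simp del: sum_ennreal)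
      also have "\<dots> \<le> (\<Sum>i<N. ennreal d) + emeasure M (B N)"
        using g(2) by (intro add_right_mono sum_mono less_imp_le)
      also have "\<dots> \<le> ennreal (e / 2) + emeasure M (B N)"
        using d by (intro add_right_mono)
          (simp add: ennreal_of_nat_eq_real_of_nat ennreal_leI mult.commute flip: ennreal_mult)
      also have "\<dots> < ennreal (e / 2) + ennreal (e / 2)"
        using N by (simp add: ennreal_add_left_cancel_less)
      also have "\<dots> = ennreal e" using e by (simp flip: ennreal_plus)
      finally show ?thesis
        using g(1) by (intro exI[of _ "\<lambda>t. \<Sum>i<N. g i t"]) (auto intro: continuous_intros)
    qed
    then show ?case using A by blast
  qed
  with assms(4) show ?thesis by blast
qed


section \<open>A vector measure is determined by its integrals of continuous functions\<close>

context hilbert_space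
begin

lemma sesq_integral_simple_indicator:
  assumes A: "A \<in> sets borel"
  shows "simple_function borel (\<lambda>t. indicator A t *\<^sub>R x)"
    and "sesq_integral_simple ip (\<lambda>t. indicator A t *\<^sub>R x) m = ip x (cabv_val m A)"
proof -
  let ?h = "\<lambda>b. if b then x else 0"
  have p: "simple_function borel (\<lambda>t. t \<in> A)"
    unfolding simple_function_def
  proof safe
    fix t
    have "(\<lambda>t. t \<in> A) -` {t \<in> A} \<inter> space borel = (if t \<in> A then A else - A)" by auto
    then show "(\<lambda>t. t \<in> A) -` {t \<in> A} \<inter> space borel \<in> sets borel" using A by auto
  qed simp
  have eq: "(\<lambda>t. indicator A t *\<^sub>R x) = (\<lambda>t. ?h (t \<in> A))" by (auto simp: fun_eq_iff)
  show "simple_function borel (\<lambda>t. indicator A t *\<^sub>R x)"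
    unfolding eq using p by (rule simple_function_compose1)
  have "sesq_integral_simple ip (\<lambda>t. ?h (t \<in> A)) m
      = (\<Sum>y\<in>range (\<lambda>t. t \<in> A). ip (?h y) (cabv_val m ((\<lambda>t. t \<in> A) -` {y})))"
    by (rule sesq_integral_simple_compose[OF p])
  also have "\<dots> = (\<Sum>y\<in>UNIV. ip (?h y) (cabv_val m ((\<lambda>t. t \<in> A) -` {y})))"
  proof (rule sum.mono_neutral_left)
    show "\<forall>y\<in>UNIV - range (\<lambda>t. t \<in> A). ip (?h y) (cabv_val m ((\<lambda>t. t \<in> A) -` {y})) = 0"
    proof
      fix y assume "y \<in> UNIV - range (\<lambda>t. t \<in> A)"
      then have "(\<lambda>t. t \<in> A) -` {y} = {}" by auto
      then show "ip (?h y) (cabv_val m ((\<lambda>t. t \<in> A) -` {y})) = 0" by (simp only: cabv_val_empty ip_0_right)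
    qed
  qed auto
  also have "\<dots> = ip x (cabv_val m A)"
    by (simp add: UNIV_bool vimage_def)
  finally show "sesq_integral_simple ip (\<lambda>t. indicator A t *\<^sub>R x) m = ip x (cabv_val m A)" unfolding eq .
qed

text \<open>
  If \<open>g\<close> is close to the indicator of \<open>A\<close> in \<open>L\<^sup>1\<close> of the variation, then \<open>(x, m(A))\<close> is close to the
  integral of \<open>g x\<close>, which is zero. The choice \<open>x = m(A)\<close> gives the claim.
\<close>

lemma cabv_eq_0_if_integrals_vanish:
  fixes m :: "('t::metric_space, 'x) cabv"
  assumes T: "compact (UNIV :: 't set)"
    and zero: "\<And>f. continuous_on UNIV f \<Longrightarrow> sesq_integral ip f m = 0"
  shows "m = 0"
proof (rule cabv_eqI)
  fix A show "cabv_val m A = cabv_val 0 A"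
  proof (cases "A \<in> sets borel")
    case False
    then show ?thesis using cabv_setD(3)[OF cabv_val] by metis
  next
    case A [measurable]: True
    let ?x = "cabv_val m A"
    have "ennreal (norm (ip ?x ?x)) \<le> 0 + ennreal e" if e: "e > 0" for e
    proof -
      obtain d where d: "d > 0" "d * norm ?x < e" using obtain_small_factor[OF e norm_ge_zero] by blast
      obtain g where g: "continuous_on UNIV g" "(\<integral>\<^sup>+t. ennreal \<bar>g t - indicator A t\<bar> \<partial>var_measure m) < ennreal d"
        using continuous_approx_indicator[OF sets_var_measure finite_measure_var_measure A d(1)] by blast
      have [measurable]: "g \<in> borel_measurable borel" using g(1) by (rule borel_measurable_continuous_onI)
      have cont: "continuous_on UNIV (\<lambda>t. g t *\<^sub>R ?x)" using g(1) by (intro continuous_intros)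
      have "ennreal (norm (sesq_integral ip (\<lambda>t. g t *\<^sub>R ?x) m - sesq_integral_simple ip (\<lambda>t. indicator A t *\<^sub>R ?x) m))
          \<le> (\<integral>\<^sup>+t. ennreal (norm (g t *\<^sub>R ?x - indicator A t *\<^sub>R ?x)) \<partial>var_measure m)"
        by (rule norm_sesq_integral_diff_le[OF T cont sesq_integral_simple_indicator(1)[OF A]])
      also have "\<dots> = (\<integral>\<^sup>+t. ennreal (norm ?x) * ennreal \<bar>g t - indicator A t\<bar> \<partial>var_measure m)"
      proof -
        have "norm (g t *\<^sub>R ?x - indicator A t *\<^sub>R ?x) = norm ?x * \<bar>g t - indicator A t\<bar>" for t
          by (simp add: mult.commute flip: scaleR_left_diff_distrib)
        then show ?thesis by (simp add: ennreal_mult)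
      qed
      also have "\<dots> = ennreal (norm ?x) * (\<integral>\<^sup>+t. ennreal \<bar>g t - indicator A t\<bar> \<partial>var_measure m)"
        by (intro nn_integral_cmult) measurable
      also have "\<dots> \<le> ennreal (norm ?x) * ennreal d"
        by (intro mult_left_mono less_imp_le[OF g(2)]) simp
      also have "\<dots> = ennreal (d * norm ?x)" using d by (simp add: ennreal_mult mult.commute)
      also have "\<dots> \<le> ennreal e" using d by (intro ennreal_leI) simp
      finally show ?thesis
        by (simp add: zero[OF cont] sesq_integral_simple_indicator(2)[OF A])
    qed
    then have "ennreal (norm (ip ?x ?x)) \<le> 0" by (rule ennreal_le_epsilon)
    then have "ip ?x ?x = 0" by simp
    then show ?thesis by (simp add: ip_self cabv_val_zero)
  qed
qed

end


section \<open>A Borel measure dominating a functional on continuous functions\<close>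

text \<open>
  The radial retraction onto the ball of radius \<open>a\<close>. Through the denominator \<open>max a (norm x)\<close>
  it is given by one continuous expression if \<open>a > 0\<close>; for \<open>a = 0\<close> it is constantly zero.
\<close>

definition clip :: "real \<Rightarrow> 'x::real_normed_vector \<Rightarrow> 'x" where
  "clip a x = (a / max a (norm x)) *\<^sub>R x"

lemma norm_clip_diff:
  assumes "0 \<le> a" "0 \<le> b"
  shows "norm (clip b x - clip a x) = \<bar>min b (norm x) - min a (norm x)\<bar>"
proof -
  have "c / max c (norm x) * norm x = min c (norm x)" if "0 \<le> c" for c
    using that by (cases "c \<le> norm x") (auto simp: max_def min_def)
  then have "(b / max b (norm x) - a / max a (norm x)) * norm x = min b (norm x) - min a (norm x)"
    using assms by (simp add: left_diff_distrib)
  moreover have "norm (clip b x - clip a x) = \<bar>(b / max b (norm x) - a / max a (norm x)) * norm x\<bar>"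
    by (simp add: clip_def abs_mult flip: scaleR_left_diff_distrib)
  ultimately show ?thesis by simp
qed

lemma clip_0_left [simp]: "clip 0 x = 0"
  by (simp add: clip_def)

lemma clip_eq_self: "norm x \<le> a \<Longrightarrow> clip a x = x"
  by (cases "x = 0") (auto simp: clip_def max_def)

lemma norm_clip: "0 \<le> a \<Longrightarrow> norm (clip a x) = min a (norm x)"
  using norm_clip_diff[of 0 a x] by simp

lemma continuous_on_clip:
  assumes "continuous_on S f" "0 \<le> a"
  shows "continuous_on S (\<lambda>t. clip a (f t))"
proof (cases "a = 0")
  case False
  with assms(2) have "max a (norm (f t)) \<noteq> 0" for t by linarith
  then show ?thesis unfolding clip_def using assms(1) by (intro continuous_intros) auto
qed simp

lemma norm_diff_clip: "0 \<le> a \<Longrightarrow> norm (x - clip a x) = max 0 (norm x - a)"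
  using norm_clip_diff[of a "max a (norm x)" x] by (simp add: clip_eq_self)

text \<open>
  The distance to the complement, except for \<open>U = UNIV\<close>, where the distance to the empty set
  is zero by convention.
\<close>

lemma open_positivity_function:
  fixes U :: "'t::metric_space set"
  assumes "open U"
  shows "\<exists>d. continuous_on UNIV d \<and> (\<forall>t. d t \<ge> (0::real)) \<and> (\<forall>t. d t > 0 \<longleftrightarrow> t \<in> U)"
proof (cases "U = UNIV")
  case True
  then show ?thesis by (intro exI[of _ "\<lambda>_. 1"]) auto
next
  case False
  then have "closed (- U)" "- U \<noteq> {}" using assms by auto
  then have "infdist t (- U) > 0 \<longleftrightarrow> t \<in> U" for t
    using in_closed_iff_infdist_zero[of "- U" t] infdist_nonneg[of t "- U"] by force
  then show ?thesis by (intro exI[of _ "\<lambda>t. infdist t (- U)"]) (auto intro: continuous_intros infdist_nonneg)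
qed

lemma ennreal_add_le: "ennreal (x + y) \<le> ennreal x + ennreal y"
  by (cases "0 \<le> x"; cases "0 \<le> y") (auto simp: ennreal_neg intro: ennreal_leI order_trans simp flip: ennreal_plus)

lemma ennreal_sum_le: "ennreal (\<Sum>i\<in>I. f i) \<le> (\<Sum>i\<in>I. ennreal (f i))"
proof (induction I rule: infinite_finite_induct)
  case (insert i I)
  then show ?case using order_trans[OF ennreal_add_le add_left_mono] by simp
qed auto

locale bounded_functional_on_continuous =
  fixes L :: "('t::metric_space \<Rightarrow> 'x::real_normed_vector) \<Rightarrow> real" and B :: real
  assumes compact_T: "compact (UNIV :: 't set)"
    and L_add: "\<And>f g. continuous_on UNIV f \<Longrightarrow> continuous_on UNIV g \<Longrightarrow> L (\<lambda>t. f t + g t) = L f + L g"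
    and L_scaleR: "\<And>r f. continuous_on UNIV f \<Longrightarrow> L (\<lambda>t. r *\<^sub>R f t) = r * L f"
    and L_bound: "\<And>f C. continuous_on UNIV f \<Longrightarrow> (\<And>t. norm (f t) \<le> C) \<Longrightarrow> L f \<le> C * B"
begin

lemma L_zero: "L (\<lambda>_. 0) = 0"
  using L_scaleR[of "\<lambda>_. 0" 0] by simp

lemma B_nonneg: "B \<ge> 0"
  using L_bound[of "\<lambda>_. 0" 1] by (simp add: L_zero)

lemma L_diff:
  assumes "continuous_on UNIV f" "continuous_on UNIV g"
  shows "L (\<lambda>t. f t - g t) = L f - L g"
proof -
  have "continuous_on UNIV (\<lambda>t. -1 *\<^sub>R g t)" using assms(2) by (intro continuous_intros)
  then show ?thesis using L_add[OF assms(1), of "\<lambda>t. -1 *\<^sub>R g t"] L_scaleR[OF assms(2), of "-1"] by simp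
qed

lemma L_sum:
  "(\<And>i. i \<in> I \<Longrightarrow> continuous_on UNIV (f i)) \<Longrightarrow> L (\<lambda>t. \<Sum>i\<in>I. f i t) = (\<Sum>i\<in>I. L (f i))"
proof (induction I rule: infinite_finite_induct)
  case (insert i I)
  have "L (\<lambda>t. f i t + (\<Sum>j\<in>I. f j t)) = L (f i) + L (\<lambda>t. \<Sum>j\<in>I. f j t)"
    using insert.prems by (intro L_add continuous_on_sum) auto
  then show ?case using insert by simp
qed (simp_all add: L_zero)

text \<open>
  The continuous functions with norm dominated by the indicator of \<open>U\<close>. The supremum of \<open>L\<close> over
  them is the total variation of \<open>L\<close> on an open set \<open>U\<close>; outer approximation by open sets extends it
  to all sets.
\<close>

definition below :: "'t set \<Rightarrow> ('t \<Rightarrow> 'x) set" where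
  "below U = {f. continuous_on UNIV f \<and> (\<forall>t. norm (f t) \<le> indicator U t)}"

definition inner_content :: "'t set \<Rightarrow> ennreal" where
  "inner_content U = (SUP f\<in>below U. ennreal (L f))"

definition outer_content :: "'t set \<Rightarrow> ennreal" where
  "outer_content A = (INF U\<in>{U. open U \<and> A \<subseteq> U}. inner_content U)"

lemma belowD: "f \<in> below U \<Longrightarrow> continuous_on UNIV f" "f \<in> below U \<Longrightarrow> norm (f t) \<le> indicator U t"
  by (simp_all add: below_def)

lemma below_support:
  assumes "f \<in> below U" "\<delta> > 0"
  shows "{t. \<delta> \<le> norm (f t)} \<subseteq> U"
proof safe
  fix t assume "\<delta> \<le> norm (f t)"
  then show "t \<in> U"
    using belowD(2)[OF assms(1), of t] assms(2) by (cases "t \<in> U") auto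
qed

lemma below_zero: "(\<lambda>_. 0) \<in> below U"
  by (simp add: below_def)

lemma below_ne: "below U \<noteq> {}"
  using below_zero by blast

lemma below_mono: "U \<subseteq> V \<Longrightarrow> below U \<subseteq> below V"
  unfolding below_def by (auto simp: indicator_def split: if_splits) (metis order_trans zero_le_one subsetD norm_le_zero_iff norm_zero)

lemma L_le_inner: "f \<in> below U \<Longrightarrow> ennreal (L f) \<le> inner_content U"
  unfolding inner_content_def by (rule SUP_upper)

lemma inner_mono: "U \<subseteq> V \<Longrightarrow> inner_content U \<le> inner_content V"
  unfolding inner_content_def by (rule SUP_subset_mono[OF below_mono]) auto

lemma inner_le: "inner_content U \<le> ennreal B"
  unfolding inner_content_def
proof (rule SUP_least)
  fix f assume f: "f \<in> below U"
  have "norm (f t) \<le> 1" for t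
    using belowD(2)[OF f, of t] by (rule order_trans) (simp add: indicator_def)
  then show "ennreal (L f) \<le> ennreal B" using L_bound[OF belowD(1)[OF f], of 1] by (simp add: ennreal_leI)
qed

lemma outer_open: "open U \<Longrightarrow> outer_content U = inner_content U"
  unfolding outer_content_def by (rule antisym) (auto intro: INF_lower INF_greatest inner_mono)

lemma outer_le: "open U \<Longrightarrow> A \<subseteq> U \<Longrightarrow> outer_content A \<le> inner_content U"
  unfolding outer_content_def by (rule INF_lower) simp

lemma outer_mono: "A \<subseteq> A' \<Longrightarrow> outer_content A \<le> outer_content A'"
  unfolding outer_content_def by (rule INF_superset_mono) auto

lemma outer_finite: "outer_content A \<le> ennreal B"
  using outer_le[of UNIV A] inner_le[of UNIV] by (meson open_UNIV order_trans top_greatest)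

text \<open>
  Every admissible function is close, in the value of \<open>L\<close>, to one that vanishes outside a
  compact subset of the open set.
\<close>

lemma below_truncate:
  assumes f: "f \<in> below U" and e: "e > 0"
  obtains f' \<delta> where "\<delta> > 0" "f' \<in> below U" "\<And>t. norm (f t) < \<delta> \<Longrightarrow> f' t = 0" "L f \<le> L f' + e"
proof -
  obtain \<delta> where d: "\<delta> > 0" "\<delta> * B < e" using obtain_small_factor[OF e B_nonneg] by blast
  let ?f' = "\<lambda>t. f t - clip \<delta> (f t)"
  note cont = continuous_on_clip[OF belowD(1)[OF f] less_imp_le[OF d(1)]]
  have "norm (?f' t) \<le> norm (f t)" for t using d(1) by (simp add: norm_diff_clip)
  then have "?f' \<in> below U"
    using f cont unfolding below_def by (auto intro!: continuous_on_diff intro: order_trans)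
  moreover have "?f' t = 0" if "norm (f t) < \<delta>" for t using that by (simp add: clip_eq_self)
  moreover have "L f \<le> L ?f' + e"
    using L_bound[OF cont, of \<delta>] d L_diff[OF belowD(1)[OF f] cont] by (simp add: norm_clip)
  ultimately show ?thesis using that d(1) by blast
qed

text \<open>
  After truncation only a compact subset \<open>K\<close> of the union matters. It is covered by finitely many
  of the sets, and a partition of unity on \<open>K\<close> splits the function.
\<close>

lemma inner_UN_le:
  assumes U: "\<And>n::nat. open (U n)"
  shows "inner_content (\<Union>n. U n) \<le> (\<Sum>n. inner_content (U n))"
  unfolding inner_content_def[of "\<Union>n. U n"]
proof (rule SUP_least)
  fix f assume f: "f \<in> below (\<Union>n. U n)"
  show "ennreal (L f) \<le> (\<Sum>n. inner_content (U n))"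
  proof (rule ennreal_le_epsilon)
    fix e :: real assume e: "e > 0"
    obtain f' \<delta> where \<delta>: "\<delta> > 0" and f': "f' \<in> below (\<Union>n. U n)"
      and f'_0: "\<And>t. norm (f t) < \<delta> \<Longrightarrow> f' t = 0" and L_f': "L f \<le> L f' + e"
      by (rule below_truncate[OF f e]) (rule that)
    define K where "K = {t. \<delta> \<le> norm (f t)}"
    have "closed K"
      unfolding K_def by (intro closed_Collect_le continuous_intros belowD(1)[OF f])
    then have K: "compact K" using compact_T by (metis compact_Int_closed Int_UNIV_left)
    have "K \<subseteq> (\<Union>n. U n)"
      unfolding K_def by (rule below_support[OF f \<delta>])
    then obtain I where I: "finite I" "K \<subseteq> (\<Union>n\<in>I. U n)"
      using compactE_image[OF K, of UNIV U] U by metis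
    have "\<forall>n. \<exists>d. continuous_on UNIV d \<and> (\<forall>t. d t \<ge> (0::real)) \<and> (\<forall>t. d t > 0 \<longleftrightarrow> t \<in> U n)"
      using open_positivity_function[OF U] by blast
    from choice[OF this] obtain d where "\<forall>n. continuous_on UNIV (d n) \<and> (\<forall>t. d n t \<ge> (0::real)) \<and>
        (\<forall>t. d n t > 0 \<longleftrightarrow> t \<in> U n)" by (rule exE)
    then have d: "continuous_on UNIV (d n)" "d n t \<ge> (0::real)" "d n t > 0 \<longleftrightarrow> t \<in> U n" for n t
      by simp_all
    define D where "D t = (\<Sum>n\<in>I. d n t)" for t
    have D_cont: "continuous_on S D" for S
      unfolding D_def by (intro continuous_on_sum continuous_on_subset[OF d(1)]) auto
    have D_pos: "D t > 0" if t: "t \<in> K" for t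
    proof -
      obtain n where "n \<in> I" "t \<in> U n" using I(2) t by blast
      then show ?thesis
        unfolding D_def using I(1) d by (intro sum_pos2[of I n]) auto
    qed
    \<comment> \<open>A positive lower bound of \<open>D\<close> on \<open>K\<close>; replacing \<open>D\<close> by \<open>max \<eta> D\<close> in the denominator makes the
        partition functions continuous everywhere.\<close>
    obtain \<eta> where \<eta>: "\<eta> > 0" "\<And>t. t \<in> K \<Longrightarrow> D t \<ge> \<eta>"
    proof (cases "K = {}")
      case False
      then obtain t where "t \<in> K" "\<forall>u\<in>K. D t \<le> D u"
        using continuous_attains_inf[OF K _ D_cont] by blast
      then show ?thesis using that[of "D t"] D_pos by blast
    qed (use that[of 1] in auto)
    define \<phi> where "\<phi> n t = d n t / max \<eta> (D t)" for n t
    have max_pos: "max \<eta> (D t) > 0" for t using \<eta>(1) by simp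
    have \<phi>_cont: "continuous_on UNIV (\<phi> n)" for n
      unfolding \<phi>_def using max_pos by (intro continuous_intros d D_cont) (metis less_irrefl)
    have part: "(\<lambda>t. \<phi> n t *\<^sub>R f' t) \<in> below (U n)" if "n \<in> I" for n
    proof -
      have "norm (\<phi> n t *\<^sub>R f' t) \<le> indicator (U n) t" for t
      proof (cases "t \<in> U n")
        case True
        have "d n t \<le> D t" unfolding D_def using I(1) that d(2) by (intro member_le_sum) auto
        then have "0 \<le> \<phi> n t" "\<phi> n t \<le> 1"
          using max_pos[of t] d(2)[of n t] by (simp_all add: \<phi>_def pos_divide_le_eq)
        moreover have "norm (f' t) \<le> 1"
          using belowD(2)[OF f', of t] by (rule order_trans) (simp add: indicator_def)
        ultimately show ?thesis using True by (simp add: mult_le_one)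
      next
        case False
        then have "d n t = 0" using d(2)[of n t] d(3)[of n t] by simp
        then show ?thesis by (simp add: \<phi>_def)
      qed
      then show ?thesis
        unfolding below_def using \<phi>_cont belowD(1)[OF f'] by (auto intro!: continuous_intros)
    qed
    have "f' = (\<lambda>t. \<Sum>n\<in>I. \<phi> n t *\<^sub>R f' t)"
    proof
      fix t
      have "(\<Sum>n\<in>I. \<phi> n t *\<^sub>R f' t) = (D t / max \<eta> (D t)) *\<^sub>R f' t"
        by (simp add: \<phi>_def D_def sum_divide_distrib flip: scaleR_sum_left)
      also have "\<dots> = f' t"
      proof (cases "t \<in> K")
        case True
        then show ?thesis using \<eta>(2) D_pos[OF True] by (simp add: max_absorb2)
      next
        case False
        then show ?thesis using f'_0 by (simp add: K_def)
      qed
      finally show "f' t = (\<Sum>n\<in>I. \<phi> n t *\<^sub>R f' t)" ..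
    qed
    then have "L f' = (\<Sum>n\<in>I. L (\<lambda>t. \<phi> n t *\<^sub>R f' t))"
      using L_sum[of I "\<lambda>n t. \<phi> n t *\<^sub>R f' t"] belowD(1)[OF part] by simp
    then have "ennreal (L f') \<le> (\<Sum>n\<in>I. ennreal (L (\<lambda>t. \<phi> n t *\<^sub>R f' t)))"
      using ennreal_sum_le by metis
    also have "\<dots> \<le> (\<Sum>n\<in>I. inner_content (U n))"
      by (intro sum_mono L_le_inner part)
    also have "\<dots> \<le> (\<Sum>n. inner_content (U n))"
      using I(1) by (intro sum_le_suminf) auto
    finally have "ennreal (L f') \<le> (\<Sum>n. inner_content (U n))" .
    moreover have "ennreal (L f) \<le> ennreal (L f') + ennreal e"
      using order_trans[OF ennreal_leI[OF L_f'] ennreal_add_le] .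
    ultimately show "ennreal (L f) \<le> (\<Sum>n. inner_content (U n)) + ennreal e"
      by (meson add_right_mono order_trans)
  qed
qed

lemma outer_empty: "outer_content {} = 0"
proof -
  have "inner_content {} \<le> 0"
    unfolding inner_content_def
  proof (rule SUP_least)
    fix f assume "f \<in> below {}"
    then have "f = (\<lambda>_. 0)" using belowD(2)[of f "{}"] by (auto simp: fun_eq_iff)
    then show "ennreal (L f) \<le> 0" by (simp add: L_zero)
  qed
  then show ?thesis by (simp add: outer_open)
qed

lemma outer_countably_subadditive: "outer_content (\<Union>n. A n) \<le> (\<Sum>n::nat. outer_content (A n))"
proof (rule ennreal_le_epsilon)
  fix e :: real assume e: "e > 0"
  have "\<exists>U. open U \<and> A n \<subseteq> U \<and> inner_content U \<le> outer_content (A n) + ennreal (e * (1/2) ^ Suc n)" for n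
  proof -
    have "outer_content (A n) \<noteq> top" using outer_finite[of "A n"] by (auto simp: top_unique)
    moreover have "0 < ennreal (e * (1/2) ^ Suc n)" using e by simp
    ultimately have "outer_content (A n) + 0 < outer_content (A n) + ennreal (e * (1/2) ^ Suc n)"
      unfolding ennreal_add_left_cancel_less infinity_ennreal_def by blast
    then have "(INF U\<in>{U. open U \<and> A n \<subseteq> U}. inner_content U) < outer_content (A n) + ennreal (e * (1/2) ^ Suc n)"
      by (simp only: outer_content_def[of "A n"] add_0_right)
    then show ?thesis unfolding INF_less_iff by (auto intro: less_imp_le)
  qed
  then obtain U where U: "\<And>n. open (U n)" "\<And>n. A n \<subseteq> U n"
    "\<And>n. inner_content (U n) \<le> outer_content (A n) + ennreal (e * (1/2) ^ Suc n)" by metis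
  have "outer_content (\<Union>n. A n) \<le> inner_content (\<Union>n. U n)"
    using U by (intro outer_le) auto
  also have "\<dots> \<le> (\<Sum>n. inner_content (U n))" by (rule inner_UN_le[OF U(1)])
  also have "\<dots> \<le> (\<Sum>n. outer_content (A n) + ennreal (e * (1/2) ^ Suc n))"
    using U(3) by (intro suminf_le) auto
  also have "\<dots> = (\<Sum>n. outer_content (A n)) + (\<Sum>n. ennreal (e * (1/2) ^ Suc n))"
    by (rule suminf_add[symmetric]) auto
  also have "(\<Sum>n. ennreal (e * (1/2) ^ Suc n)) = ennreal e"
    using e sums_mult[OF power_half_series, of e] by (intro suminf_ennreal_eq) auto
  finally show "outer_content (\<Union>n. A n) \<le> (\<Sum>n. outer_content (A n)) + ennreal e" .
qed

text \<open>
  For open \<open>U\<close> containing \<open>A\<close>, a function below \<open>U \<inter> V\<close> may be assumed to live on a closed set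
  \<open>K\<close> contained in \<open>U \<inter> V\<close>. Functions below \<open>U - K\<close> have disjoint support, so sums of the two
  kinds are below \<open>U\<close>, and \<open>U - K\<close> is an open set containing \<open>A - V\<close>.
\<close>

lemma outer_open_splits:
  assumes V: "open V"
  shows "outer_content (A \<inter> V) + outer_content (A - V) \<le> outer_content A"
  unfolding outer_content_def[of A]
proof (rule INF_greatest, safe)
  fix U assume U: "open U" "A \<subseteq> U"
  have "ennreal (L f) + outer_content (U - V) \<le> inner_content U" if f: "f \<in> below (U \<inter> V)" for f
  proof (rule ennreal_le_epsilon)
    fix e :: real assume e: "e > 0"
    obtain f' \<delta> where \<delta>: "\<delta> > 0" and f': "f' \<in> below (U \<inter> V)"
      and f'_0: "\<And>t. norm (f t) < \<delta> \<Longrightarrow> f' t = 0" and L_f': "L f \<le> L f' + e"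
      by (rule below_truncate[OF f e]) (rule that)
    define K where "K = {t. \<delta> \<le> norm (f t)}"
    have K: "closed K"
      unfolding K_def by (intro closed_Collect_le continuous_intros belowD(1)[OF f])
    have KUV: "K \<subseteq> U \<inter> V"
      unfolding K_def by (rule below_support[OF f \<delta>])
    have f'U: "f' \<in> below U" using f' below_mono[of "U \<inter> V" U] by blast
    have pair: "ennreal (L f') + ennreal (L h) \<le> inner_content U" if h: "h \<in> below (U - K)" for h
    proof -
      have hU: "h \<in> below U" using h below_mono[of "U - K" U] by blast
      have "norm (f' t + h t) \<le> indicator U t" for t
      proof (cases "t \<in> K")
        case True
        then have "h t = 0" using belowD(2)[OF h, of t] by simp
        then show ?thesis using belowD(2)[OF f'U, of t] by simp
      next
        case False
        then have "f' t = 0" using f'_0 by (simp add: K_def)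
        then show ?thesis using belowD(2)[OF hU, of t] by simp
      qed
      then have "(\<lambda>t. f' t + h t) \<in> below U"
        unfolding below_def using belowD(1)[OF f'] belowD(1)[OF h] by (auto intro: continuous_on_add)
      then have "ennreal (L f' + L h) \<le> inner_content U"
        using L_le_inner L_add[OF belowD(1)[OF f'] belowD(1)[OF h]] by metis
      then show ?thesis
        using L_le_inner[OF f'U] L_le_inner[OF hU]
        by (cases "0 \<le> L f'"; cases "0 \<le> L h") (auto simp: ennreal_neg)
    qed
    have "ennreal (L f) + outer_content (U - V) \<le> ennreal (L f) + inner_content (U - K)"
      using U(1) K KUV by (intro add_left_mono outer_le) auto
    also have "\<dots> \<le> ennreal (L f') + ennreal e + inner_content (U - K)"
      by (intro add_right_mono order_trans[OF ennreal_leI[OF L_f'] ennreal_add_le])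
    also have "\<dots> = (ennreal (L f') + inner_content (U - K)) + ennreal e" by (simp add: ac_simps)
    also have "ennreal (L f') + inner_content (U - K) = (SUP h\<in>below (U - K). ennreal (L f') + ennreal (L h))"
      unfolding inner_content_def[of "U - K"] by (rule ennreal_SUP_add_right[OF below_ne])
    also have "\<dots> \<le> inner_content U" by (intro SUP_least pair)
    finally show "ennreal (L f) + outer_content (U - V) \<le> inner_content U + ennreal e" by (simp add: add_right_mono)
  qed
  then have "inner_content (U \<inter> V) + outer_content (U - V) \<le> inner_content U"
    unfolding inner_content_def[of "U \<inter> V"] ennreal_SUP_add_left[OF below_ne, symmetric] by (intro SUP_least)
  moreover have "outer_content (A \<inter> V) \<le> inner_content (U \<inter> V)" using U V by (intro outer_le) auto
  moreover have "outer_content (A - V) \<le> outer_content (U - V)" using U by (intro outer_mono) auto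
  ultimately show "outer_content (A \<inter> V) + outer_content (A - V) \<le> inner_content U"
    by (meson add_mono order_trans)
qed

lemma outer_measure_space_outer: "outer_measure_space (Pow UNIV) outer_content"
  unfolding outer_measure_space_def positive_def increasing_def countably_subadditive_def
  using outer_empty outer_mono outer_countably_subadditive by auto

lemma measure_space_outer: "measure_space UNIV (sets borel) outer_content"
proof -
  interpret P: sigma_algebra UNIV "Pow (UNIV :: 't set)" by (rule sigma_algebra_Pow)
  let ?\<Lambda> = "lambda_system UNIV (Pow UNIV) outer_content"
  have ms: "measure_space UNIV ?\<Lambda> outer_content"
    by (rule P.caratheodory_lemma[OF outer_measure_space_outer])
  then have sa: "sigma_algebra UNIV ?\<Lambda>" by (simp add: measure_space_def)
  have "V \<in> ?\<Lambda>" if V: "open V" for V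
  proof -
    have "outer_content A \<le> outer_content (A \<inter> V) + outer_content (A - V)" for A
    proof -
      have "outer_content (\<Union>n. binaryset (A \<inter> V) (A - V) n) \<le> (\<Sum>n. outer_content (binaryset (A \<inter> V) (A - V) n))"
        by (rule outer_countably_subadditive)
      also have "(\<Sum>n. outer_content (binaryset (A \<inter> V) (A - V) n)) = outer_content (A \<inter> V) + outer_content (A - V)"
        by (rule suminf_binaryset_eq[of outer_content, OF outer_empty])
      also have "(\<Union>n. binaryset (A \<inter> V) (A - V) n) = A" by (auto simp: UN_binaryset_eq)
      finally show ?thesis .
    qed
    then show ?thesis
      unfolding P.lambda_system_eq using outer_open_splits[OF V] by (auto intro: antisym)
  qed
  then have "sigma_sets UNIV (Collect open) \<subseteq> ?\<Lambda>"
    using sigma_algebra.sigma_sets_subset[OF sa, of "Collect open"] by blast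
  moreover have "sets borel = sigma_sets UNIV (Collect open :: 't set set)"
    unfolding borel_def by (simp add: sets_measure_of)
  moreover have "sigma_algebra UNIV (sets (borel :: 't measure))"
    using sets.sigma_algebra_axioms[of borel] by simp
  ultimately show ?thesis using measure_down[OF ms] by simp
qed

definition dominating_measure :: "'t measure" where
  "dominating_measure = measure_of UNIV (sets borel) outer_content"

lemma sets_dominating_measure [simp, measurable_cong]: "sets dominating_measure = sets borel"
  unfolding dominating_measure_def
  using sets.sigma_sets_eq[of borel] by (simp add: sets_measure_of_conv)

lemma emeasure_dominating_measure: "A \<in> sets borel \<Longrightarrow> emeasure dominating_measure A = outer_content A"
  unfolding dominating_measure_def using measure_space_outer
  by (intro emeasure_measure_of_sigma) (auto simp: measure_space_def)

lemma emeasure_dominating_measure_le: "emeasure dominating_measure UNIV \<le> ennreal B"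
  using outer_finite by (simp add: emeasure_dominating_measure)

lemma L_le_scaled_inner:
  assumes g: "continuous_on UNIV g" and h: "h > 0" and le: "\<And>t. norm (g t) \<le> h * indicator U t"
  shows "ennreal (L g) \<le> ennreal h * inner_content U"
proof -
  have "norm ((1 / h) *\<^sub>R g t) \<le> indicator U t" for t
    using le[of t] h by (simp add: pos_divide_le_eq mult.commute)
  then have "(\<lambda>t. (1 / h) *\<^sub>R g t) \<in> below U"
    unfolding below_def using g by (auto intro!: continuous_intros)
  then have "ennreal (1 / h * L g) \<le> inner_content U" using L_le_inner L_scaleR[OF g] by metis
  then have "ennreal h * ennreal (1 / h * L g) \<le> ennreal h * inner_content U" by (rule mult_left_mono) simp
  moreover have "ennreal h * ennreal (1 / h * L g) = ennreal (L g)"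
    using h by (simp flip: ennreal_mult')
  ultimately show ?thesis by simp
qed

text \<open>
  A layer-cake argument: \<open>f\<close> is the sum of a remainder of norm at most \<open>h\<close> and of slices between
  consecutive clipping levels. The slice above level \<open>(i + 1) h\<close> has norm at most \<open>h\<close> and vanishes off
  the open set \<open>V i\<close> where \<open>\<parallel>f\<parallel>\<close> exceeds that level, so \<open>L\<close> maps it to at most \<open>h \<rho>(V i)\<close>. In turn
  \<open>h\<close> times the indicator of \<open>V i\<close> is dominated by the part of \<open>\<parallel>f\<parallel>\<close> between the levels \<open>i h\<close>
  and \<open>(i + 1) h\<close>; shifting by one level here lets the sum telescope to at most \<open>\<parallel>f\<parallel>\<close>.
\<close>

theorem L_le_integral_norm:
  assumes f: "continuous_on UNIV f"
  shows "ennreal (L f) \<le> (\<integral>\<^sup>+t. ennreal (norm (f t)) \<partial>dominating_measure)" (is "_ \<le> ?I")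
proof (rule ennreal_le_epsilon)
  fix e :: real assume e: "e > 0"
  have "bounded (range f)" using compact_continuous_image[OF f compact_T] by (rule compact_imp_bounded)
  then obtain C where C: "\<And>t. norm (f t) \<le> C" unfolding bounded_iff by blast
  obtain h where h: "h > 0" "h * B < e" using obtain_small_factor[OF e B_nonneg] by blast
  obtain n :: nat where n: "C \<le> real n * h" using reals_Archimedean3[OF h(1)] less_imp_le by blast
  define V where "V i = {t. real (Suc i) * h < norm (f t)}" for i
  define slice where "slice i t = clip (real (Suc (Suc i)) * h) (f t) - clip (real (Suc i) * h) (f t)" for i t
  have V: "open (V i)" for i
    unfolding V_def by (intro open_Collect_less continuous_intros f)
  have clip_cont: "continuous_on UNIV (\<lambda>t. clip (real i * h) (f t))" for i
    using h(1) by (intro continuous_on_clip f) simp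
  have slice_cont: "continuous_on UNIV (slice i)" for i
    unfolding slice_def by (intro continuous_on_diff clip_cont)
  have slice_le: "norm (slice i t) \<le> h * indicator (V i) t" for i t
    using h(1) by (auto simp: slice_def norm_clip_diff V_def indicator_def min_def algebra_simps)
  have layer: "h * indicator (V i) t \<le> min (real (Suc i) * h) (norm (f t)) - min (real i * h) (norm (f t))" for i t
    using h(1) by (auto simp: V_def indicator_def min_def algebra_simps)
  have f_eq: "f t = clip (real 1 * h) (f t) + (\<Sum>i<n. slice i t)" for t
  proof -
    have "(\<Sum>i<n. slice i t) = clip (real (Suc n) * h) (f t) - clip (real (Suc 0) * h) (f t)"
      unfolding slice_def by (rule sum_lessThan_telescope)
    moreover have "clip (real (Suc n) * h) (f t) = f t"
      using C[of t] n h(1) by (intro clip_eq_self) (simp add: algebra_simps)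
    ultimately show ?thesis by simp
  qed
  have "L f = L (\<lambda>t. clip (real 1 * h) (f t) + (\<Sum>i<n. slice i t))" using f_eq by (metis ext)
  also have "\<dots> = L (\<lambda>t. clip (real 1 * h) (f t)) + (\<Sum>i<n. L (slice i))"
    by (simp only: L_add[OF clip_cont[of 1] continuous_on_sum[OF slice_cont]] L_sum[OF slice_cont])
  also have "\<dots> \<le> e + (\<Sum>i<n. L (slice i))"
    using L_bound[OF clip_cont[of 1], of h] h by (simp add: norm_clip)
  finally have "ennreal (L f) \<le> ennreal (e + (\<Sum>i<n. L (slice i)))" by (simp add: ennreal_leI)
  also have "\<dots> \<le> ennreal e + (\<Sum>i<n. ennreal (L (slice i)))"
    by (rule order_trans[OF ennreal_add_le add_left_mono[OF ennreal_sum_le]])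
  also have "\<dots> \<le> ennreal e + (\<Sum>i<n. ennreal h * inner_content (V i))"
    by (intro add_left_mono sum_mono L_le_scaled_inner slice_cont h(1) slice_le)
  finally have L_le: "ennreal (L f) \<le> ennreal e + (\<Sum>i<n. ennreal h * inner_content (V i))" .
  have "(\<Sum>i<n. ennreal h * inner_content (V i)) = (\<Sum>i<n. \<integral>\<^sup>+t. ennreal h * indicator (V i) t \<partial>dominating_measure)"
    using V by (simp add: nn_integral_cmult_indicator emeasure_dominating_measure outer_open)
  also have "\<dots> = (\<integral>\<^sup>+t. (\<Sum>i<n. ennreal h * indicator (V i) t) \<partial>dominating_measure)"
    using borel_open[OF V] by (intro nn_integral_sum[symmetric]) simp
  also have "\<dots> \<le> ?I"
  proof (rule nn_integral_mono)
    fix t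
    have "(\<Sum>i<n. ennreal h * indicator (V i) t) = ennreal (\<Sum>i<n. h * indicator (V i) t)"
    proof -
      have "ennreal h * indicator (V i) t = ennreal (h * indicator (V i) t)" for i
        by (simp add: indicator_def)
      then show ?thesis using h(1) by simp
    qed
    also have "\<dots> \<le> ennreal (\<Sum>i<n. min (real (Suc i) * h) (norm (f t)) - min (real i * h) (norm (f t)))"
      by (intro ennreal_leI sum_mono layer)
    also have "\<dots> \<le> ennreal (norm (f t))"
      using h(1) by (subst sum_lessThan_telescope) (simp add: ennreal_leI)
    finally show "(\<Sum>i<n. ennreal h * indicator (V i) t) \<le> ennreal (norm (f t))" .
  qed
  finally show "ennreal (L f) \<le> ?I + ennreal e"
    using L_le by (metis add.commute add_left_mono order_trans)
qed

end


section \<open>Representation of functionals by vector measures\<close>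

locale scalar_functional_on_continuous = hilbert_space smul ip
  for smul :: "'k::real_or_complex \<Rightarrow> 'x::banach \<Rightarrow> 'x" and ip :: "'x \<Rightarrow> 'x \<Rightarrow> 'k" +
  fixes Y :: "('t::metric_space \<Rightarrow> 'x) \<Rightarrow> 'k" and B :: real
  assumes compact_T: "compact (UNIV :: 't set)"
    and Y_add: "\<And>f g. continuous_on UNIV f \<Longrightarrow> continuous_on UNIV g \<Longrightarrow> Y (\<lambda>t. f t + g t) = Y f + Y g"
    and Y_smul: "\<And>c f. continuous_on UNIV f \<Longrightarrow> Y (\<lambda>t. smul c (f t)) = c * Y f"
    and Y_bound: "\<And>f C. continuous_on UNIV f \<Longrightarrow> (\<And>t. norm (f t) \<le> C) \<Longrightarrow> norm (Y f) \<le> C * B"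
begin

sublocale real_part: bounded_functional_on_continuous "\<lambda>f. kre (Y f)" B
proof
  fix f :: "'t \<Rightarrow> 'x" and r C :: real assume f: "continuous_on UNIV f"
  show "kre (Y (\<lambda>t. r *\<^sub>R f t)) = r * kre (Y f)"
    using Y_smul[OF f, of "of_real r"] by (simp add: smul_of_real kre_of_real_mult)
  show "kre (Y f) \<le> C * B" if "\<And>t. norm (f t) \<le> C"
    using order_trans[OF kre_le_norm Y_bound[OF f that]] .
qed (simp_all add: compact_T Y_add kre_add)

abbreviation M :: "'t measure" where "M \<equiv> real_part.dominating_measure"

lemma continuous_on_smul: "continuous_on S f \<Longrightarrow> continuous_on S (\<lambda>t. smul c (f t))"
  by (rule bounded_linear.continuous_on[OF bounded_linear_smul])

text \<open>
  The measure dominates the real part only; multiplying \<open>f\<close> by a phase turns the value real.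
\<close>

lemma norm_Y_le_integral:
  assumes f: "continuous_on UNIV f"
  shows "ennreal (norm (Y f)) \<le> (\<integral>\<^sup>+t. ennreal (norm (f t)) \<partial>M)"
proof -
  obtain c where c: "norm c \<le> 1" "kre (c * Y f) = norm (Y f)" by (rule obtain_phase)
  have "ennreal (norm (Y f)) = ennreal (kre (Y (\<lambda>t. smul c (f t))))"
    using c(2) by (simp add: Y_smul[OF f])
  also have "\<dots> \<le> (\<integral>\<^sup>+t. ennreal (norm (smul c (f t))) \<partial>M)"
    by (rule real_part.L_le_integral_norm[OF continuous_on_smul[OF f]])
  also have "\<dots> \<le> (\<integral>\<^sup>+t. ennreal (norm (f t)) \<partial>M)"
    using c(1) by (intro nn_integral_mono ennreal_leI) (simp add: mult_left_le_one_le)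
  finally show ?thesis .
qed

lemma Y_scaleR: "continuous_on UNIV f \<Longrightarrow> Y (\<lambda>t. r *\<^sub>R f t) = of_real r * Y f"
  using Y_smul[of f "of_real r"] by (simp add: smul_of_real)

lemma Y_zero: "Y (\<lambda>_. 0) = 0"
  using Y_scaleR[of "\<lambda>_. 0" 0] by simp

lemma Y_diff:
  assumes f: "continuous_on UNIV f" and g: "continuous_on UNIV g"
  shows "Y (\<lambda>t. f t - g t) = Y f - Y g"
  using Y_add[OF f continuous_on_scaleR[OF continuous_on_const g], of "-1"] Y_scaleR[OF g, of "-1"] by simp

lemma Y_sum:
  "(\<And>i. i \<in> I \<Longrightarrow> continuous_on UNIV (f i)) \<Longrightarrow> Y (\<lambda>t. \<Sum>i\<in>I. f i t) = (\<Sum>i\<in>I. Y (f i))"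
proof (induction I rule: infinite_finite_induct)
  case (insert i I)
  have "Y (\<lambda>t. f i t + (\<Sum>j\<in>I. f j t)) = Y (f i) + Y (\<lambda>t. \<Sum>j\<in>I. f j t)"
    using insert.prems by (intro Y_add continuous_on_sum) auto
  then show ?case using insert by simp
qed (simp_all add: Y_zero)

lemma finite_measure_M: "finite_measure M"
proof (rule finite_measureI)
  have "space M = UNIV" using sets_eq_imp_space_eq[OF real_part.sets_dominating_measure] by simp
  then show "emeasure M (space M) \<noteq> \<infinity>"
    using real_part.emeasure_dominating_measure_le by (auto simp: top_unique)
qed

text \<open>
  \<open>G g\<close> is the integral of the scalar function \<open>g\<close> against the representing vector measure, which is
  constructed from these values.
\<close>

definition G :: "('t \<Rightarrow> real) \<Rightarrow> 'x" where
  "G g = (SOME z. \<forall>x. Y (\<lambda>t. g t *\<^sub>R x) = ip x z)"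

lemma ip_G:
  assumes g: "continuous_on UNIV g"
  shows "ip x (G g) = Y (\<lambda>t. g t *\<^sub>R x)"
proof -
  have cont: "continuous_on UNIV (\<lambda>t. g t *\<^sub>R x)" for x :: 'x
    using g by (intro continuous_intros)
  have "bounded (range g)" using compact_continuous_image[OF g compact_T] by (rule compact_imp_bounded)
  then obtain C where C: "\<And>t. \<bar>g t\<bar> \<le> C" unfolding bounded_iff by auto
  have "\<exists>z. \<forall>x. Y (\<lambda>t. g t *\<^sub>R x) = ip x z"
  proof (rule frechet_riesz)
    show "Y (\<lambda>t. g t *\<^sub>R (x + y)) = Y (\<lambda>t. g t *\<^sub>R x) + Y (\<lambda>t. g t *\<^sub>R y)" for x y
      by (simp add: scaleR_add_right Y_add[OF cont cont])
    show "Y (\<lambda>t. g t *\<^sub>R smul c x) = c * Y (\<lambda>t. g t *\<^sub>R x)" for c x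
      by (simp add: Y_smul[OF cont] flip: smul_scaleR)
    show "norm (Y (\<lambda>t. g t *\<^sub>R x)) \<le> (C * B) * norm x" for x
    proof -
      have "norm (g t *\<^sub>R x) \<le> C * norm x" for t by (simp add: C mult_right_mono)
      from Y_bound[OF cont this] show ?thesis by (simp only: mult_ac)
    qed
  qed blast
  then have "\<forall>x. Y (\<lambda>t. g t *\<^sub>R x) = ip x (G g)" unfolding G_def by (rule someI_ex)
  then show ?thesis by simp
qed

lemma G_add:
  assumes g: "continuous_on UNIV g" and h: "continuous_on UNIV h"
  shows "G (\<lambda>t. g t + h t) = G g + G h"
proof (rule eq_via_ip)
  fix x
  note Y_add[OF continuous_on_scaleR[OF g continuous_on_const[of _ x]]
      continuous_on_scaleR[OF h continuous_on_const[of _ x]]]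
  then show "ip x (G (\<lambda>t. g t + h t)) = ip x (G g + G h)"
    using g h by (simp add: ip_G continuous_on_add ip_add_right scaleR_left_distrib)
qed

lemma norm_G_diff_le:
  assumes g: "continuous_on UNIV g" and h: "continuous_on UNIV h"
  shows "ennreal (norm (G g - G h)) \<le> (\<integral>\<^sup>+t. ennreal \<bar>g t - h t\<bar> \<partial>M)" (is "_ \<le> ?I")
proof (cases "?I")
  case (real I)
  have [measurable]: "(\<lambda>t. g t - h t) \<in> borel_measurable borel"
    using g h by (intro borel_measurable_continuous_onI continuous_intros)
  have "norm (ip x (G g - G h)) \<le> I * norm x" for x
  proof -
    note c = continuous_on_scaleR[OF g continuous_on_const[of _ x]]
      continuous_on_scaleR[OF h continuous_on_const[of _ x]]
    have "ip x (G g - G h) = Y (\<lambda>t. g t *\<^sub>R x - h t *\<^sub>R x)"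
      using g h c by (simp add: Y_diff ip_G ip_diff_right)
    then have "ennreal (norm (ip x (G g - G h))) \<le> (\<integral>\<^sup>+t. ennreal (norm (g t *\<^sub>R x - h t *\<^sub>R x)) \<partial>M)"
      using norm_Y_le_integral[OF continuous_on_diff[OF c]] by simp
    also have "\<dots> = (\<integral>\<^sup>+t. ennreal (norm x) * ennreal \<bar>g t - h t\<bar> \<partial>M)"
    proof -
      have "norm (g t *\<^sub>R x - h t *\<^sub>R x) = norm x * \<bar>g t - h t\<bar>" for t
        by (simp add: mult.commute flip: scaleR_left_diff_distrib)
      then show ?thesis by (simp add: ennreal_mult)
    qed
    also have "\<dots> = ennreal (norm x) * ?I" by (intro nn_integral_cmult) measurable
    also have "\<dots> = ennreal (I * norm x)" using real by (simp add: ennreal_mult mult.commute)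
    finally show ?thesis using real by (simp add: ennreal_le_iff)
  qed
  then have "norm (G g - G h) \<le> I" using real(1) by (rule norm_le_via_ip)
  then show ?thesis using real by (simp add: ennreal_leI)
qed simp

definition approx :: "nat \<Rightarrow> 't set \<Rightarrow> 't \<Rightarrow> real" where
  "approx n A = (SOME g. continuous_on UNIV g \<and> (\<integral>\<^sup>+t. ennreal \<bar>g t - indicator A t\<bar> \<partial>M) < ennreal (1 / Suc n))"

lemma approx:
  assumes "A \<in> sets borel"
  shows "continuous_on UNIV (approx n A)"
    and "(\<integral>\<^sup>+t. ennreal \<bar>approx n A t - indicator A t\<bar> \<partial>M) \<le> ennreal (1 / Suc n)"
proof -
  have "\<exists>g. continuous_on UNIV g \<and> (\<integral>\<^sup>+t. ennreal \<bar>g t - indicator A t\<bar> \<partial>M) < ennreal (1 / Suc n)"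
    by (rule continuous_approx_indicator[OF real_part.sets_dominating_measure finite_measure_M assms]) simp
  from someI_ex[OF this] show "continuous_on UNIV (approx n A)"
    "(\<integral>\<^sup>+t. ennreal \<bar>approx n A t - indicator A t\<bar> \<partial>M) \<le> ennreal (1 / Suc n)"
    unfolding approx_def[symmetric] by auto
qed

lemma integral_triangle:
  assumes [measurable]: "g \<in> borel_measurable borel" "h \<in> borel_measurable borel" "k \<in> borel_measurable borel"
  shows "(\<integral>\<^sup>+t. ennreal \<bar>g t - h t\<bar> \<partial>M) \<le> (\<integral>\<^sup>+t. ennreal \<bar>g t - k t\<bar> \<partial>M) + (\<integral>\<^sup>+t. ennreal \<bar>h t - k t\<bar> \<partial>M)"
proof -
  have "ennreal \<bar>g t - h t\<bar> \<le> ennreal \<bar>g t - k t\<bar> + ennreal \<bar>h t - k t\<bar>" for t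
    by (simp add: ennreal_leI flip: ennreal_plus)
  then have "(\<integral>\<^sup>+t. ennreal \<bar>g t - h t\<bar> \<partial>M) \<le> (\<integral>\<^sup>+t. ennreal \<bar>g t - k t\<bar> + ennreal \<bar>h t - k t\<bar> \<partial>M)"
    by (rule nn_integral_mono)
  also have "\<dots> = (\<integral>\<^sup>+t. ennreal \<bar>g t - k t\<bar> \<partial>M) + (\<integral>\<^sup>+t. ennreal \<bar>h t - k t\<bar> \<partial>M)"
    by (rule nn_integral_add) measurable
  finally show ?thesis .
qed

lemma norm_G_diff_approx_le:
  assumes A: "A \<in> sets borel" and g: "continuous_on UNIV g"
  shows "ennreal (norm (G g - G (approx n A)))
    \<le> (\<integral>\<^sup>+t. ennreal \<bar>g t - indicator A t\<bar> \<partial>M) + ennreal (1 / Suc n)"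
proof -
  have "ennreal (norm (G g - G (approx n A))) \<le> (\<integral>\<^sup>+t. ennreal \<bar>g t - approx n A t\<bar> \<partial>M)"
    by (rule norm_G_diff_le[OF g approx(1)[OF A]])
  also have "\<dots> \<le> (\<integral>\<^sup>+t. ennreal \<bar>g t - indicator A t\<bar> \<partial>M) + (\<integral>\<^sup>+t. ennreal \<bar>approx n A t - indicator A t\<bar> \<partial>M)"
    using borel_measurable_indicator[OF A]
    by (intro integral_triangle[OF borel_measurable_continuous_onI[OF g]
          borel_measurable_continuous_onI[OF approx(1)[OF A]]])
  also have "\<dots> \<le> (\<integral>\<^sup>+t. ennreal \<bar>g t - indicator A t\<bar> \<partial>M) + ennreal (1 / Suc n)"
    by (intro add_left_mono approx(2)[OF A])
  finally show ?thesis .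
qed

definition rep :: "'t set \<Rightarrow> 'x" where
  "rep A = (if A \<in> sets borel then lim (\<lambda>n. G (approx n A)) else 0)"

lemma G_approx_LIMSEQ:
  assumes A: "A \<in> sets borel"
  shows "(\<lambda>n. G (approx n A)) \<longlonglongrightarrow> rep A"
proof -
  have le: "norm (G (approx k A) - G (approx n A)) \<le> 1 / Suc k + 1 / Suc n" for k n
  proof -
    have "ennreal (norm (G (approx k A) - G (approx n A))) \<le> ennreal (1 / Suc k) + ennreal (1 / Suc n)"
      using norm_G_diff_approx_le[OF A approx(1)[OF A, of k], of n] approx(2)[OF A, of k]
      by (meson add_right_mono order_trans)
    also have "\<dots> = ennreal (1 / Suc k + 1 / Suc n)" by (rule ennreal_plus[symmetric]) auto
    finally show ?thesis by (subst (asm) ennreal_le_iff) auto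
  qed
  have "Cauchy (\<lambda>n. G (approx n A))"
  proof (rule CauchyI)
    fix e :: real assume e: "e > 0"
    obtain N where N: "1 / real (Suc N) < e / 2" using nat_approx_posE[of "e / 2"] e by auto
    have "norm (G (approx k A) - G (approx n A)) < e" if "k \<ge> N" "n \<ge> N" for k n
    proof -
      have "1 / real (Suc k) \<le> 1 / real (Suc N)" "1 / real (Suc n) \<le> 1 / real (Suc N)"
        using that by (simp_all add: frac_le)
      then show ?thesis using le[of k n] N by linarith
    qed
    then show "\<exists>N. \<forall>k\<ge>N. \<forall>n\<ge>N. norm (G (approx k A) - G (approx n A)) < e" by blast
  qed
  then show ?thesis using A by (simp add: rep_def Cauchy_convergent flip: convergent_LIMSEQ_iff)
qed

text \<open>
  This estimate characterizes \<open>rep A\<close> as the value at the indicator of \<open>A\<close> of the extension of \<open>G\<close>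
  by continuity. Additivity and the bound by the dominating measure follow from it.
\<close>

lemma norm_G_diff_rep_le:
  assumes A: "A \<in> sets borel" and g: "continuous_on UNIV g"
  shows "ennreal (norm (G g - rep A)) \<le> (\<integral>\<^sup>+t. ennreal \<bar>g t - indicator A t\<bar> \<partial>M)" (is "_ \<le> ?I")
proof (rule LIMSEQ_le)
  show "(\<lambda>n. ennreal (norm (G g - G (approx n A)))) \<longlonglongrightarrow> ennreal (norm (G g - rep A))"
    by (intro tendsto_ennrealI tendsto_norm tendsto_diff tendsto_const G_approx_LIMSEQ A)
  have "(\<lambda>n. ennreal (1 / Suc n)) \<longlonglongrightarrow> ennreal 0"
    by (intro tendsto_ennrealI LIMSEQ_Suc lim_1_over_n)
  then have "(\<lambda>n. ?I + ennreal (1 / Suc n)) \<longlonglongrightarrow> ?I + ennreal 0"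
    by (intro tendsto_add tendsto_const)
  then show "(\<lambda>n. ?I + ennreal (1 / Suc n)) \<longlonglongrightarrow> ?I" by simp
qed (use norm_G_diff_approx_le[OF A g] in blast)

lemma norm_rep_le: "A \<in> sets borel \<Longrightarrow> ennreal (norm (rep A)) \<le> emeasure M A"
proof -
  assume A: "A \<in> sets borel"
  have "G (\<lambda>_. 0) = 0" by (rule eq_via_ip) (simp add: ip_G Y_zero)
  then have "ennreal (norm (rep A)) \<le> (\<integral>\<^sup>+t. ennreal \<bar>0 - indicator A t\<bar> \<partial>M)"
    using norm_G_diff_rep_le[OF A, of "\<lambda>_. 0"] by simp
  also have "\<dots> = (\<integral>\<^sup>+t. indicator A t \<partial>M)"
    by (intro nn_integral_cong) (auto simp: indicator_def)
  finally show ?thesis using A by simp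
qed

lemma rep_Un:
  assumes A: "A \<in> sets borel" and A': "A' \<in> sets borel" and disj: "A \<inter> A' = {}"
  shows "rep (A \<union> A') = rep A + rep A'"
proof -
  have AA': "A \<union> A' \<in> sets borel" using A A' by auto
  let ?g = "\<lambda>n t. approx n A t + approx n A' t"
  have g: "continuous_on UNIV (?g n)" for n by (intro continuous_on_add approx A A')
  have [measurable]: "approx n A \<in> borel_measurable borel" "approx n A' \<in> borel_measurable borel" for n
    by (intro borel_measurable_continuous_onI approx A A')+
  note [measurable] = A A'
  have "ennreal (norm (G (?g n) - rep (A \<union> A'))) \<le> ennreal (1 / Suc n) + ennreal (1 / Suc n)" for n
  proof -
    have "ennreal \<bar>?g n t - indicator (A \<union> A') t\<bar>
        \<le> ennreal \<bar>approx n A t - indicator A t\<bar> + ennreal \<bar>approx n A' t - indicator A' t\<bar>" for t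
    proof -
      have "indicator (A \<union> A') t = indicator A t + (indicator A' t :: real)"
        using disj by (auto simp: indicator_def)
      then have "\<bar>?g n t - indicator (A \<union> A') t\<bar> \<le> \<bar>approx n A t - indicator A t\<bar> + \<bar>approx n A' t - indicator A' t\<bar>"
        by linarith
      then show ?thesis by (simp add: ennreal_leI flip: ennreal_plus)
    qed
    then have "(\<integral>\<^sup>+t. ennreal \<bar>?g n t - indicator (A \<union> A') t\<bar> \<partial>M)
        \<le> (\<integral>\<^sup>+t. ennreal \<bar>approx n A t - indicator A t\<bar> + ennreal \<bar>approx n A' t - indicator A' t\<bar> \<partial>M)"
      by (rule nn_integral_mono)
    also have "\<dots> = (\<integral>\<^sup>+t. ennreal \<bar>approx n A t - indicator A t\<bar> \<partial>M)
        + (\<integral>\<^sup>+t. ennreal \<bar>approx n A' t - indicator A' t\<bar> \<partial>M)"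
      by (rule nn_integral_add) measurable
    also have "\<dots> \<le> ennreal (1 / Suc n) + ennreal (1 / Suc n)" by (intro add_mono approx(2) A A')
    finally show ?thesis by (rule order_trans[OF norm_G_diff_rep_le[OF AA' g]])
  qed
  moreover have "(\<lambda>n. ennreal (1 / Suc n) + ennreal (1 / Suc n)) \<longlonglongrightarrow> ennreal 0 + ennreal 0"
    by (intro tendsto_add tendsto_ennrealI LIMSEQ_Suc lim_1_over_n)
  moreover have "(\<lambda>n. ennreal (norm (G (?g n) - rep (A \<union> A')))) \<longlonglongrightarrow> ennreal (norm (rep A + rep A' - rep (A \<union> A')))"
    unfolding G_add[OF approx(1)[OF A] approx(1)[OF A']]
    by (intro tendsto_ennrealI tendsto_norm tendsto_diff tendsto_add tendsto_const G_approx_LIMSEQ A A')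
  ultimately have "ennreal (norm (rep A + rep A' - rep (A \<union> A'))) \<le> ennreal 0 + ennreal 0"
    using LIMSEQ_le by blast
  then show ?thesis by simp
qed

lemma variation_rep_le: "variation rep UNIV \<le> emeasure M UNIV"
  unfolding variation_def
proof (rule SUP_least, safe)
  fix P :: "'t set set" assume P: "finite P" "partition_on UNIV P" "P \<subseteq> sets borel"
  have "(\<Sum>A\<in>P. ennreal (norm (rep A))) \<le> (\<Sum>A\<in>P. emeasure M A)"
    using P(3) by (intro sum_mono norm_rep_le) auto
  also have "\<dots> = emeasure M (\<Union>A\<in>P. A)"
    using P by (intro sum_emeasure) (auto simp: partition_on_def disjoint_def disjoint_family_on_def)
  also have "\<dots> = emeasure M UNIV" using P(2) by (simp add: partition_on_def)
  finally show "(\<Sum>A\<in>P. ennreal (norm (rep A))) \<le> emeasure M UNIV" .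
qed

lemma rep_in_cabv_set: "rep \<in> cabv_set"
proof (rule cabv_setI)
  show "variation rep UNIV < \<infinity>"
    using order_trans[OF variation_rep_le real_part.emeasure_dominating_measure_le] by (simp add: le_less_trans)
  show "rep A = 0" if "A \<notin> sets borel" for A using that by (simp add: rep_def)
  fix A :: "nat \<Rightarrow> 't set" assume A: "range A \<subseteq> sets borel" "disjoint_family A"
  interpret finite_measure M by (rule finite_measure_M)
  define R where "R n = (\<Union>i. A i) - (\<Union>i<n. A i)" for n :: nat
  have part: "rep (\<Union>i<n. A i) = (\<Sum>i<n. rep (A i))" for n
  proof (induction n)
    case 0
    show ?case using norm_rep_le[of "{}"] by simp
  next
    case (Suc n)
    have "A i \<inter> A n = {}" if "i < n" for i
      using that by (intro disjoint_family_onD[OF A(2)]) auto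
    then have "(\<Union>i<n. A i) \<inter> A n = {}" by blast
    then have "rep ((\<Union>i<n. A i) \<union> A n) = rep (\<Union>i<n. A i) + rep (A n)"
      using A(1) by (intro rep_Un) auto
    then show ?case using Suc by (simp add: lessThan_Suc Un_commute)
  qed
  have "rep (\<Union>i. A i) = (\<Sum>i<n. rep (A i)) + rep (R n)" for n
  proof -
    have "rep ((\<Union>i<n. A i) \<union> R n) = rep (\<Union>i<n. A i) + rep (R n)"
      using A(1) unfolding R_def by (intro rep_Un) auto
    moreover have "(\<Union>i<n. A i) \<union> R n = (\<Union>i. A i)" by (auto simp: R_def)
    ultimately show ?thesis by (simp add: part)
  qed
  then have eq: "(\<Sum>i<n. rep (A i)) = rep (\<Union>i. A i) - rep (R n)" for n by (simp add: algebra_simps)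
  have R: "R n \<in> sets borel" for n using A(1) unfolding R_def by auto
  have "(\<lambda>n. emeasure M (R n)) \<longlonglongrightarrow> emeasure M (\<Inter>n. R n)"
    by (rule Lim_emeasure_decseq) (use R in \<open>auto simp: decseq_def R_def intro: less_le_trans\<close>)
  moreover have "(\<Inter>n. R n) = {}" by (auto simp: R_def)
  ultimately have lim0: "(\<lambda>n. emeasure M (R n)) \<longlonglongrightarrow> 0" by simp
  have "(\<lambda>n. ennreal (norm (rep (R n)))) \<longlonglongrightarrow> 0"
    by (rule tendsto_sandwich[OF _ _ tendsto_const lim0]) (auto intro!: always_eventually norm_rep_le R)
  then have "(\<lambda>n. norm (rep (R n))) \<longlonglongrightarrow> 0"
    using tendsto_ennreal_iff[of "\<lambda>n. norm (rep (R n))" sequentially 0] by simp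
  then have "(\<lambda>n. rep (R n)) \<longlonglongrightarrow> 0" by (rule tendsto_norm_zero_cancel)
  then have "(\<lambda>n. rep (\<Union>i. A i) - rep (R n)) \<longlonglongrightarrow> rep (\<Union>i. A i) - 0"
    by (intro tendsto_diff tendsto_const)
  then show "(\<lambda>n. rep (A n)) sums rep (\<Union>n. A n)" unfolding sums_def eq by simp
qed

definition rep_measure :: "('t, 'x) cabv" where
  "rep_measure = Abs_cabv rep"

lemma cabv_val_rep_measure: "cabv_val rep_measure = rep"
  unfolding rep_measure_def by (rule Abs_cabv_inverse[OF rep_in_cabv_set])

lemma norm_rep_measure_le: "norm rep_measure \<le> B"
proof -
  have "norm rep_measure = enn2real (variation rep UNIV)"
    by (simp add: norm_cabv_def cabv_val_rep_measure)
  also have "\<dots> \<le> enn2real (ennreal B)"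
    using order_trans[OF variation_rep_le real_part.emeasure_dominating_measure_le] by (intro enn2real_mono) auto
  finally show ?thesis using real_part.B_nonneg by simp
qed

text \<open>
  Approximating the fibres of \<open>s\<close> by continuous functions approximates \<open>s\<close> in \<open>L\<^sup>1\<close> by continuous
  functions, on which \<open>Y\<close> is given by \<open>G\<close>.
\<close>

lemma norm_Y_diff_simple_le:
  assumes f: "continuous_on UNIV f" and s: "simple_function borel s"
  shows "ennreal (norm (Y f - sesq_integral_simple ip s rep_measure)) \<le> (\<integral>\<^sup>+t. ennreal (norm (f t - s t)) \<partial>M)"
    (is "_ \<le> ?I")
proof (rule LIMSEQ_le)
  let ?A = "\<lambda>x. s -` {x}"
  note A = simple_function_borelD(2)[OF s, of "{_}"]
  note fin = simple_function_borelD(1)[OF s]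
  define g where "g n t = (\<Sum>x\<in>range s. approx n (?A x) t *\<^sub>R x)" for n t
  have c: "continuous_on UNIV (\<lambda>t. approx n (?A x) t *\<^sub>R x)" for n x
    by (intro continuous_on_scaleR approx A continuous_on_const)
  have g: "continuous_on UNIV (g n)" for n
    unfolding g_def by (intro continuous_on_sum c)
  have Yg: "Y (g n) = (\<Sum>x\<in>range s. ip x (G (approx n (?A x))))" for n
    unfolding g_def by (simp add: Y_sum[OF c] ip_G[OF approx(1)[OF A]])
  show "(\<lambda>n. ennreal (norm (Y f - Y (g n)))) \<longlonglongrightarrow> ennreal (norm (Y f - sesq_integral_simple ip s rep_measure))"
    unfolding Yg sesq_integral_simple_def cabv_val_rep_measure
    by (intro tendsto_ennrealI tendsto_norm tendsto_diff tendsto_sum tendsto_const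
        bounded_linear.tendsto[OF bounded_linear_ip_right] G_approx_LIMSEQ A)
  let ?E = "\<lambda>n. \<Sum>x\<in>range s. ennreal (norm x) * ennreal (1 / Suc n)"
  have "?E \<longlonglongrightarrow> (\<Sum>x\<in>range s. ennreal (norm x) * ennreal 0)"
    by (intro tendsto_sum ennreal_tendsto_cmult tendsto_ennrealI LIMSEQ_Suc lim_1_over_n) simp
  then have "(\<lambda>n. ?I + ?E n) \<longlonglongrightarrow> ?I + 0"
    by (intro tendsto_add tendsto_const) simp
  then show "(\<lambda>n. ?I + ?E n) \<longlonglongrightarrow> ?I" by simp
  have "ennreal (norm (Y f - Y (g n))) \<le> ?I + ?E n" for n
  proof -
    have [measurable]: "(\<lambda>t. norm (f t - s t)) \<in> borel_measurable borel"
      by (rule borel_measurable_norm_diff_simple[OF borel_measurable_continuous_onI[OF f] s])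
    have [measurable]: "approx n (?A x) \<in> borel_measurable borel" for x
      by (intro borel_measurable_continuous_onI approx A)
    note [measurable] = A
    have s_eq: "s t = (\<Sum>x\<in>range s. indicator (?A x) t *\<^sub>R x)" for t
    proof -
      have "(\<Sum>x\<in>range s. indicator (?A x) t *\<^sub>R x) = (\<Sum>x\<in>{s t}. indicator (?A x) t *\<^sub>R x)"
        using fin by (intro sum.mono_neutral_right) (auto simp: indicator_def)
      then show ?thesis by simp
    qed
    have pointwise: "ennreal (norm (f t - g n t)) \<le> ennreal (norm (f t - s t))
        + (\<Sum>x\<in>range s. ennreal (norm x) * ennreal \<bar>approx n (?A x) t - indicator (?A x) t\<bar>)" for t
    proof -
      have "norm (s t - g n t) = norm (\<Sum>x\<in>range s. (indicator (?A x) t - approx n (?A x) t) *\<^sub>R x)"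
        unfolding g_def scaleR_left_diff_distrib sum_subtractf by (simp only: s_eq[of t, symmetric])
      also have "\<dots> \<le> (\<Sum>x\<in>range s. norm x * \<bar>approx n (?A x) t - indicator (?A x) t\<bar>)"
        by (rule sum_norm_le) (simp add: mult.commute abs_minus_commute)
      finally have "norm (f t - g n t) \<le> norm (f t - s t) + (\<Sum>x\<in>range s. norm x * \<bar>approx n (?A x) t - indicator (?A x) t\<bar>)"
        using norm_triangle_ineq[of "f t - s t" "s t - g n t"] by simp
      then have "ennreal (norm (f t - g n t)) \<le> ennreal (norm (f t - s t) + (\<Sum>x\<in>range s. norm x * \<bar>approx n (?A x) t - indicator (?A x) t\<bar>))"
        by (rule ennreal_leI)
      then show ?thesis by (simp add: sum_nonneg flip: ennreal_mult)
    qed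
    have "ennreal (norm (Y f - Y (g n))) \<le> (\<integral>\<^sup>+t. ennreal (norm (f t - g n t)) \<partial>M)"
      using norm_Y_le_integral[OF continuous_on_diff[OF f g]] by (simp add: Y_diff[OF f g])
    also have "\<dots> \<le> (\<integral>\<^sup>+t. ennreal (norm (f t - s t))
        + (\<Sum>x\<in>range s. ennreal (norm x) * ennreal \<bar>approx n (?A x) t - indicator (?A x) t\<bar>) \<partial>M)"
      by (rule nn_integral_mono[OF pointwise])
    also have "\<dots> = ?I + (\<integral>\<^sup>+t. (\<Sum>x\<in>range s. ennreal (norm x) * ennreal \<bar>approx n (?A x) t - indicator (?A x) t\<bar>) \<partial>M)"
      by (rule nn_integral_add) measurable
    also have "(\<integral>\<^sup>+t. (\<Sum>x\<in>range s. ennreal (norm x) * ennreal \<bar>approx n (?A x) t - indicator (?A x) t\<bar>) \<partial>M)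
        = (\<Sum>x\<in>range s. \<integral>\<^sup>+t. ennreal (norm x) * ennreal \<bar>approx n (?A x) t - indicator (?A x) t\<bar> \<partial>M)"
      by (rule nn_integral_sum) measurable
    also have "\<dots> = (\<Sum>x\<in>range s. ennreal (norm x) * (\<integral>\<^sup>+t. ennreal \<bar>approx n (?A x) t - indicator (?A x) t\<bar> \<partial>M))"
      by (intro sum.cong refl nn_integral_cmult) measurable
    also have "?I + \<dots> \<le> ?I + ?E n"
      by (intro add_left_mono sum_mono mult_left_mono approx(2) A) simp
    finally show ?thesis .
  qed
  then show "\<exists>N. \<forall>n\<ge>N. ennreal (norm (Y f - Y (g n))) \<le> ?I + ?E n" by blast
qed

theorem sesq_integral_rep_measure:
  assumes f: "continuous_on UNIV f"
  shows "sesq_integral ip f rep_measure = Y f"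
proof -
  obtain s where "\<forall>n. simple_function borel (s n)" "uniform_limit UNIV s f sequentially"
    by (rule simple_functions_uniform_limit[OF compact_T f])
  then have s: "simple_function borel (s n)" "uniform_limit UNIV s f sequentially" for n by simp_all
  have "(\<lambda>n. sesq_integral_simple ip (s n) rep_measure) \<longlonglongrightarrow> Y f"
  proof (rule LIMSEQ_I)
    fix e :: real assume e: "e > 0"
    obtain d where d: "d > 0" "d * B < e" using obtain_small_factor[OF e real_part.B_nonneg] by blast
    obtain N where N: "\<And>n t. n \<ge> N \<Longrightarrow> dist (s n t) (f t) < d"
      using uniform_limitD[OF s(2) d(1)] unfolding eventually_sequentially by auto
    have "norm (sesq_integral_simple ip (s n) rep_measure - Y f) < e" if n: "n \<ge> N" for n
    proof -
      have "ennreal (norm (Y f - sesq_integral_simple ip (s n) rep_measure))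
          \<le> (\<integral>\<^sup>+t. ennreal (norm (f t - s n t)) \<partial>M)"
        by (rule norm_Y_diff_simple_le[OF f s(1)])
      also have "\<dots> \<le> (\<integral>\<^sup>+t. ennreal d \<partial>M)"
        using N[OF n] by (intro nn_integral_mono ennreal_leI) (simp add: dist_norm norm_minus_commute less_imp_le)
      also have "\<dots> = ennreal d * emeasure M UNIV"
        using sets_eq_imp_space_eq[OF real_part.sets_dominating_measure] by simp
      also have "\<dots> \<le> ennreal d * ennreal B"
        by (intro mult_left_mono real_part.emeasure_dominating_measure_le) simp
      also have "\<dots> = ennreal (d * B)" using d(1) real_part.B_nonneg by (simp add: ennreal_mult)
      finally have "norm (Y f - sesq_integral_simple ip (s n) rep_measure) \<le> d * B"
        using d(1) real_part.B_nonneg by (simp add: ennreal_le_iff)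
      then show ?thesis using d(2) by (simp add: norm_minus_commute)
    qed
    then show "\<exists>N. \<forall>n\<ge>N. norm (sesq_integral_simple ip (s n) rep_measure - Y f) < e" by blast
  qed
  with sesq_integral_LIMSEQ[OF s] show ?thesis by (rule LIMSEQ_unique)
qed

end


section \<open>The Bochner integral with values in an arbitrary normed space\<close>

lemma has_bochnerE:
  assumes "has_bochner M h x"
  obtains s where "\<forall>i. Bochner_Integration.simple_bochner_integrable M (s i)"
    "(\<lambda>i. \<integral>\<^sup>+\<theta>. ennreal (norm (h \<theta> - s i \<theta>)) \<partial>M) \<longlonglongrightarrow> 0"
    "(\<lambda>i. Bochner_Integration.simple_bochner_integral M (s i)) \<longlonglongrightarrow> x"
  using assms unfolding has_bochner_def by blast

lemma has_bochner_measurable: "has_bochner M h x \<Longrightarrow> h \<in> borel_measurable M"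
  unfolding has_bochner_def by blast

lemma simple_bochner_integrableD:
  "Bochner_Integration.simple_bochner_integrable M s \<Longrightarrow> simple_function M s"
  by (auto elim: simple_bochner_integrable.cases)

lemma norm_simple_bochner_integral_diff_le:
  assumes s: "Bochner_Integration.simple_bochner_integrable M s"
    and s': "Bochner_Integration.simple_bochner_integrable M s'"
  shows "ennreal (norm (Bochner_Integration.simple_bochner_integral M s - Bochner_Integration.simple_bochner_integral M s'))
    \<le> (\<integral>\<^sup>+\<theta>. ennreal (norm (s \<theta> - s' \<theta>)) \<partial>M)"
proof -
  have d: "Bochner_Integration.simple_bochner_integrable M (\<lambda>\<theta>. s \<theta> - s' \<theta>)"
    by (rule simple_bochner_integrable_compose2[where p = "(-)", OF _ s s']) simp
  have n: "Bochner_Integration.simple_bochner_integrable M (\<lambda>\<theta>. norm (s \<theta> - s' \<theta>))"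
    by (rule simple_bochner_integrable_compose2[where p = "\<lambda>x y. norm (x - y)", OF _ s s']) simp
  show ?thesis
    unfolding simple_bochner_integral_diff[OF s s', symmetric] simple_bochner_integral_eq_nn_integral[OF n norm_ge_zero, symmetric]
    by (rule ennreal_leI) (rule simple_bochner_integral_norm_bound[OF d])
qed

lemma has_bochner_diff_simple_measurable:
  "has_bochner M h x \<Longrightarrow> Bochner_Integration.simple_bochner_integrable M s
    \<Longrightarrow> (\<lambda>\<theta>. norm (h \<theta> - s \<theta>)) \<in> borel_measurable M"
  by (rule borel_measurable_norm_diff_simple[OF has_bochner_measurable simple_bochner_integrableD])

text \<open>
  The majorant \<open>\<phi>\<close> replaces \<open>\<parallel>h - h'\<parallel>\<close>, which need not be measurable. The three integrands that
  bound \<open>\<parallel>s - s'\<parallel>\<close> for approximating simple functions are measurable. The cases \<open>\<phi> = 0\<close> and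
  \<open>h' = 0\<close> give uniqueness of the integral and its norm estimate.
\<close>

lemma has_bochner_norm_diff_le:
  assumes h: "has_bochner M h x" and h': "has_bochner M h' x'"
    and \<phi>: "\<phi> \<in> borel_measurable M" and le: "\<And>\<theta>. \<theta> \<in> space M \<Longrightarrow> norm (h \<theta> - h' \<theta>) \<le> \<phi> \<theta>"
  shows "ennreal (norm (x - x')) \<le> (\<integral>\<^sup>+\<theta>. ennreal (\<phi> \<theta>) \<partial>M)"
proof -
  note [measurable] = \<phi>
  obtain s where s: "\<forall>i. Bochner_Integration.simple_bochner_integrable M (s i)"
    "(\<lambda>i. \<integral>\<^sup>+\<theta>. ennreal (norm (h \<theta> - s i \<theta>)) \<partial>M) \<longlonglongrightarrow> 0"
    "(\<lambda>i. Bochner_Integration.simple_bochner_integral M (s i)) \<longlonglongrightarrow> x"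
    by (rule has_bochnerE[OF h])
  obtain s' where s': "\<forall>i. Bochner_Integration.simple_bochner_integrable M (s' i)"
    "(\<lambda>i. \<integral>\<^sup>+\<theta>. ennreal (norm (h' \<theta> - s' i \<theta>)) \<partial>M) \<longlonglongrightarrow> 0"
    "(\<lambda>i. Bochner_Integration.simple_bochner_integral M (s' i)) \<longlonglongrightarrow> x'"
    by (rule has_bochnerE[OF h'])
  have [measurable]: "(\<lambda>\<theta>. norm (h \<theta> - s i \<theta>)) \<in> borel_measurable M"
    "(\<lambda>\<theta>. norm (h' \<theta> - s' i \<theta>)) \<in> borel_measurable M" for i
    using s(1) s'(1) has_bochner_diff_simple_measurable[OF h] has_bochner_diff_simple_measurable[OF h'] by auto
  have "ennreal (norm (Bochner_Integration.simple_bochner_integral M (s i) - Bochner_Integration.simple_bochner_integral M (s' i)))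
      \<le> (\<integral>\<^sup>+\<theta>. ennreal (norm (h \<theta> - s i \<theta>)) \<partial>M) + (\<integral>\<^sup>+\<theta>. ennreal (\<phi> \<theta>) \<partial>M)
        + (\<integral>\<^sup>+\<theta>. ennreal (norm (h' \<theta> - s' i \<theta>)) \<partial>M)" for i
  proof -
    have "ennreal (norm (Bochner_Integration.simple_bochner_integral M (s i) - Bochner_Integration.simple_bochner_integral M (s' i)))
        \<le> (\<integral>\<^sup>+\<theta>. ennreal (norm (s i \<theta> - s' i \<theta>)) \<partial>M)"
      using s(1) s'(1) by (intro norm_simple_bochner_integral_diff_le) auto
    also have "\<dots> \<le> (\<integral>\<^sup>+\<theta>. ennreal (norm (h \<theta> - s i \<theta>)) + ennreal (\<phi> \<theta>) + ennreal (norm (h' \<theta> - s' i \<theta>)) \<partial>M)"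
    proof (rule nn_integral_mono)
      fix \<theta> assume "\<theta> \<in> space M"
      note \<phi>_ge = le[OF this]
      then have nonneg: "0 \<le> \<phi> \<theta>" using norm_ge_zero order_trans by blast
      have "s i \<theta> - s' i \<theta> = (h \<theta> - h' \<theta>) + ((h' \<theta> - s' i \<theta>) - (h \<theta> - s i \<theta>))" by simp
      then have "norm (s i \<theta> - s' i \<theta>) \<le> norm (h \<theta> - h' \<theta>) + (norm (h' \<theta> - s' i \<theta>) + norm (h \<theta> - s i \<theta>))"
        by (metis norm_triangle_ineq norm_triangle_ineq4 add_left_mono order_trans)
      then have "norm (s i \<theta> - s' i \<theta>) \<le> norm (h \<theta> - s i \<theta>) + \<phi> \<theta> + norm (h' \<theta> - s' i \<theta>)"
        using \<phi>_ge by linarith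
      then show "ennreal (norm (s i \<theta> - s' i \<theta>))
          \<le> ennreal (norm (h \<theta> - s i \<theta>)) + ennreal (\<phi> \<theta>) + ennreal (norm (h' \<theta> - s' i \<theta>))"
        using nonneg by (simp add: ennreal_leI flip: ennreal_plus)
    qed
    also have "\<dots> = (\<integral>\<^sup>+\<theta>. ennreal (norm (h \<theta> - s i \<theta>)) \<partial>M) + (\<integral>\<^sup>+\<theta>. ennreal (\<phi> \<theta>) \<partial>M)
        + (\<integral>\<^sup>+\<theta>. ennreal (norm (h' \<theta> - s' i \<theta>)) \<partial>M)"
      by (simp add: nn_integral_add)
    finally show ?thesis .
  qed
  moreover have "(\<lambda>i. (\<integral>\<^sup>+\<theta>. ennreal (norm (h \<theta> - s i \<theta>)) \<partial>M) + (\<integral>\<^sup>+\<theta>. ennreal (\<phi> \<theta>) \<partial>M)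
        + (\<integral>\<^sup>+\<theta>. ennreal (norm (h' \<theta> - s' i \<theta>)) \<partial>M)) \<longlonglongrightarrow> 0 + (\<integral>\<^sup>+\<theta>. ennreal (\<phi> \<theta>) \<partial>M) + 0"
    by (intro tendsto_add tendsto_const s(2) s'(2))
  moreover have "(\<lambda>i. ennreal (norm (Bochner_Integration.simple_bochner_integral M (s i) - Bochner_Integration.simple_bochner_integral M (s' i))))
      \<longlonglongrightarrow> ennreal (norm (x - x'))"
    by (intro tendsto_ennrealI tendsto_norm tendsto_diff s(3) s'(3))
  ultimately have "ennreal (norm (x - x')) \<le> 0 + (\<integral>\<^sup>+\<theta>. ennreal (\<phi> \<theta>) \<partial>M) + 0"
    using LIMSEQ_le by blast
  then show ?thesis by simp
qed

lemma bochner_integral_eq: "has_bochner M h x \<Longrightarrow> bochner_integral M h = x"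
  unfolding bochner_integral_def
proof (rule the_equality)
  fix y assume "has_bochner M h x" "has_bochner M h y"
  then have "ennreal (norm (y - x)) \<le> (\<integral>\<^sup>+\<theta>. ennreal 0 \<partial>M)"
    by (intro has_bochner_norm_diff_le) auto
  then show "y = x" by simp
qed

lemma has_bochner_bochner_integral: "bochner_integrable M h \<Longrightarrow> has_bochner M h (bochner_integral M h)"
  using bochner_integral_eq unfolding bochner_integrable_def by metis

lemma has_bochner_zero: "has_bochner M (\<lambda>_::'a. 0::'b::real_normed_vector) 0"
proof -
  have i: "Bochner_Integration.simple_bochner_integrable M (\<lambda>_::'a. 0::'b)"
    by (auto intro!: simple_bochner_integrable.intros)
  have "Bochner_Integration.simple_bochner_integral M (\<lambda>_::'a. 0::'b) = 0"
    unfolding simple_bochner_integral_def by (rule sum.neutral) auto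
  with i show ?thesis
    unfolding has_bochner_def by (intro conjI exI[of _ "\<lambda>_ _. 0"]) simp_all
qed

lemma has_bochner_norm_le:
  assumes "has_bochner M h x" "\<phi> \<in> borel_measurable M" "\<And>\<theta>. \<theta> \<in> space M \<Longrightarrow> norm (h \<theta>) \<le> \<phi> \<theta>"
  shows "ennreal (norm x) \<le> (\<integral>\<^sup>+\<theta>. ennreal (\<phi> \<theta>) \<partial>M)"
  using has_bochner_norm_diff_le[OF assms(1) has_bochner_zero assms(2)] assms(3) by simp

text \<open>
  Measurability of the sum is a hypothesis because it does not follow from that of the summands.
\<close>

lemma has_bochner_add:
  assumes h: "has_bochner M h x" and h': "has_bochner M h' x'"
    and g: "g \<in> borel_measurable M" "\<And>\<theta>. \<theta> \<in> space M \<Longrightarrow> g \<theta> = h \<theta> + h' \<theta>"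
  shows "has_bochner M g (x + x')"
proof -
  obtain s where s: "\<forall>i. Bochner_Integration.simple_bochner_integrable M (s i)"
    "(\<lambda>i. \<integral>\<^sup>+\<theta>. ennreal (norm (h \<theta> - s i \<theta>)) \<partial>M) \<longlonglongrightarrow> 0"
    "(\<lambda>i. Bochner_Integration.simple_bochner_integral M (s i)) \<longlonglongrightarrow> x"
    by (rule has_bochnerE[OF h])
  obtain s' where s': "\<forall>i. Bochner_Integration.simple_bochner_integrable M (s' i)"
    "(\<lambda>i. \<integral>\<^sup>+\<theta>. ennreal (norm (h' \<theta> - s' i \<theta>)) \<partial>M) \<longlonglongrightarrow> 0"
    "(\<lambda>i. Bochner_Integration.simple_bochner_integral M (s' i)) \<longlonglongrightarrow> x'"
    by (rule has_bochnerE[OF h'])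
  have [measurable]: "(\<lambda>\<theta>. norm (h \<theta> - s i \<theta>)) \<in> borel_measurable M"
    "(\<lambda>\<theta>. norm (h' \<theta> - s' i \<theta>)) \<in> borel_measurable M" for i
    using s(1) s'(1) has_bochner_diff_simple_measurable[OF h] has_bochner_diff_simple_measurable[OF h'] by auto
  have "Bochner_Integration.simple_bochner_integrable M (\<lambda>\<theta>. s i \<theta> + s' i \<theta>)" for i
    using s(1) s'(1) by (intro simple_bochner_integrable_compose2[where p = "(+)"]) auto
  moreover have "(\<lambda>i. \<integral>\<^sup>+\<theta>. ennreal (norm (g \<theta> - (s i \<theta> + s' i \<theta>))) \<partial>M) \<longlonglongrightarrow> 0"
  proof (rule tendsto_sandwich[OF always_eventually always_eventually tendsto_const])
    have "(\<integral>\<^sup>+\<theta>. ennreal (norm (g \<theta> - (s i \<theta> + s' i \<theta>))) \<partial>M)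
        \<le> (\<integral>\<^sup>+\<theta>. ennreal (norm (h \<theta> - s i \<theta>)) + ennreal (norm (h' \<theta> - s' i \<theta>)) \<partial>M)" for i
    proof (rule nn_integral_mono)
      fix \<theta> assume "\<theta> \<in> space M"
      then have "g \<theta> - (s i \<theta> + s' i \<theta>) = (h \<theta> - s i \<theta>) + (h' \<theta> - s' i \<theta>)" by (simp add: g(2))
      then have "norm (g \<theta> - (s i \<theta> + s' i \<theta>)) \<le> norm (h \<theta> - s i \<theta>) + norm (h' \<theta> - s' i \<theta>)"
        by (simp only: norm_triangle_ineq)
      then show "ennreal (norm (g \<theta> - (s i \<theta> + s' i \<theta>))) \<le> ennreal (norm (h \<theta> - s i \<theta>)) + ennreal (norm (h' \<theta> - s' i \<theta>))"
        by (simp add: ennreal_leI flip: ennreal_plus)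
    qed
    then show "\<forall>i. (\<integral>\<^sup>+\<theta>. ennreal (norm (g \<theta> - (s i \<theta> + s' i \<theta>))) \<partial>M)
        \<le> (\<integral>\<^sup>+\<theta>. ennreal (norm (h \<theta> - s i \<theta>)) \<partial>M) + (\<integral>\<^sup>+\<theta>. ennreal (norm (h' \<theta> - s' i \<theta>)) \<partial>M)"
      by (simp add: nn_integral_add)
    show "(\<lambda>i. (\<integral>\<^sup>+\<theta>. ennreal (norm (h \<theta> - s i \<theta>)) \<partial>M) + (\<integral>\<^sup>+\<theta>. ennreal (norm (h' \<theta> - s' i \<theta>)) \<partial>M)) \<longlonglongrightarrow> 0"
      using tendsto_add[OF s(2) s'(2)] by simp
  qed simp
  moreover have "(\<lambda>i. Bochner_Integration.simple_bochner_integral M (\<lambda>\<theta>. s i \<theta> + s' i \<theta>)) \<longlonglongrightarrow> x + x'"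
    using tendsto_add[OF s(3) s'(3)] s(1) s'(1) by (simp add: simple_bochner_integral_add)
  ultimately show ?thesis
    unfolding has_bochner_def using g(1) by (intro conjI exI[of _ "\<lambda>i \<theta>. s i \<theta> + s' i \<theta>"]) auto
qed

lemma has_bochner_bounded_linear:
  assumes T: "bounded_linear T" and h: "has_bochner M h x"
    and g: "g \<in> borel_measurable M" "\<And>\<theta>. \<theta> \<in> space M \<Longrightarrow> g \<theta> = T (h \<theta>)"
  shows "has_bochner M g (T x)"
proof -
  interpret T: bounded_linear T by fact
  obtain s where s: "\<forall>i. Bochner_Integration.simple_bochner_integrable M (s i)"
    "(\<lambda>i. \<integral>\<^sup>+\<theta>. ennreal (norm (h \<theta> - s i \<theta>)) \<partial>M) \<longlonglongrightarrow> 0"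
    "(\<lambda>i. Bochner_Integration.simple_bochner_integral M (s i)) \<longlonglongrightarrow> x"
    by (rule has_bochnerE[OF h])
  have [measurable]: "(\<lambda>\<theta>. norm (h \<theta> - s i \<theta>)) \<in> borel_measurable M" for i
    using s(1) has_bochner_diff_simple_measurable[OF h] by auto
  obtain K where K: "K \<ge> 0" "\<And>v. norm (T v) \<le> norm v * K" using T.nonneg_bounded by blast
  have "Bochner_Integration.simple_bochner_integrable M (\<lambda>\<theta>. T (s i \<theta>))" for i
    using s(1) by (intro simple_bochner_integrable_compose2[where p = "\<lambda>v _. T v"]) (auto simp: T.zero)
  moreover have "(\<lambda>i. \<integral>\<^sup>+\<theta>. ennreal (norm (g \<theta> - T (s i \<theta>))) \<partial>M) \<longlonglongrightarrow> 0"
  proof (rule tendsto_sandwich[OF always_eventually always_eventually tendsto_const])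
    have "(\<integral>\<^sup>+\<theta>. ennreal (norm (g \<theta> - T (s i \<theta>))) \<partial>M)
        \<le> (\<integral>\<^sup>+\<theta>. ennreal K * ennreal (norm (h \<theta> - s i \<theta>)) \<partial>M)" for i
    proof (rule nn_integral_mono)
      fix \<theta> assume "\<theta> \<in> space M"
      then have "norm (g \<theta> - T (s i \<theta>)) \<le> K * norm (h \<theta> - s i \<theta>)"
        using K(2)[of "h \<theta> - s i \<theta>"] by (simp add: g(2) T.diff mult.commute)
      then show "ennreal (norm (g \<theta> - T (s i \<theta>))) \<le> ennreal K * ennreal (norm (h \<theta> - s i \<theta>))"
        using K(1) by (simp add: ennreal_leI flip: ennreal_mult)
    qed
    then show "\<forall>i. (\<integral>\<^sup>+\<theta>. ennreal (norm (g \<theta> - T (s i \<theta>))) \<partial>M)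
        \<le> ennreal K * (\<integral>\<^sup>+\<theta>. ennreal (norm (h \<theta> - s i \<theta>)) \<partial>M)"
      by (simp add: nn_integral_cmult)
    show "(\<lambda>i. ennreal K * (\<integral>\<^sup>+\<theta>. ennreal (norm (h \<theta> - s i \<theta>)) \<partial>M)) \<longlonglongrightarrow> 0"
      using ennreal_tendsto_cmult[OF _ s(2), of "ennreal K"] by simp
  qed simp
  moreover have "(\<lambda>i. Bochner_Integration.simple_bochner_integral M (\<lambda>\<theta>. T (s i \<theta>))) \<longlonglongrightarrow> T x"
    using T.tendsto[OF s(3)] s(1) by (simp add: simple_bochner_integral_linear[OF T.linear])
  ultimately show ?thesis
    unfolding has_bochner_def using g(1) by (intro conjI exI[of _ "\<lambda>i \<theta>. T (s i \<theta>)"]) auto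
qed


section \<open>The operator on continuous functions\<close>

text \<open>
  Continuity at zero, rescaled to the sphere of radius \<open>d / 2\<close>.
\<close>

lemma bounded_linear_if_continuous:
  fixes f :: "'a::real_normed_vector \<Rightarrow> 'b::real_normed_vector"
  assumes f: "linear f" and "continuous_on UNIV f"
  shows "bounded_linear f"
proof -
  interpret linear f by fact
  have "continuous (at 0) f" using assms(2) by (simp add: continuous_on_eq_continuous_at)
  then obtain d where d: "d > 0" "\<And>x. norm x < d \<Longrightarrow> norm (f x) < 1"
    unfolding continuous_at_eps_delta by (metis dist_norm diff_zero zero zero_less_one)
  have "norm (f x) \<le> norm x * (2 / d)" for x
  proof (cases "x = 0")
    case False
    let ?c = "d / (2 * norm x)"
    have c: "?c > 0" using False d(1) by simp
    have "norm (?c *\<^sub>R x) < d" using False d(1) by simp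
    then have "?c * norm (f x) < 1" using d(2)[of "?c *\<^sub>R x"] c False d(1) by (simp add: scale)
    then show ?thesis using False d(1) by (simp add: field_simps)
  qed (simp add: zero)
  then show ?thesis by (intro bounded_linear_intro[where K = "2 / d"]) (auto simp: add scale)
qed

lemma (in hilbert_space) bounded_linear_if_linear_smul:
  assumes lin: "Vector_Spaces.linear smul smul f" and cont: "continuous_on UNIV f"
  shows "bounded_linear f"
proof (rule bounded_linear_if_continuous[OF _ cont])
  show "linear f"
  proof (rule linearI)
    show "f (x + y) = f x + f y" "f (r *\<^sub>R x) = r *\<^sub>R f x" for x y r
      using lin unfolding module_hom_iff_linear[symmetric] module_hom_iff
      by (simp_all flip: smul_of_real)
  qed
qed

text \<open>
  Two distinct points are needed since the supremum of the empty set of reals is unspecified.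
\<close>

lemma lipschitz_constant_nonneg:
  fixes g :: "'t::metric_space \<Rightarrow> 't"
  assumes L: "L-lipschitz_on UNIV g" and st: "(s::'t) \<noteq> t"
  shows "lipschitz_constant g \<ge> 0"
proof -
  let ?q = "\<lambda>(s, t). dist (g s) (g t) / dist s t"
  have "bdd_above (?q ` {(s, t). s \<noteq> t})"
  proof (rule bdd_aboveI2)
    fix p assume "p \<in> {(s :: 't, t). s \<noteq> t}"
    then show "?q p \<le> L"
      using lipschitz_onD[OF L, of "fst p" "snd p"] by (auto simp: pos_divide_le_eq)
  qed
  then show ?thesis
    unfolding lipschitz_constant_def using st by (intro cSUP_upper2[of _ _ "(s, t)"]) auto
qed

locale random_operators = hilbert_space smul ip
  for smul :: "'k::real_or_complex \<Rightarrow> 'x::banach \<Rightarrow> 'x" and ip :: "'x \<Rightarrow> 'x \<Rightarrow> 'k" +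
  fixes W :: "'th measure"
    and \<omega> :: "'t::metric_space \<times> 'th \<Rightarrow> 't"
    and R :: "'x \<times> 'th \<Rightarrow> 'x"
  assumes compact_T: "compact (UNIV :: 't set)"
    and \<omega>_measurable: "\<omega> \<in> borel \<Otimes>\<^sub>M W \<rightarrow>\<^sub>M borel"
    and \<omega>_continuous: "\<And>\<theta>. \<theta> \<in> space W \<Longrightarrow> continuous_on UNIV (\<lambda>t. \<omega> (t, \<theta>))"
    and R_linear: "\<And>\<theta>. \<theta> \<in> space W \<Longrightarrow> Vector_Spaces.linear smul smul (\<lambda>x. R (x, \<theta>))"
    and R_continuous: "\<And>\<theta>. \<theta> \<in> space W \<Longrightarrow> continuous_on UNIV (\<lambda>x. R (x, \<theta>))"
    and onorm_measurable: "(\<lambda>\<theta>. onorm (\<lambda>x. R (x, \<theta>))) \<in> borel_measurable W"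
    and onorm_integral_finite: "(\<integral>\<^sup>+\<theta>. ennreal (onorm (\<lambda>x. R (x, \<theta>))) \<partial>W) < \<infinity>"
    and integrable:
      "\<And>(f :: 't \<Rightarrow>\<^sub>C 'x) t. bochner_integrable W (\<lambda>\<theta>. R (apply_bcontfun f (\<omega> (t, \<theta>)), \<theta>))"
begin

lemma R_add: "\<theta> \<in> space W \<Longrightarrow> R (x + y, \<theta>) = R (x, \<theta>) + R (y, \<theta>)"
  and R_smul: "\<theta> \<in> space W \<Longrightarrow> R (smul c x, \<theta>) = smul c (R (x, \<theta>))"
  using R_linear unfolding module_hom_iff_linear[symmetric] module_hom_iff by blast+

lemma R_bounded_linear: "\<theta> \<in> space W \<Longrightarrow> bounded_linear (\<lambda>x. R (x, \<theta>))"
  by (rule bounded_linear_if_linear_smul[OF R_linear R_continuous])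

definition mean_norm :: real where
  "mean_norm = (\<integral>\<theta>. onorm (\<lambda>x. R (x, \<theta>)) \<partial>W)"

lemma nn_integral_onorm: "(\<integral>\<^sup>+\<theta>. ennreal (onorm (\<lambda>x. R (x, \<theta>))) \<partial>W) = ennreal mean_norm"
proof -
  have nonneg: "AE \<theta> in W. 0 \<le> onorm (\<lambda>x. R (x, \<theta>))"
    by (intro AE_I2 onorm_pos_le R_bounded_linear)
  then have "integrable W (\<lambda>\<theta>. onorm (\<lambda>x. R (x, \<theta>)))"
    by (intro integrableI_nonneg onorm_measurable onorm_integral_finite)
  then show ?thesis unfolding mean_norm_def using nonneg by (rule nn_integral_eq_integral)
qed

lemma mean_norm_nonneg: "mean_norm \<ge> 0"
  unfolding mean_norm_def by (intro integral_nonneg_AE AE_I2 onorm_pos_le R_bounded_linear)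

lemma continuous_bcontfun:
  fixes f :: "'t \<Rightarrow> 'y::real_normed_vector"
  assumes "continuous_on UNIV f"
  shows "apply_bcontfun (Bcontfun f) = f"
proof (rule Bcontfun_inverse)
  have "bounded (range f)" using compact_continuous_image[OF assms compact_T] by (rule compact_imp_bounded)
  then show "f \<in> bcontfun" using assms by (simp add: bcontfun_def)
qed

definition H :: "('t \<Rightarrow> 'x) \<Rightarrow> 't \<Rightarrow> 'x" where
  "H f t = bochner_integral W (\<lambda>\<theta>. R (f (\<omega> (t, \<theta>)), \<theta>))"

lemma has_bochner_H:
  assumes "continuous_on UNIV f"
  shows "has_bochner W (\<lambda>\<theta>. R (f (\<omega> (t, \<theta>)), \<theta>)) (H f t)"
  unfolding H_def using has_bochner_bochner_integral[OF integrable[of "Bcontfun f" t]]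
  by (simp add: continuous_bcontfun[OF assms])

lemma H_add:
  assumes f: "continuous_on UNIV f" and g: "continuous_on UNIV g"
  shows "H (\<lambda>t. f t + g t) t = H f t + H g t"
  unfolding H_def[of "\<lambda>t. f t + g t"]
  using has_bochner_measurable[OF has_bochner_H[OF continuous_on_add[OF f g]]] R_add
  by (intro bochner_integral_eq has_bochner_add[OF has_bochner_H[OF f] has_bochner_H[OF g]]) auto

lemma H_smul:
  assumes f: "continuous_on UNIV f"
  shows "H (\<lambda>t. smul c (f t)) t = smul c (H f t)"
  unfolding H_def[of "\<lambda>t. smul c (f t)"]
  using has_bochner_measurable[OF has_bochner_H[OF bounded_linear.continuous_on[OF bounded_linear_smul f]]] R_smul
  by (intro bochner_integral_eq has_bochner_bounded_linear[OF bounded_linear_smul has_bochner_H[OF f]]) auto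

lemma norm_H_le:
  assumes f: "continuous_on UNIV f" and C: "\<And>t. norm (f t) \<le> C"
  shows "norm (H f t) \<le> C * mean_norm"
proof -
  have C0: "C \<ge> 0" by (rule order_trans[OF norm_ge_zero C])
  have "ennreal (norm (H f t)) \<le> (\<integral>\<^sup>+\<theta>. ennreal (onorm (\<lambda>x. R (x, \<theta>)) * C) \<partial>W)"
  proof (rule has_bochner_norm_le[OF has_bochner_H[OF f]])
    fix \<theta> assume \<theta>: "\<theta> \<in> space W"
    have "norm (R (f (\<omega> (t, \<theta>)), \<theta>)) \<le> onorm (\<lambda>x. R (x, \<theta>)) * norm (f (\<omega> (t, \<theta>)))"
      by (rule onorm[OF R_bounded_linear[OF \<theta>]])
    also have "\<dots> \<le> onorm (\<lambda>x. R (x, \<theta>)) * C"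
      by (intro mult_left_mono C onorm_pos_le R_bounded_linear \<theta>)
    finally show "norm (R (f (\<omega> (t, \<theta>)), \<theta>)) \<le> onorm (\<lambda>x. R (x, \<theta>)) * C" .
  qed (use onorm_measurable in measurable)
  also have "\<dots> = (\<integral>\<^sup>+\<theta>. ennreal (onorm (\<lambda>x. R (x, \<theta>))) * ennreal C \<partial>W)"
    by (intro nn_integral_cong ennreal_mult onorm_pos_le R_bounded_linear C0)
  also have "\<dots> = ennreal mean_norm * ennreal C"
    using onorm_measurable by (simp add: nn_integral_multc nn_integral_onorm)
  also have "\<dots> = ennreal (C * mean_norm)"
    using C0 mean_norm_nonneg by (simp add: ennreal_mult mult.commute)
  finally show ?thesis using C0 mean_norm_nonneg by (simp add: ennreal_le_iff)
qed

text \<open>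
  Uniform approximation of \<open>f\<close> by simple functions makes the norm of the increment a pointwise
  limit of simple real functions.
\<close>

lemma increment_measurable:
  assumes f: "continuous_on UNIV (f :: 't \<Rightarrow> 'x)"
  shows "(\<lambda>\<theta>. norm (f (\<omega> (s, \<theta>)) - f (\<omega> (t, \<theta>)))) \<in> borel_measurable W"
proof -
  obtain g where "\<forall>n. simple_function borel (g n)" "uniform_limit UNIV g f sequentially"
    by (rule simple_functions_uniform_limit[OF compact_T f])
  then have g: "simple_function borel (g n)" "uniform_limit UNIV g f sequentially" for n by simp_all
  have \<omega>s: "(\<lambda>\<theta>. \<omega> (u, \<theta>)) \<in> W \<rightarrow>\<^sub>M borel" for u
    using measurable_compose[OF measurable_Pair1' \<omega>_measurable, of u] by simp
  have lim: "(\<lambda>n. g n u) \<longlonglongrightarrow> f u" for u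
    using g(2) by (rule tendsto_uniform_limitI) simp
  show ?thesis
  proof (rule borel_measurable_LIMSEQ_real)
    show "(\<lambda>n. norm (g n (\<omega> (s, \<theta>)) - g n (\<omega> (t, \<theta>)))) \<longlonglongrightarrow> norm (f (\<omega> (s, \<theta>)) - f (\<omega> (t, \<theta>)))" for \<theta>
      by (intro tendsto_norm tendsto_diff lim)
    show "(\<lambda>\<theta>. norm (g n (\<omega> (s, \<theta>)) - g n (\<omega> (t, \<theta>)))) \<in> borel_measurable W" for n
      by (intro borel_measurable_simple_function
          simple_function_compose2[OF simple_function_comp[OF \<omega>s g(1)] simple_function_comp[OF \<omega>s g(1)]])
  qed
qed

text \<open>
  Dominated convergence with the majorants \<open>\<parallel>R\<^sub>\<theta>\<parallel> \<parallel>f (\<omega>\<^sub>\<theta> (u n)) - f (\<omega>\<^sub>\<theta> t)\<parallel>\<close> of the increments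
  of the integrand, which are bounded by \<open>2 C \<parallel>R\<^sub>\<theta>\<parallel>\<close>.
\<close>

lemma continuous_on_H:
  assumes f: "continuous_on UNIV f"
  shows "continuous_on UNIV (H f)"
proof (rule continuous_on_sequentiallyI)
  fix u :: "nat \<Rightarrow> 't" and t assume u: "u \<longlonglongrightarrow> t"
  have "bounded (range f)" using compact_continuous_image[OF f compact_T] by (rule compact_imp_bounded)
  then obtain C where C: "\<And>t. norm (f t) \<le> C" unfolding bounded_iff by blast
  have C0: "C \<ge> 0" by (rule order_trans[OF norm_ge_zero C])
  define \<phi> where "\<phi> n \<theta> = onorm (\<lambda>x. R (x, \<theta>)) * norm (f (\<omega> (u n, \<theta>)) - f (\<omega> (t, \<theta>)))" for n \<theta>
  note [measurable] = onorm_measurable increment_measurable[OF f]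
  have [measurable]: "\<phi> n \<in> borel_measurable W" for n unfolding \<phi>_def by measurable
  have le: "ennreal (norm (H f (u n) - H f t)) \<le> (\<integral>\<^sup>+\<theta>. ennreal (\<phi> n \<theta>) \<partial>W)" for n
  proof (rule has_bochner_norm_diff_le[OF has_bochner_H[OF f] has_bochner_H[OF f]])
    fix \<theta> assume \<theta>: "\<theta> \<in> space W"
    have "R (f (\<omega> (u n, \<theta>)), \<theta>) - R (f (\<omega> (t, \<theta>)), \<theta>) = R (f (\<omega> (u n, \<theta>)) - f (\<omega> (t, \<theta>)), \<theta>)"
      by (rule linear_diff[OF bounded_linear.linear[OF R_bounded_linear[OF \<theta>]], symmetric])
    then show "norm (R (f (\<omega> (u n, \<theta>)), \<theta>) - R (f (\<omega> (t, \<theta>)), \<theta>)) \<le> \<phi> n \<theta>"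
      unfolding \<phi>_def using onorm[OF R_bounded_linear[OF \<theta>]] by simp
  qed simp
  have "(\<lambda>n. \<integral>\<^sup>+\<theta>. ennreal (\<phi> n \<theta>) \<partial>W) \<longlonglongrightarrow> (\<integral>\<^sup>+\<theta>. 0 \<partial>W)"
  proof (rule nn_integral_dominated_convergence[where w = "\<lambda>\<theta>. ennreal (onorm (\<lambda>x. R (x, \<theta>))) * ennreal (2 * C)"])
    show "AE \<theta> in W. ennreal (\<phi> n \<theta>) \<le> ennreal (onorm (\<lambda>x. R (x, \<theta>))) * ennreal (2 * C)" for n
    proof (rule AE_I2)
      fix \<theta> assume \<theta>: "\<theta> \<in> space W"
      have "norm (f (\<omega> (u n, \<theta>)) - f (\<omega> (t, \<theta>))) \<le> 2 * C"
        using norm_triangle_ineq4[of "f (\<omega> (u n, \<theta>))" "f (\<omega> (t, \<theta>))"] C[of "\<omega> (u n, \<theta>)"] C[of "\<omega> (t, \<theta>)"]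
        by linarith
      then have "\<phi> n \<theta> \<le> onorm (\<lambda>x. R (x, \<theta>)) * (2 * C)"
        unfolding \<phi>_def by (intro mult_left_mono onorm_pos_le R_bounded_linear \<theta>)
      then show "ennreal (\<phi> n \<theta>) \<le> ennreal (onorm (\<lambda>x. R (x, \<theta>))) * ennreal (2 * C)"
        using C0 onorm_pos_le[OF R_bounded_linear[OF \<theta>]] by (simp add: ennreal_leI flip: ennreal_mult)
    qed
    show "(\<integral>\<^sup>+\<theta>. ennreal (onorm (\<lambda>x. R (x, \<theta>))) * ennreal (2 * C) \<partial>W) < \<infinity>"
      by (simp add: nn_integral_multc nn_integral_onorm ennreal_mult_less_top)
    show "AE \<theta> in W. (\<lambda>n. ennreal (\<phi> n \<theta>)) \<longlonglongrightarrow> 0"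
    proof (rule AE_I2)
      fix \<theta> assume \<theta>: "\<theta> \<in> space W"
      have "continuous_on UNIV (\<lambda>t. f (\<omega> (t, \<theta>)))"
        by (rule continuous_on_compose2[OF f \<omega>_continuous[OF \<theta>]]) simp
      then have "(\<lambda>n. f (\<omega> (u n, \<theta>))) \<longlonglongrightarrow> f (\<omega> (t, \<theta>))"
        by (rule continuous_on_tendsto_compose[OF _ u]) simp_all
      then have "(\<lambda>n. \<phi> n \<theta>) \<longlonglongrightarrow> onorm (\<lambda>x. R (x, \<theta>)) * norm (f (\<omega> (t, \<theta>)) - f (\<omega> (t, \<theta>)))"
        unfolding \<phi>_def by (intro tendsto_intros)
      then show "(\<lambda>n. ennreal (\<phi> n \<theta>)) \<longlonglongrightarrow> 0"
        using tendsto_ennrealI[of "\<lambda>n. \<phi> n \<theta>" 0] by simp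
    qed
  qed measurable
  then have lim: "(\<lambda>n. \<integral>\<^sup>+\<theta>. ennreal (\<phi> n \<theta>) \<partial>W) \<longlonglongrightarrow> 0" by simp
  have "(\<lambda>n. ennreal (norm (H f (u n) - H f t))) \<longlonglongrightarrow> 0"
    by (rule tendsto_sandwich[OF _ _ tendsto_const lim]) (simp_all add: always_eventually le)
  then have "(\<lambda>n. norm (H f (u n) - H f t)) \<longlonglongrightarrow> 0"
    using tendsto_ennreal_iff[of "\<lambda>n. norm (H f (u n) - H f t)" sequentially 0] by simp
  then show "(\<lambda>n. H f (u n)) \<longlonglongrightarrow> H f t" by (simp add: LIM_zero_iff tendsto_norm_zero_iff)
qed

lemma apply_H_C: "apply_bcontfun (H_C W R \<omega> f) = H (apply_bcontfun f)"
proof -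
  have "H_C W R \<omega> f = Bcontfun (H (apply_bcontfun f))"
    by (simp add: H_C_def H_def[abs_def])
  then show ?thesis by (simp add: continuous_bcontfun continuous_on_H)
qed


section \<open>The operator on vector measures\<close>

lemma Phi_eqD:
  fixes m m' :: "('t, 'x) cabv"
  assumes "Phi ip m = Phi ip m'"
  shows "m = m'"
proof -
  have "m - m' = 0"
  proof (rule cabv_eq_0_if_integrals_vanish[OF compact_T])
    fix f :: "'t \<Rightarrow> 'x" assume f: "continuous_on UNIV f"
    have "sesq_integral ip f m = sesq_integral ip f m'"
      using fun_cong[OF assms, of "Bcontfun f"] by (simp add: Phi_def continuous_bcontfun[OF f])
    then show "sesq_integral ip f (m - m') = 0"
      using sesq_integral_add_measure[OF compact_T f, of "m - m'" m'] by simp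
  qed
  then show ?thesis by simp
qed

text \<open>
  The functional \<open>f \<mapsto> \<integral> H f d\<mu>\<close> has norm at most \<open>mean_norm * \<parallel>\<mu>\<parallel>\<close>, and the representing measure
  inherits this bound.
\<close>

lemma exists_adjoint_measure:
  fixes \<mu> :: "('t, 'x) cabv"
  shows "\<exists>\<nu>. Phi ip \<nu> = H_C_adjoint W R \<omega> (Phi ip \<mu>) \<and> norm \<nu> \<le> mean_norm * norm \<mu>"
proof -
  interpret Y: scalar_functional_on_continuous smul ip "\<lambda>f. sesq_integral ip (H f) \<mu>" "mean_norm * norm \<mu>"
  proof
    fix f g :: "'t \<Rightarrow> 'x" and c and C :: real assume f: "continuous_on UNIV f"
    show "sesq_integral ip (H (\<lambda>t. smul c (f t))) \<mu> = c * sesq_integral ip (H f) \<mu>"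
      unfolding H_smul[OF f, abs_def] by (rule sesq_integral_smul[OF compact_T continuous_on_H[OF f]])
    show "sesq_integral ip (H (\<lambda>t. f t + g t)) \<mu> = sesq_integral ip (H f) \<mu> + sesq_integral ip (H g) \<mu>"
      if g: "continuous_on UNIV g"
      unfolding H_add[OF f g, abs_def]
      by (rule sesq_integral_add[OF compact_T continuous_on_H[OF f] continuous_on_H[OF g]])
    show "norm (sesq_integral ip (H f) \<mu>) \<le> C * (mean_norm * norm \<mu>)" if C: "\<And>t. norm (f t) \<le> C"
      using norm_sesq_integral_le[OF compact_T continuous_on_H[OF f] norm_H_le[OF f C]] by (simp only: mult.assoc)
  qed (rule compact_T)
  have "Phi ip Y.rep_measure = H_C_adjoint W R \<omega> (Phi ip \<mu>)"
    by (rule ext) (simp add: Phi_def H_C_adjoint_def apply_H_C Y.sesq_integral_rep_measure)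
  then show ?thesis using Y.norm_rep_measure_le by blast
qed

lemma Phi_H_op: "Phi ip (H_op ip W R \<omega> \<mu>) = H_C_adjoint W R \<omega> (Phi ip \<mu>)"
  and norm_H_op_le: "norm (H_op ip W R \<omega> \<mu>) \<le> mean_norm * norm \<mu>"
  for \<mu> :: "('t, 'x) cabv"
proof -
  obtain \<nu> where \<nu>: "Phi ip \<nu> = H_C_adjoint W R \<omega> (Phi ip \<mu>)" "norm \<nu> \<le> mean_norm * norm \<mu>"
    using exists_adjoint_measure by blast
  have "inj (Phi ip :: ('t, 'x) cabv \<Rightarrow> _)" by (rule injI) (rule Phi_eqD)
  then have "H_op ip W R \<omega> \<mu> = \<nu>"
    unfolding H_op_def o_apply \<nu>(1)[symmetric] by (rule inv_f_f)
  with \<nu> show "Phi ip (H_op ip W R \<omega> \<mu>) = H_C_adjoint W R \<omega> (Phi ip \<mu>)"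
    "norm (H_op ip W R \<omega> \<mu>) \<le> mean_norm * norm \<mu>" by simp_all
qed

lemma Phi_add: "Phi ip (m + m') F = Phi ip m F + Phi ip m' F" for m m' :: "('t, 'x) cabv"
  by (simp add: Phi_def sesq_integral_add_measure[OF compact_T])

lemma Phi_smul: "Phi ip (smul_cabv smul c m) F = kcnj c * Phi ip m F" for m :: "('t, 'x) cabv"
  by (simp add: Phi_def sesq_integral_smul_measure[OF compact_T])

lemma H_op_add: "H_op ip W R \<omega> (m + m') = H_op ip W R \<omega> m + H_op ip W R \<omega> m'"
  for m m' :: "('t, 'x) cabv"
  by (rule Phi_eqD, rule ext) (simp add: Phi_H_op H_C_adjoint_def Phi_add)

lemma H_op_smul: "H_op ip W R \<omega> (smul_cabv smul c m) = smul_cabv smul c (H_op ip W R \<omega> m)"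
  for m :: "('t, 'x) cabv"
  by (rule Phi_eqD, rule ext) (simp add: Phi_H_op H_C_adjoint_def Phi_smul)

end

theorem theorem4p4:
  fixes smul :: "'k::real_or_complex \<Rightarrow> 'x::banach \<Rightarrow> 'x"
    and ip :: "'x \<Rightarrow> 'x \<Rightarrow> 'k"
    and W :: "'th measure"
    and \<omega> :: "'t::metric_space \<times> 'th \<Rightarrow> 't"
    and R :: "'x \<times> 'th \<Rightarrow> 'x"
  assumes hilbert: "hilbert_space smul ip"
    and X_nonnull: "\<exists>x::'x. x \<noteq> 0"
    and T_compact: "compact (UNIV :: 't set)"
    and T_two_elements: "\<exists>s t::'t. s \<noteq> t"
    and \<omega>_measurable: "\<omega> \<in> borel \<Otimes>\<^sub>M W \<rightarrow>\<^sub>M borel"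
    and R_measurable: "R \<in> borel \<Otimes>\<^sub>M W \<rightarrow>\<^sub>M borel"
    and R_linear: "\<And>\<theta>. \<theta> \<in> space W \<Longrightarrow> Vector_Spaces.linear smul smul (\<lambda>x. R (x, \<theta>))"
    and R_continuous: "\<And>\<theta>. \<theta> \<in> space W \<Longrightarrow> continuous_on UNIV (\<lambda>x. R (x, \<theta>))"
    and \<omega>_lipschitz: "\<And>\<theta>. \<theta> \<in> space W \<Longrightarrow> \<exists>L. L-lipschitz_on UNIV (\<lambda>t. \<omega> (t, \<theta>))"
    and onorm_measurable: "(\<lambda>\<theta>. onorm (\<lambda>x. R (x, \<theta>))) \<in> borel_measurable W"
    and finite_integral:
      "(\<integral>\<^sup>+\<theta>. ennreal (onorm (\<lambda>x. R (x, \<theta>)) * (1 + lipschitz_constant (\<lambda>t. \<omega> (t, \<theta>)))) \<partial>W) < \<infinity>"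
    and bochner_integrable:
      "\<And>(f :: 't \<Rightarrow>\<^sub>C 'x) t.
        bochner_integrable W (\<lambda>\<theta>. R (apply_bcontfun f (\<omega> (t, \<theta>)), \<theta>))"
  shows "Vector_Spaces.linear (smul_cabv smul) (smul_cabv smul)
           (H_op ip W R \<omega> :: ('t, 'x) cabv \<Rightarrow> ('t, 'x) cabv)
       \<and> continuous_on UNIV (H_op ip W R \<omega> :: ('t, 'x) cabv \<Rightarrow> ('t, 'x) cabv)
       \<and> onorm (H_op ip W R \<omega> :: ('t, 'x) cabv \<Rightarrow> ('t, 'x) cabv)
           \<le> (\<integral>\<theta>. onorm (\<lambda>x. R (x, \<theta>)) \<partial>W)"
proof -
  interpret hilbert_space smul ip by (rule hilbert)
  \<comment> \<open>Here the factor \<open>1 + r\<^sub>\<theta>\<close> is at least one.\<close>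
  have onorm_finite: "(\<integral>\<^sup>+\<theta>. ennreal (onorm (\<lambda>x. R (x, \<theta>))) \<partial>W) < \<infinity>"
  proof (rule le_less_trans[OF nn_integral_mono finite_integral])
    fix \<theta> assume \<theta>: "\<theta> \<in> space W"
    have "0 \<le> onorm (\<lambda>x. R (x, \<theta>))"
      by (intro onorm_pos_le bounded_linear_if_linear_smul R_linear R_continuous \<theta>)
    moreover have "0 \<le> lipschitz_constant (\<lambda>t. \<omega> (t, \<theta>))"
      using \<omega>_lipschitz[OF \<theta>] T_two_elements lipschitz_constant_nonneg by blast
    ultimately have "onorm (\<lambda>x. R (x, \<theta>)) * 1 \<le> onorm (\<lambda>x. R (x, \<theta>)) * (1 + lipschitz_constant (\<lambda>t. \<omega> (t, \<theta>)))"
      by (intro mult_left_mono) auto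
    then show "ennreal (onorm (\<lambda>x. R (x, \<theta>)))
        \<le> ennreal (onorm (\<lambda>x. R (x, \<theta>)) * (1 + lipschitz_constant (\<lambda>t. \<omega> (t, \<theta>))))"
      by (simp add: ennreal_leI)
  qed
  have \<omega>_continuous: "continuous_on UNIV (\<lambda>t. \<omega> (t, \<theta>))" if "\<theta> \<in> space W" for \<theta>
    using \<omega>_lipschitz[OF that] lipschitz_on_continuous_on by blast
  interpret random_operators smul ip W \<omega> R
    by (intro random_operators.intro hilbert random_operators_axioms.intro T_compact \<omega>_measurable
        \<omega>_continuous R_linear R_continuous onorm_measurable onorm_finite bochner_integrable)
  let ?H = "H_op ip W R \<omega> :: ('t, 'x) cabv \<Rightarrow> ('t, 'x) cabv"
  have "Vector_Spaces.linear (smul_cabv smul) (smul_cabv smul) ?H"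
    unfolding module_hom_iff_linear[symmetric] module_hom_iff module_iff_vector_space
    using vector_space_smul_cabv H_op_add H_op_smul by blast
  moreover have "bounded_linear ?H"
  proof (rule bounded_linear_intro[where K = mean_norm])
    show "?H (r *\<^sub>R m) = r *\<^sub>R ?H m" for r m
      using H_op_smul[of "of_real r" m] by (simp only: smul_cabv_of_real)
    show "norm (?H m) \<le> norm m * mean_norm" for m
      using norm_H_op_le[of m] by (simp only: mult.commute)
  qed (rule H_op_add)
  then have "continuous_on UNIV ?H" by (rule linear_continuous_on)
  moreover have "onorm ?H \<le> mean_norm"
    by (rule onorm_bound[OF mean_norm_nonneg norm_H_op_le])
  ultimately show ?thesis unfolding mean_norm_def by blast
qed

end
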